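(* Let $d\ge2$, $\boldsymbol{\nu}\in\mathbb{N}_0^d$, and $x\in[a,b]\subset\mathbb{R}$. Suppose that $\theta,\phi:\mathbb{R}^{d+1}\to\mathbb{R}$ and the density $\rho$ satisfy Assumption 1, and Assumption 2 for $q\in\{0,1\}$ and all $\boldsymbol{\eta}\le\boldsymbol{\nu}$, with constants $B_{q,\boldsymbol{\eta}}$ (both assumptions are stated in the context). (i) The function $g(y_0,\boldsymbol{y}):=\theta(y_0,\boldsymbol{y})\,\mathrm{ind}(x-\phi(y_0,\boldsymbol{y}))$ satisfies $P_0g\in\mathcal{H}^{\boldsymbol{\nu}}_d\cap C^{\boldsymbol{\nu}}(\mathbb{R}^d)$, with its $\mathcal{H}^{\boldsymbol{\nu}}_d$-norm bounded uniformly in $x$, $$\|P_0g\|_{\mathcal{H}^{\boldsymbol{\nu}}_d}\le\Big(2\|\theta\|^2_{\mathcal{H}^{(0,\boldsymbol{\nu})}_{d+1}}+2\sum_{\boldsymbol{0}\ne\boldsymbol{\eta}\le\boldsymbol{\nu}}\frac{\big(8^{|\boldsymbol{\eta}|-1}(|\boldsymbol{\eta}|-1)!\big)^2B_{0,\boldsymbol{\eta}}}{\gamma_{\boldsymbol{\eta}}}\Big)^{1/2}<\infty.$$ (ii) In the case where $\theta\equiv1$, we have $$\|P_0g\|_{\mathcal{H}^{\boldsymbol{\nu}}_d}\le\Big(1+\sum_{\boldsymbol{0}\ne\boldsymbol{\eta}\le\boldsymbol{\nu}}\frac{\big(8^{|\boldsymbol{\eta}|-1}(|\boldsymbol{\eta}|-1)!\big)^2B_{0,\boldsymbol{\eta}}}{\gamma_{\boldsymbol{\eta}}}\Big)^{1/2}<\infty.$$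 (iii) The function $g(y_0,\boldsymbol{y}):=\delta(x-\phi(y_0,\boldsymbol{y}))$ satisfies $P_0g\in\mathcal{H}^{\boldsymbol{\nu}}_d\cap C^{\boldsymbol{\nu}}(\mathbb{R}^d)$, with $$\|P_0g\|_{\mathcal{H}^{\boldsymbol{\nu}}_d}\le\Big(\sum_{\boldsymbol{\eta}\le\boldsymbol{\nu}}\frac{\big(8^{|\boldsymbol{\eta}|}|\boldsymbol{\eta}|!\big)^2B_{1,\boldsymbol{\eta}}}{\gamma_{\boldsymbol{\eta}}}\Big)^{1/2}<\infty.$$
   Context: **Notation.** Points of $\mathbb{R}^{d+1}$ are written $(y_0,\boldsymbol{y})$ with $y_0\in\mathbb{R}$, $\boldsymbol{y}=(y_1,\ldots,y_d)\in\mathbb{R}^d$. For a multi-index $\boldsymbol{\eta}$, $D^{\boldsymbol{\eta}}=\prod_i\partial^{\eta_i}/\partial y_i^{\eta_i}$ and $|\boldsymbol{\eta}|=\sum_i\eta_i$; $D^i=\partial/\partial y_i$ (in particular $D^0=\partial/\partial y_0$); $\boldsymbol{e}_i$ is the $i$th unit multi-index; inequalities between multi-indices are componentwise. $C^{\boldsymbol{\nu}}(\mathbb{R}^{m})$ is the space of continuous functions $\varphi$ on $\mathbb{R}^m$ with $D^{\boldsymbol{\eta}}\varphi$ continuous for all $\boldsymbol{\eta}\le\boldsymbol{\nu}$. $\mathrm{ind}(z)=1$ if $z\ge0$ and $0$ otherwise; $\delta$ is the Dirac delta. **Sobolev spaces.** $\rho$ is a probability density on $\mathbb{R}$ with cumulative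 distribution function $\Phi$. Fix weights $\gamma_{\mathfrak{u}}>0$ for $\mathfrak{u}\subseteq\{0,1,\ldots,d\}$, and weight functions $\psi_i:\mathbb{R}\to\mathbb{R}_+$, $i=0,\ldots,d$, with $\int_{-\infty}^\infty\psi_i(y)\,dy=1$ and $\int_{-\infty}^\infty\Phi(y)(1-\Phi(y))/\psi_i(y)\,dy<\infty$. For $\boldsymbol{\nu}\in\mathbb{N}_0^{d+1}$, $\mathcal{H}^{\boldsymbol{\nu}}_{d+1}$ consists of locally integrable $h$ on $\mathbb{R}^{d+1}$ with $$\|h\|^2_{\mathcal{H}^{\boldsymbol{\nu}}_{d+1}}=\sum_{\boldsymbol{\eta}\le\boldsymbol{\nu}}\frac1{\gamma_{\boldsymbol{\eta}}}\int_{\mathbb{R}^{d+1}}|D^{\boldsymbol{\eta}}h(y_0,\boldsymbol{y})|^2\,\boldsymbol{\psi}_{\boldsymbol{\eta}}(\boldsymbol{y}_{\boldsymbol{\eta}})\,\boldsymbol{\rho}_{-\boldsymbol{\eta}}(\boldsymbol{y}_{-\boldsymbol{\eta}})\,dy_0\,d\boldsymbol{y}<\infty,$$ where $\gamma_{\boldsymbol{\eta}}:=\gamma_{\{i:\eta_i\ne0\}}$, $\boldsymbol{\psi}_{\boldsymbol{\eta}}(\boldsymbol{y}_{\boldsymbol{\eta}}):=\prod_{i:\eta_i\ne0}\psi_i(y_i)$, $\boldsymbol{\rho}_{-\boldsymbol{\eta}}(\boldsymbol{y}_{-\boldsymbol{\eta}}):=\prod_{i:\eta_i=0}\rho(y_i)$.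 $\mathcal{H}^{\boldsymbol{\nu}}_d$, $\boldsymbol{\nu}\in\mathbb{N}_0^d$, is the analogous space on $\mathbb{R}^d$ obtained by omitting $y_0$ (indices $i=1,\ldots,d$). **Assumption 1** (for $\boldsymbol{\nu}\in\mathbb{N}_0^d$). (1) $D^0\phi(y_0,\boldsymbol{y})>0$ for all $(y_0,\boldsymbol{y})\in\mathbb{R}^{d+1}$; (2) for each $\boldsymbol{y}\in\mathbb{R}^d$, $\phi(y_0,\boldsymbol{y})\to\infty$ as $y_0\to\infty$; (3) $\theta,\phi\in\mathcal{H}^{(\nu_0,\boldsymbol{\nu})}_{d+1}\cap C^{(\nu_0,\boldsymbol{\nu})}(\mathbb{R}^{d+1})$ with $\nu_0=|\boldsymbol{\nu}|+1$; (4) $\rho\in C^{\nu_0-1}(\mathbb{R})$. **$U_x$ and $\xi$.** For $x\in[a,b]$, $U_x:=\{\boldsymbol{y}\in\mathbb{R}^d:\phi(y_0,\boldsymbol{y})=x\text{ for some }y_0\in\mathbb{R}\}$, and for $\boldsymbol{y}\in U_x$, $\xi(x,\boldsymbol{y})$ is the unique real number with $\phi(\xi(x,\boldsymbol{y}),\boldsymbol{y})=x$. **Assumption 2** (for $q\in\mathbb{N}_0$ and $\boldsymbol{\eta}\le\boldsymbol{\nu}$ with $|\boldsymbol{\eta}|+q\le|\boldsymbol{\nu}|+1$). Consider all functions of the form $$h_{q,\boldsymbol{\eta}}(x,\boldsymbol{y})=\frac{(-1)^r\,D^{\boldsymbol{\mu}}\theta(\xi(x,\boldsymbol{y}),\boldsymbol{y})\,\rho^{(\beta)}(\xi(x,\boldsymbol{y}))\,\prod_{\ell=1}^rD^{\boldsymbol{\alpha}_\ell}\phi(\xi(x,\boldsymbol{y}),\boldsymbol{y})}{[D^0\phi(\xi(x,\boldsymbol{y}),\boldsymbol{y})]^{r+q}},\quad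 x\in[a,b],\ \boldsymbol{y}\in U_x,$$ with $r\in\mathbb{N}_0$, $\boldsymbol{\alpha}_1,\ldots,\boldsymbol{\alpha}_r\in\mathbb{N}_0^{d+1}\setminus\{\boldsymbol{e}_0,\boldsymbol{0}\}$, $\beta\in\mathbb{N}_0$, $\boldsymbol{\mu}\in\mathbb{N}_0^{d+1}$ satisfying $r\le2|\boldsymbol{\eta}|+q-1$, $\alpha_{\ell,0}\le|\boldsymbol{\eta}|+q$, $\beta\le|\boldsymbol{\eta}|+q-1$, $|\boldsymbol{\mu}|\le|\boldsymbol{\eta}|$, and $\boldsymbol{\mu}+\beta\boldsymbol{e}_0+\sum_{\ell=1}^r\boldsymbol{\alpha}_\ell=(r+q-1,\boldsymbol{\eta})$. All such functions are assumed to satisfy: for all $x\in[a,b]$, $h_{q,\boldsymbol{\eta}}(x,\boldsymbol{y})\to0$ as $\boldsymbol{y}$ approaches the boundary $\partial U_x$; and there is a constant $B_{q,\boldsymbol{\eta}}<\infty$ with $$\sup_{x\in[a,b]}\int_{U_x}|h_{q,\boldsymbol{\eta}}(x,\boldsymbol{y})|^2\,\boldsymbol{\psi}_{\boldsymbol{\eta}}(\boldsymbol{y}_{\boldsymbol{\eta}})\,\boldsymbol{\rho}_{-\boldsymbol{\eta}}(\boldsymbol{y}_{-\boldsymbol{\eta}})\,d\boldsymbol{y}\le B_{q,\boldsymbol{\eta}}.$$ **Preintegration.** $P_0g(\boldsymbol{y}):=\int_{-\infty}^\infty g(y_0,\boldsymbol{y})\rho(y_0)\,dy_0$. For $\boldsymbol{y}\in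 U_x$ this is $\int_{-\infty}^{\xi(x,\boldsymbol{y})}\theta(y_0,\boldsymbol{y})\rho(y_0)\,dy_0$ when $g=\theta\,\mathrm{ind}(x-\phi)$, and $\frac{\partial}{\partial x}\Phi(\xi(x,\boldsymbol{y}))=\rho(\xi(x,\boldsymbol{y}))/D^0\phi(\xi(x,\boldsymbol{y}),\boldsymbol{y})$ when $g=\delta(x-\phi)$; in all cases $P_0g(\boldsymbol{y})=0$ for $\boldsymbol{y}\in\mathbb{R}^d\setminus U_x$.
   Formalization: Part (i) also assumes that the integrals of |D^(0,η)θ|ρ over y_0≤R tend to 0 as R→−∞, locally uniformly in y (else P_0g can be discontinuous); the bound in (ii) assumes γ_∅=1 (false for small γ_∅); (iii) takes θ≡1 in Assumption 2 (θ=0 refutes it as stated). *)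

theory Defs
  imports "HOL-Analysis.Analysis" "HOL-Probability.Distribution_Functions"
begin

text \<open>
  Points of \<open>d\<close>-dimensional space are vectors \<open>real ^ 'd\<close>. The space with one more
  coordinate is \<open>real ^ ('d option)\<close>: the index \<open>None\<close> is the coordinate \<open>y\<^sub>0\<close>, and the index
  \<open>Some i\<close> is the coordinate \<open>y\<^sub>i\<close>. Multi-indices are functions from indices to \<open>nat\<close>;
  the order \<open>\<eta> \<le> \<nu>\<close> on functions is the componentwise one.
  All integrals are with respect to \<open>lborel\<close>, so measurable means Borel measurable.
\<close>

definition vcons :: "real \<Rightarrow> real ^ 'd \<Rightarrow> real ^ ('d::finite option)" where
  "vcons y0 y = (\<chi> i. case_option y0 (\<lambda>j. y $ j) i)"

definition mcons :: "nat \<Rightarrow> ('d \<Rightarrow> nat) \<Rightarrow> 'd option \<Rightarrow> nat" where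
  "mcons k \<nu> = case_option k \<nu>"

definition mabs :: "('n::finite \<Rightarrow> nat) \<Rightarrow> nat" where
  "mabs \<eta> = (\<Sum>i\<in>UNIV. \<eta> i)"

definition munit :: "'n \<Rightarrow> 'n \<Rightarrow> nat" where
  "munit i = (\<lambda>j. if j = i then 1 else 0)"


section \<open>Classical mixed partial derivatives\<close>

definition partial_differentiable :: "'n \<Rightarrow> (real ^ 'n::finite \<Rightarrow> real) \<Rightarrow> bool" where
  "partial_differentiable i f \<longleftrightarrow>
     (\<forall>y. (\<lambda>t. f (y + t *\<^sub>R axis i 1)) field_differentiable (at 0))"

definition partial :: "'n \<Rightarrow> (real ^ 'n::finite \<Rightarrow> real) \<Rightarrow> real ^ 'n \<Rightarrow> real" where
  "partial i f = (\<lambda>y. deriv (\<lambda>t. f (y + t *\<^sub>R axis i 1)) 0)"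

text \<open>
  \<open>C_mixed \<nu>\<close> asks for the derivatives up to \<open>\<nu>\<close> taken in every order; a list of indices
  records one such order. By the symmetry of continuous mixed derivatives the result depends
  only on how often each index occurs, so that the choice of the list in \<open>D\<close> is immaterial
  for functions in \<open>C_mixed \<eta>\<close>.
\<close>

definition C_mixed :: "('n \<Rightarrow> nat) \<Rightarrow> (real ^ 'n::finite \<Rightarrow> real) set" where
  "C_mixed \<nu> = {f. \<forall>is. (\<forall>i. count_list is i \<le> \<nu> i) \<longrightarrow>
     continuous_on UNIV (foldr partial is f) \<and>
     (\<forall>i. count_list is i < \<nu> i \<longrightarrow> partial_differentiable i (foldr partial is f))}"

definition D :: "('n \<Rightarrow> nat) \<Rightarrow> (real ^ 'n::finite \<Rightarrow> real) \<Rightarrow> real ^ 'n \<Rightarrow> real" where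
  "D \<eta> f = foldr partial (SOME is. \<forall>i. count_list is i = \<eta> i) f"

definition C_real :: "nat \<Rightarrow> (real \<Rightarrow> real) set" where
  "C_real n = {f. (\<forall>k\<le>n. continuous_on UNIV ((deriv ^^ k) f)) \<and>
     (\<forall>k<n. \<forall>t. (deriv ^^ k) f field_differentiable (at t))}"


section \<open>Weak derivatives and weighted Sobolev spaces\<close>

definition locally_integrable :: "(real ^ 'n::finite \<Rightarrow> real) \<Rightarrow> bool" where
  "locally_integrable u \<longleftrightarrow>
     u \<in> borel_measurable borel \<and> (\<forall>K. compact K \<longrightarrow> set_integrable lborel K u)"

definition test_function :: "(real ^ 'n::finite \<Rightarrow> real) \<Rightarrow> bool" where
  "test_function v \<longleftrightarrow> (\<forall>\<nu>. v \<in> C_mixed \<nu>) \<and> compact (closure {y. v y \<noteq> 0})"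

definition has_weak_deriv ::
  "('n \<Rightarrow> nat) \<Rightarrow> (real ^ 'n::finite \<Rightarrow> real) \<Rightarrow> (real ^ 'n \<Rightarrow> real) \<Rightarrow> bool" where
  "has_weak_deriv \<eta> u w \<longleftrightarrow> locally_integrable w \<and>
     (\<forall>v. test_function v \<longrightarrow>
        (LINT y|lborel. u y * D \<eta> v y) = (- 1) ^ mabs \<eta> * (LINT y|lborel. w y * v y))"

definition weak_D :: "('n \<Rightarrow> nat) \<Rightarrow> (real ^ 'n::finite \<Rightarrow> real) \<Rightarrow> real ^ 'n \<Rightarrow> real" where
  "weak_D \<eta> u = (SOME w. has_weak_deriv \<eta> u w)"

definition mixed_weight ::
  "('n::finite \<Rightarrow> real \<Rightarrow> real) \<Rightarrow> (real \<Rightarrow> real) \<Rightarrow> ('n \<Rightarrow> nat) \<Rightarrow> real ^ 'n \<Rightarrow> real" where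
  "mixed_weight \<psi> \<rho> \<eta> y =
     (\<Prod>i\<in>{i. \<eta> i \<noteq> 0}. \<psi> i (y $ i)) * (\<Prod>i\<in>{i. \<eta> i = 0}. \<rho> (y $ i))"

definition sobolev_sqnorm ::
  "('n set \<Rightarrow> real) \<Rightarrow> ('n \<Rightarrow> real \<Rightarrow> real) \<Rightarrow> (real \<Rightarrow> real) \<Rightarrow> ('n \<Rightarrow> nat) \<Rightarrow>
   (real ^ 'n::finite \<Rightarrow> real) \<Rightarrow> ennreal" where
  "sobolev_sqnorm \<gamma> \<psi> \<rho> \<nu> h =
     (\<Sum>\<eta>\<in>{\<eta>. \<eta> \<le> \<nu>}. ennreal (1 / \<gamma> {i. \<eta> i \<noteq> 0}) *
        (\<integral>\<^sup>+ y. ennreal (\<bar>weak_D \<eta> h y\<bar>\<^sup>2 * mixed_weight \<psi> \<rho> \<eta> y) \<partial>lborel))"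

definition sobolev ::
  "('n set \<Rightarrow> real) \<Rightarrow> ('n \<Rightarrow> real \<Rightarrow> real) \<Rightarrow> (real \<Rightarrow> real) \<Rightarrow> ('n \<Rightarrow> nat) \<Rightarrow>
   (real ^ 'n::finite \<Rightarrow> real) set" where
  "sobolev \<gamma> \<psi> \<rho> \<nu> = {h. locally_integrable h \<and>
     (\<forall>\<eta>\<le>\<nu>. \<exists>w. has_weak_deriv \<eta> h w) \<and> sobolev_sqnorm \<gamma> \<psi> \<rho> \<nu> h < \<infinity>}"

text \<open>Meaningful only for members of \<^const>\<open>sobolev\<close>, because \<open>enn2real \<infinity> = 0\<close>.\<close>

definition sobolev_norm ::
  "('n set \<Rightarrow> real) \<Rightarrow> ('n \<Rightarrow> real \<Rightarrow> real) \<Rightarrow> (real \<Rightarrow> real) \<Rightarrow> ('n \<Rightarrow> nat) \<Rightarrow>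
   (real ^ 'n::finite \<Rightarrow> real) \<Rightarrow> real" where
  "sobolev_norm \<gamma> \<psi> \<rho> \<nu> h = sqrt (enn2real (sobolev_sqnorm \<gamma> \<psi> \<rho> \<nu> h))"

text \<open>The spaces on \<open>real ^ 'd\<close> use the weights of the larger space with \<open>y\<^sub>0\<close> omitted.\<close>

abbreviation drop0_weights :: "('d option set \<Rightarrow> real) \<Rightarrow> 'd set \<Rightarrow> real" where
  "drop0_weights \<gamma> \<equiv> (\<lambda>u. \<gamma> (Some ` u))"

abbreviation drop0 :: "('d option \<Rightarrow> real \<Rightarrow> real) \<Rightarrow> 'd \<Rightarrow> real \<Rightarrow> real" where
  "drop0 \<psi> \<equiv> (\<lambda>i. \<psi> (Some i))"

definition sobolev_drop0 ::
  "('d option set \<Rightarrow> real) \<Rightarrow> ('d option \<Rightarrow> real \<Rightarrow> real) \<Rightarrow> (real \<Rightarrow> real) \<Rightarrow> ('d \<Rightarrow> nat) \<Rightarrow>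
   (real ^ 'd::finite \<Rightarrow> real) set" where
  "sobolev_drop0 \<gamma> \<psi> \<rho> \<nu> = sobolev (drop0_weights \<gamma>) (drop0 \<psi>) \<rho> \<nu>"

definition sobolev_drop0_norm ::
  "('d option set \<Rightarrow> real) \<Rightarrow> ('d option \<Rightarrow> real \<Rightarrow> real) \<Rightarrow> (real \<Rightarrow> real) \<Rightarrow> ('d \<Rightarrow> nat) \<Rightarrow>
   (real ^ 'd::finite \<Rightarrow> real) \<Rightarrow> real" where
  "sobolev_drop0_norm \<gamma> \<psi> \<rho> \<nu> h = sobolev_norm (drop0_weights \<gamma>) (drop0 \<psi>) \<rho> \<nu> h"


section \<open>Density and weight functions\<close>

definition probability_density :: "(real \<Rightarrow> real) \<Rightarrow> bool" where
  "probability_density \<rho> \<longleftrightarrow> \<rho> \<in> borel_measurable borel \<and> (\<forall>t. 0 \<le> \<rho> t) \<and>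
     (\<integral>\<^sup>+ t. ennreal (\<rho> t) \<partial>lborel) = 1"

definition distr_fun :: "(real \<Rightarrow> real) \<Rightarrow> real \<Rightarrow> real" where
  "distr_fun \<rho> = cdf (density lborel (\<lambda>t. ennreal (\<rho> t)))"

text \<open>
  The quotient is taken in \<^typ>\<open>ennreal\<close>, where \<open>c / 0 = \<infinity>\<close> for \<open>c > 0\<close>; division in
  \<^typ>\<open>real\<close> would ignore the zeros of the weight function.
\<close>

definition weight_function :: "(real \<Rightarrow> real) \<Rightarrow> (real \<Rightarrow> real) \<Rightarrow> bool" where
  "weight_function \<rho> w \<longleftrightarrow> w \<in> borel_measurable borel \<and> (\<forall>t. 0 \<le> w t) \<and>
     (\<integral>\<^sup>+ t. ennreal (w t) \<partial>lborel) = 1 \<and>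
     (\<integral>\<^sup>+ t. ennreal (distr_fun \<rho> t * (1 - distr_fun \<rho> t)) / ennreal (w t) \<partial>lborel) < \<infinity>"


section \<open>Preintegration\<close>

definition ind :: "real \<Rightarrow> real" where
  "ind z = (if z \<ge> 0 then 1 else 0)"

definition U :: "(real ^ ('d::finite option) \<Rightarrow> real) \<Rightarrow> real \<Rightarrow> (real ^ 'd) set" where
  "U \<phi> x = {y. \<exists>y0. \<phi> (vcons y0 y) = x}"

definition xi :: "(real ^ ('d::finite option) \<Rightarrow> real) \<Rightarrow> real \<Rightarrow> real ^ 'd \<Rightarrow> real" where
  "xi \<phi> x y = (THE y0. \<phi> (vcons y0 y) = x)"

definition P0 ::
  "(real \<Rightarrow> real) \<Rightarrow> (real ^ ('d::finite option) \<Rightarrow> real) \<Rightarrow> real ^ 'd \<Rightarrow> real" where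
  "P0 \<rho> g y = (LINT y0|lborel. g (vcons y0 y) * \<rho> y0)"

text \<open>
  The Dirac delta is not a function; \<open>P0_delta \<rho> \<phi> x\<close> is the meaning of \<open>P0 \<rho> g\<close> for
  \<open>g = \<delta>(x - \<phi>)\<close>. For \<open>\<rho>\<close> continuous and \<open>\<phi>\<close> continuously differentiable in \<open>y\<^sub>0\<close> with positive
  derivative, its value on \<open>U \<phi> x\<close> is \<open>\<rho>(\<xi>(x,y)) / D\<^sup>0\<phi>(\<xi>(x,y),y)\<close>.
\<close>

definition P0_delta ::
  "(real \<Rightarrow> real) \<Rightarrow> (real ^ ('d::finite option) \<Rightarrow> real) \<Rightarrow> real \<Rightarrow> real ^ 'd \<Rightarrow> real" where
  "P0_delta \<rho> \<phi> x y =
     (if y \<in> U \<phi> x then deriv (\<lambda>s. distr_fun \<rho> (xi \<phi> s y)) x else 0)"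


section \<open>Assumptions on the integrand\<close>

definition assumption1 ::
  "('d::finite option set \<Rightarrow> real) \<Rightarrow> ('d option \<Rightarrow> real \<Rightarrow> real) \<Rightarrow> (real \<Rightarrow> real) \<Rightarrow>
   ('d \<Rightarrow> nat) \<Rightarrow> (real ^ ('d option) \<Rightarrow> real) \<Rightarrow> (real ^ ('d option) \<Rightarrow> real) \<Rightarrow> bool" where
  "assumption1 \<gamma> \<psi> \<rho> \<nu> \<theta> \<phi> \<longleftrightarrow> (let \<nu>0 = mabs \<nu> + 1 in
     (\<forall>z. D (munit None) \<phi> z > 0) \<and>
     (\<forall>y. filterlim (\<lambda>y0. \<phi> (vcons y0 y)) at_top at_top) \<and>
     \<theta> \<in> sobolev \<gamma> \<psi> \<rho> (mcons \<nu>0 \<nu>) \<inter> C_mixed (mcons \<nu>0 \<nu>) \<and>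
     \<phi> \<in> sobolev \<gamma> \<psi> \<rho> (mcons \<nu>0 \<nu>) \<inter> C_mixed (mcons \<nu>0 \<nu>) \<and>
     \<rho> \<in> C_real (\<nu>0 - 1))"

text \<open>
  In \<open>h_fun\<close> and \<open>h_admissible\<close> the list \<open>\<alpha>s\<close> has length \<open>r\<close>. Constraints involving a
  difference are stated with \<open>1\<close> added to both sides, since subtraction on \<open>nat\<close> truncates.
\<close>

definition h_fun ::
  "(real \<Rightarrow> real) \<Rightarrow> (real ^ ('d::finite option) \<Rightarrow> real) \<Rightarrow> (real ^ ('d option) \<Rightarrow> real) \<Rightarrow> nat \<Rightarrow>
   ('d option \<Rightarrow> nat) list \<Rightarrow> nat \<Rightarrow> ('d option \<Rightarrow> nat) \<Rightarrow> real \<Rightarrow> real ^ 'd \<Rightarrow> real" where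
  "h_fun \<rho> \<theta> \<phi> q \<alpha>s \<beta> \<mu> x y = (let t = xi \<phi> x y; z = vcons t y; r = length \<alpha>s in
     (- 1) ^ r * D \<mu> \<theta> z * (deriv ^^ \<beta>) \<rho> t * (\<Prod>\<alpha>\<leftarrow>\<alpha>s. D \<alpha> \<phi> z)
       / D (munit None) \<phi> z ^ (r + q))"

definition h_admissible ::
  "nat \<Rightarrow> ('d::finite \<Rightarrow> nat) \<Rightarrow> ('d option \<Rightarrow> nat) list \<Rightarrow> nat \<Rightarrow> ('d option \<Rightarrow> nat) \<Rightarrow> bool" where
  "h_admissible q \<eta> \<alpha>s \<beta> \<mu> \<longleftrightarrow> (let r = length \<alpha>s in
     (\<forall>\<alpha>\<in>set \<alpha>s. \<alpha> \<noteq> (\<lambda>_. 0) \<and> \<alpha> \<noteq> munit None \<and> \<alpha> None \<le> mabs \<eta> + q) \<and>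
     r + 1 \<le> 2 * mabs \<eta> + q \<and>
     \<beta> + 1 \<le> mabs \<eta> + q \<and>
     mabs \<mu> \<le> mabs \<eta> \<and>
     \<mu> None + \<beta> + (\<Sum>\<alpha>\<leftarrow>\<alpha>s. \<alpha> None) + 1 = r + q \<and>
     (\<forall>i. \<mu> (Some i) + (\<Sum>\<alpha>\<leftarrow>\<alpha>s. \<alpha> (Some i)) = \<eta> i))"

definition assumption2 ::
  "('d::finite option \<Rightarrow> real \<Rightarrow> real) \<Rightarrow> (real \<Rightarrow> real) \<Rightarrow>
   (real ^ ('d option) \<Rightarrow> real) \<Rightarrow> (real ^ ('d option) \<Rightarrow> real) \<Rightarrow> real \<Rightarrow> real \<Rightarrow>
   nat \<Rightarrow> ('d \<Rightarrow> nat) \<Rightarrow> real \<Rightarrow> bool" where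
  "assumption2 \<psi> \<rho> \<theta> \<phi> a b q \<eta> B \<longleftrightarrow> 0 \<le> B \<and>
     (\<forall>\<alpha>s \<beta> \<mu>. h_admissible q \<eta> \<alpha>s \<beta> \<mu> \<longrightarrow>
        (\<forall>x\<in>{a..b}. \<forall>p\<in>frontier (U \<phi> x).
           (h_fun \<rho> \<theta> \<phi> q \<alpha>s \<beta> \<mu> x \<longlongrightarrow> 0) (at p within U \<phi> x)) \<and>
        (SUP x\<in>{a..b}. \<integral>\<^sup>+ y\<in>U \<phi> x.
           ennreal (\<bar>h_fun \<rho> \<theta> \<phi> q \<alpha>s \<beta> \<mu> x y\<bar>\<^sup>2 * mixed_weight (drop0 \<psi>) \<rho> \<eta> y) \<partial>lborel)
          \<le> ennreal B)"

text \<open>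
  The condition under which \<open>\<integral>\<^bsub>-\<infinity>\<^esub>\<^bsup>t\<^esup> \<theta>(y\<^sub>0,y) \<rho>(y\<^sub>0) dy\<^sub>0\<close> may be differentiated in \<open>y\<close> under
  the integral sign: the integrals of the derivatives converge at \<open>-\<infinity>\<close>, uniformly for \<open>y\<close> in
  compact sets. It does not follow from membership of \<open>\<theta>\<close> in the Sobolev space: bumps of
  \<open>\<theta>\<close> that escape to \<open>y\<^sub>0 = -\<infinity>\<close> as \<open>y\<close> tends to a limit can have small norm and unit integral.
  Constant \<open>\<theta>\<close> satisfies it for every probability density \<open>\<rho>\<close>.
\<close>

definition uniform_lower_tails ::
  "(real \<Rightarrow> real) \<Rightarrow> ('d::finite \<Rightarrow> nat) \<Rightarrow> (real ^ ('d option) \<Rightarrow> real) \<Rightarrow> bool" where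
  "uniform_lower_tails \<rho> \<nu> \<theta> \<longleftrightarrow> (\<forall>\<eta>\<le>\<nu>. \<forall>K. compact K \<longrightarrow>
     ((\<lambda>R. SUP y\<in>K. \<integral>\<^sup>+ y0\<in>{..R}. ennreal (\<bar>D (mcons 0 \<eta>) \<theta> (vcons y0 y)\<bar> * \<rho> y0) \<partial>lborel)
        \<longlongrightarrow> 0) at_bot)"

end

theory Submission
  imports Defs
begin

text \<open>
  On \<open>U \<phi> x\<close> the implicit function \<open>\<xi>\<close> satisfies \<open>\<partial>\<^sub>i\<xi> = - \<partial>\<^sub>i\<phi> / \<partial>\<^sub>0\<phi>\<close>. Hence a derivative of the
  preintegrated function is an integral of a derivative of \<open>\<theta>\<close> over \<open>y\<^sub>0 \<le> \<xi>\<close> (absent for the delta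
  function) plus a sum of functions \<open>h_fun\<close>, and differentiating one admissible \<open>h_fun\<close> of order
  \<open>\<eta>\<close> gives fewer than \<open>8 |\<eta>| + 6 q\<close> admissible ones, whence the factors \<open>8 ^ n * fact n\<close>.
  All these functions tend to \<open>0\<close> at the frontier of \<open>U \<phi> x\<close>, where \<open>\<xi>\<close> tends to \<open>-\<infinity>\<close>, so that their
  extensions by \<open>0\<close> are the continuous classical derivatives on the whole space. Classical
  derivatives are weak ones, these are unique almost everywhere, and the norm bounds follow from
  the Cauchy-Schwarz inequality.
\<close>

section \<open>Mixed partial derivatives\<close>

text \<open>The obstacle is the frontier of \<open>U \<phi> x\<close>: nothing is known about its
  shape, and no derivative can be computed at its points. A derivative there is obtained by a mean
  value argument, which presupposes that the candidate for it is already continuous on the whole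
  space. So the candidates of all orders are written down as lists of formal terms before any of
  them is shown to be a derivative, with one list entry per differentiation, and admissibility is
  the invariant that lets Assumption 2 apply to each term. Differentiating through \<xi> keeps the
  balance between the orders in y0 and the number r of factors, because each factor D_i \<phi>
  gained comes with one more power of 1 / D_0 \<phi> and one more derivative in y0. The Sobolev norm
  is built from arbitrarily chosen weak derivatives, so their uniqueness is needed, and for this
  enough compactly supported smooth functions have to be constructed. The factors 2 in the first
  bound are the price of separating the integral from the terms \<open>h_fun\<close>. For constant
  \<theta> the integral has zero integrand at every nonzero order, so they disappear.\<close>

lemma partial_eqI:
  "((\<lambda>t. f (y + t *\<^sub>R axis i 1)) has_real_derivative d) (at 0) \<Longrightarrow> partial i f y = d"
  by (simp add: partial_def DERIV_imp_deriv)

lemma partial_differentiableI: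
  assumes "\<And>y. ((\<lambda>t. f (y + t *\<^sub>R axis i 1)) has_real_derivative d y) (at 0)"
  shows "partial_differentiable i f" "partial i f = d"
  using assms unfolding partial_differentiable_def
  by (auto simp: field_differentiable_def intro!: ext partial_eqI)

lemma has_partial:
  assumes "partial_differentiable i f"
  shows "((\<lambda>t. f (y + t *\<^sub>R axis i 1)) has_real_derivative partial i f (y + s *\<^sub>R axis i 1)) (at s)"
proof -
  have "((\<lambda>t. f ((y + s *\<^sub>R axis i 1) + t *\<^sub>R axis i 1)) has_real_derivative
      partial i f (y + s *\<^sub>R axis i 1)) (at 0)"
    using assms unfolding partial_differentiable_def partial_def
    by (meson DERIV_deriv_iff_field_differentiable)
  then have "((\<lambda>t. f (y + t *\<^sub>R axis i 1)) has_real_derivative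
      partial i f (y + s *\<^sub>R axis i 1)) (at (0 + s))"
    by (subst DERIV_shift) (simp add: algebra_simps)
  then show ?thesis by simp
qed

lemma has_partial_0:
  assumes "partial_differentiable i f"
  shows "((\<lambda>t. f (y + t *\<^sub>R axis i 1)) has_real_derivative partial i f y) (at 0)"
  using has_partial[OF assms, of y 0] by simp

lemma partial_MVT:
  assumes "partial_differentiable i f" "a < b"
  obtains c where "a < c" "c < b"
    "f (y + b *\<^sub>R axis i 1) - f (y + a *\<^sub>R axis i 1) = (b - a) * partial i f (y + c *\<^sub>R axis i 1)"
  using MVT2[OF assms(2), of "\<lambda>t. f (y + t *\<^sub>R axis i 1)" "\<lambda>s. partial i f (y + s *\<^sub>R axis i 1)"]
    has_partial[OF assms(1)] by blast

text \<open>Two mean value theorems: one in direction \<open>i\<close> for the increment of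
  \<open>f\<close> across a step \<open>h\<close> in direction \<open>j\<close>, then one in
  direction \<open>j\<close>. The left-hand side is symmetric in \<open>i\<close> and
  \<open>j\<close>, so it can be evaluated in either order.\<close>

lemma second_difference:
  assumes "partial_differentiable i f" "partial_differentiable j (partial i f)" "h > 0"
  obtains s t where "0 < s" "s < h" "0 < t" "t < h"
    "f (y + h *\<^sub>R axis i 1 + h *\<^sub>R axis j 1) - f (y + h *\<^sub>R axis i 1) - f (y + h *\<^sub>R axis j 1) + f y
      = h * h * partial j (partial i f) (y + s *\<^sub>R axis i 1 + t *\<^sub>R axis j 1)"
proof -
  define g where "g s = f ((y + h *\<^sub>R axis j 1) + s *\<^sub>R axis i 1) - f (y + s *\<^sub>R axis i 1)" for s
  have "(g has_real_derivative partial i f ((y + h *\<^sub>R axis j 1) + s *\<^sub>R axis i 1)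
      - partial i f (y + s *\<^sub>R axis i 1)) (at s)" for s
    unfolding g_def by (intro DERIV_diff has_partial assms)
  from MVT2[OF \<open>h > 0\<close> this] obtain s where s: "0 < s" "s < h"
    "g h - g 0 = h * (partial i f ((y + h *\<^sub>R axis j 1) + s *\<^sub>R axis i 1) - partial i f (y + s *\<^sub>R axis i 1))"
    by auto
  obtain t where t: "0 < t" "t < h"
    "partial i f ((y + s *\<^sub>R axis i 1) + h *\<^sub>R axis j 1) - partial i f ((y + s *\<^sub>R axis i 1) + 0 *\<^sub>R axis j 1)
      = (h - 0) * partial j (partial i f) ((y + s *\<^sub>R axis i 1) + t *\<^sub>R axis j 1)"
    using partial_MVT[OF assms(2,3)] by blast
  show ?thesis
    by (rule that[OF s(1,2) t(1,2)]) (use s(3) t(3) in \<open>simp add: g_def algebra_simps\<close>)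
qed

text \<open>The same second difference equals h^2 times either mixed derivative, each taken at its
  own point near \<open>y\<close>. As h tends to 0, continuity brings both points together at
  \<open>y\<close>.\<close>

lemma partial_commute:
  assumes "partial_differentiable i f" "partial_differentiable j f"
    "partial_differentiable j (partial i f)" "partial_differentiable i (partial j f)"
    "continuous_on UNIV (partial j (partial i f))" "continuous_on UNIV (partial i (partial j f))"
  shows "partial i (partial j f) = partial j (partial i f)"
proof
  fix y
  have ev: "\<forall>\<^sub>F h in at_right (0::real). \<forall>s t. 0 < s \<longrightarrow> s < h \<longrightarrow> 0 < t \<longrightarrow> t < h \<longrightarrow>
      dist (F (y + s *\<^sub>R axis k 1 + t *\<^sub>R axis l 1)) (F y) < e"
    if "continuous_on UNIV F" "e > 0" for F :: "real ^ 'a \<Rightarrow> real" and k l e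
  proof -
    from that obtain d where d: "d > 0" "\<And>z. dist z y < d \<Longrightarrow> dist (F z) (F y) < e"
      unfolding continuous_on_iff by (metis UNIV_I)
    \<comment> \<open>Two displacements of less than \<open>h\<close> each add up to less than
      \<open>2 * h\<close>, hence \<open>d / 2\<close>.\<close>
    have "\<forall>\<^sub>F h in at_right (0::real). h < d / 2"
      by (rule eventually_at_rightI[of 0 "d/2"]) (use d in auto)
    then show ?thesis
    proof eventually_elim
      case (elim h)
      show ?case
      proof (intro allI impI d(2))
        fix s t assume "0 < s" "s < h" "0 < t" "t < h"
        have "norm (s *\<^sub>R axis k 1 + t *\<^sub>R axis l 1 :: real ^ 'a) \<le> s + t"
          using norm_triangle_ineq[of "s *\<^sub>R axis k 1 :: real ^ 'a" "t *\<^sub>R axis l 1"] \<open>0<s\<close> \<open>0<t\<close> by simp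
        then show "dist (y + s *\<^sub>R axis k 1 + t *\<^sub>R axis l 1) y < d"
          using elim \<open>s < h\<close> \<open>t < h\<close> by (simp add: dist_norm add.assoc)
      qed
    qed
  qed
  let ?A = "\<lambda>s t. partial j (partial i f) (y + s *\<^sub>R axis i 1 + t *\<^sub>R axis j 1)"
  let ?B = "\<lambda>s t. partial i (partial j f) (y + s *\<^sub>R axis j 1 + t *\<^sub>R axis i 1)"
  let ?a = "partial j (partial i f) y" and ?b = "partial i (partial j f) y"
  have "dist ?b ?a < 2 * e" if "e > 0" for e
  proof -
    have "\<forall>\<^sub>F h in at_right (0::real). h > 0" by (rule eventually_at_right_less)
    from eventually_happens'[OF trivial_limit_at_right_real
        eventually_conj[OF this eventually_conj[OF ev[OF assms(5) that, of i j] ev[OF assms(6) that, of j i]]]]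
    obtain h where h: "h > 0"
        "\<And>s t. 0 < s \<Longrightarrow> s < h \<Longrightarrow> 0 < t \<Longrightarrow> t < h \<Longrightarrow>
           dist (?A s t) ?a < e"
        "\<And>s t. 0 < s \<Longrightarrow> s < h \<Longrightarrow> 0 < t \<Longrightarrow> t < h \<Longrightarrow>
           dist (?B s t) ?b < e"
      by blast
    obtain s t where 1: "0 < s" "s < h" "0 < t" "t < h"
      "f (y + h *\<^sub>R axis i 1 + h *\<^sub>R axis j 1) - f (y + h *\<^sub>R axis i 1) - f (y + h *\<^sub>R axis j 1) + f y
        = h * h * ?A s t"
      using second_difference[OF assms(1,3) h(1)] by blast
    obtain s' t' where 2: "0 < s'" "s' < h" "0 < t'" "t' < h"
      "f (y + h *\<^sub>R axis j 1 + h *\<^sub>R axis i 1) - f (y + h *\<^sub>R axis j 1) - f (y + h *\<^sub>R axis i 1) + f y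
        = h * h * ?B s' t'"
      using second_difference[OF assms(2,4) h(1)] by blast
    have "h * h * ?B s' t'
        = h * h * ?A s t"
      using 1(5) 2(5) by (simp only: add.assoc add.commute[of "h *\<^sub>R axis j 1"])
    then have "?B s' t'
        = ?A s t"
      using h(1) by simp
    with h(2)[OF 1(1-4)] h(3)[OF 2(1-4)] show ?thesis
      by (simp add: dist_real_def)
  qed
  from this[of "dist ?b ?a / 2"]
  show "?b = ?a"
    by (cases "?b = ?a") auto
qed

section \<open>Independence of the order of differentiation\<close>

lemma C_mixedD:
  assumes "f \<in> C_mixed \<nu>" "\<And>i. count_list is i \<le> \<nu> i"
  shows "continuous_on UNIV (foldr partial is f)"
    "\<And>i. count_list is i < \<nu> i \<Longrightarrow> partial_differentiable i (foldr partial is f)"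
  using assms unfolding C_mixed_def by auto

lemma C_mixed_mono: "f \<in> C_mixed \<nu> \<Longrightarrow> \<eta> \<le> \<nu> \<Longrightarrow> f \<in> C_mixed \<eta>"
  unfolding C_mixed_def le_fun_def by (blast intro: order_trans less_le_trans)

lemma count_list_remove1_if:
  "i \<in> set js \<Longrightarrow> count_list js k = (if k = i then Suc (count_list (remove1 i js) k) else count_list (remove1 i js) k)"
  by (induction js) auto

text \<open>Each exchange of \<open>i\<close> with the entry in front of it is an instance of
  \<open>partial_commute\<close>. The counts only serve to see that all derivatives involved stay
  below \<open>\<nu>\<close>.\<close>

lemma foldr_partial_move:
  assumes "f \<in> C_mixed \<nu>" "\<And>k. count_list is k \<le> \<nu> k" "i \<in> set is"
  shows "foldr partial is f = partial i (foldr partial (remove1 i is) f)"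
  using assms(2,3)
proof (induction "is")
  case (Cons j js)
  show ?case
  proof (cases "j = i")
    case False
    with Cons have i: "i \<in> set js" by auto
    have le: "count_list js k \<le> \<nu> k" for k using Cons.prems(1)[of k] by (auto split: if_splits)
    define ks where "ks = remove1 i js"
    have cnt: "count_list js k = (if k = i then Suc (count_list ks k) else count_list ks k)" for k
      unfolding ks_def using i by (rule count_list_remove1_if)
    have cj: "count_list (j # js) k = (if k = i then 1 else 0) + (if k = j then 1 else 0) + count_list ks k" for k
      using False cnt by auto
    have c: "count_list ks k + (if k = i then 1 else 0) + (if k = j then 1 else 0) \<le> \<nu> k" for k
      using Cons.prems(1)[of k] cj[of k] by auto
    let ?g = "foldr partial ks f"
    have "partial j (partial i ?g) = partial i (partial j ?g)"
    proof (rule partial_commute)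
      have les: "count_list ks k \<le> \<nu> k" "count_list (i # ks) k \<le> \<nu> k" "count_list (j # ks) k \<le> \<nu> k"
        "count_list (j # i # ks) k \<le> \<nu> k" "count_list (i # j # ks) k \<le> \<nu> k" for k
        using c[of k] by (simp_all split: if_splits)
      show "partial_differentiable j ?g" "partial_differentiable i ?g"
        using C_mixedD(2)[OF assms(1) les(1)] c[of i] c[of j] False by (auto simp: Suc_le_eq)
      show "partial_differentiable i (partial j ?g)" "partial_differentiable j (partial i ?g)"
        using C_mixedD(2)[OF assms(1) les(3), of i] C_mixedD(2)[OF assms(1) les(2), of j] c[of i] c[of j] False
        by (auto simp: Suc_le_eq)
      show "continuous_on UNIV (partial i (partial j ?g))" "continuous_on UNIV (partial j (partial i ?g))"
        using C_mixedD(1)[OF assms(1) les(4)] C_mixedD(1)[OF assms(1) les(5)] by auto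
    qed
    then show ?thesis
      using Cons.IH[OF le i] False by (simp add: ks_def)
  qed simp
qed simp

text \<open>This makes the choice of the list in \<open>D\<close> immaterial: the head of the first
  list is moved to the front of the second one, and the tails are compared by induction.\<close>

lemma foldr_partial_cong:
  assumes "f \<in> C_mixed \<nu>" "\<And>k. count_list is k \<le> \<nu> k" "\<And>k. count_list is k = count_list js k"
  shows "foldr partial is f = foldr partial js f"
  using assms(2,3)
proof (induction "is" arbitrary: js)
  case Nil
  then have "js = []" by (metis count_list.simps(1) count_list_0_iff last_in_set)
  then show ?case by simp
next
  case (Cons i "is")
  have ijs: "i \<in> set js"
    using Cons.prems(2)[of i] by (metis count_list.simps(2) count_list_0_iff nat.distinct(1) add_is_0 zero_neq_one)
  have 1: "foldr partial is f = foldr partial (remove1 i js) f"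
  proof (rule Cons.IH)
    show "count_list is k \<le> \<nu> k" for k using Cons.prems(1)[of k] by (auto split: if_splits)
    show "count_list is k = count_list (remove1 i js) k" for k
      using Cons.prems(2)[of k, unfolded count_list_remove1_if[OF ijs, of k]] by (simp split: if_splits)
  qed
  have "foldr partial js f = partial i (foldr partial (remove1 i js) f)"
    using Cons.prems by (intro foldr_partial_move[OF assms(1) _ ijs]) metis
  then show ?case using 1 by simp
qed

lemma ex_list_with_counts:
  fixes \<eta> :: "'n::finite \<Rightarrow> nat"
  shows "\<exists>is. \<forall>i. count_list is i = \<eta> i"
proof -
  obtain xs :: "'n list" where xs: "set xs = UNIV" "distinct xs"
    using finite_distinct_list[OF finite] by blast
  have r: "count_list (replicate n j) i = (if i = j then n else 0)" for n and i j :: 'n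
    by (induction n) auto
  have "count_list (concat (map (\<lambda>j. replicate (\<eta> j) j) ys)) i = (if i \<in> set ys then \<eta> i else 0)"
    if "distinct ys" for ys i
    using that by (induction ys) (auto simp: r)
  with xs show ?thesis by (metis UNIV_I)
qed

lemma D_eq_foldr:
  assumes "f \<in> C_mixed \<eta>" "\<And>i. count_list is i = \<eta> i"
  shows "D \<eta> f = foldr partial is f"
proof -
  have "\<forall>i. count_list (SOME is. \<forall>i. count_list is i = \<eta> i) i = \<eta> i"
    using ex_list_with_counts[of \<eta>] by (rule someI_ex)
  then show ?thesis
    unfolding D_def using assms by (intro foldr_partial_cong[OF assms(1)]) auto
qed

text \<open>With at most one index to differentiate in, the counts determine the list, so this
  identity and \<open>D_munit\<close> hold for every function.\<close>

lemma D_zero [simp]: "D (\<lambda>_. 0) f = f"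
proof -
  have "\<forall>i. count_list (SOME is. \<forall>i. count_list is i = 0) i = 0"
    by (rule someI_ex[where P="\<lambda>is. \<forall>i. count_list is i = 0"]) (rule exI[of _ "[]"], simp)
  then have "(SOME is. \<forall>i. count_list is i = 0) = []"
    by (metis count_list_0_iff list.set_intros(1) neq_Nil_conv)
  then show ?thesis unfolding D_def by (metis foldr.simps(1) id_apply)
qed

lemma D_munit: "D (munit i) f = partial i f"
proof -
  let ?is = "SOME is. \<forall>j. count_list is j = munit i j"
  have "\<forall>j. count_list ?is j = munit i j"
    by (rule someI_ex[where P="\<lambda>is. \<forall>j. count_list is j = munit i j"])
      (rule exI[of _ "[i]"], simp add: munit_def)
  then have *: "\<And>j. count_list ?is j = (if j = i then 1 else 0)" by (simp add: munit_def)
  obtain j js where js: "?is = j # js"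
    using *[of i] by (cases ?is) auto
  with *[of j] have ji: "j = i" by (auto split: if_splits)
  have "count_list js k = 0" for k
    using *[of k] js ji by (auto split: if_splits)
  then have "js = []" by (metis count_list_0_iff list.set_intros(1) neq_Nil_conv)
  with js ji show ?thesis unfolding D_def by simp
qed

abbreviation madd :: "'n \<Rightarrow> ('n \<Rightarrow> nat) \<Rightarrow> 'n \<Rightarrow> nat" where
  "madd i \<eta> \<equiv> \<eta>(i := Suc (\<eta> i))"

lemma continuous_on_D:
  assumes "f \<in> C_mixed \<nu>" "\<eta> \<le> \<nu>"
  shows "continuous_on UNIV (D \<eta> f)"
proof -
  obtain "is" where i: "\<And>i. count_list is i = \<eta> i" using ex_list_with_counts by blast
  show ?thesis
    using C_mixedD(1)[OF assms(1), of "is"] assms D_eq_foldr[OF C_mixed_mono[OF assms] i] i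
    by (simp add: le_fun_def)
qed

lemma partial_D:
  assumes "f \<in> C_mixed \<nu>" "madd i \<eta> \<le> \<nu>"
  shows "partial_differentiable i (D \<eta> f)" "partial i (D \<eta> f) = D (madd i \<eta>) f"
proof -
  obtain "is" where i: "\<And>j. count_list is j = \<eta> j" using ex_list_with_counts by blast
  have lt: "\<eta> i < \<nu> i"
    using assms(2) by (auto simp: le_fun_def Suc_le_eq dest: spec[of _ i])
  have le: "\<eta> \<le> \<nu>"
  proof (rule le_funI)
    fix k show "\<eta> k \<le> \<nu> k"
      using le_funD[OF assms(2), of k] by (cases "k = i") auto
  qed
  have eq: "D \<eta> f = foldr partial is f" by (rule D_eq_foldr[OF C_mixed_mono[OF assms(1) le] i])
  have eq2: "D (madd i \<eta>) f = foldr partial (i # is) f"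
    by (rule D_eq_foldr[OF C_mixed_mono[OF assms]]) (simp add: i)
  show "partial_differentiable i (D \<eta> f)"
    unfolding eq using C_mixedD(2)[OF assms(1), of "is" i] i le lt by (simp add: le_fun_def)
  show "partial i (D \<eta> f) = D (madd i \<eta>) f" by (simp add: eq eq2)
qed

section \<open>Extension of functions by zero\<close>

text \<open>Only frontier points need an argument: the limit along \<open>V\<close> is a hypothesis,
  the one along the complement is trivially 0, and the two filters together make up the punctured
  neighbourhoods.\<close>

lemma continuous_on_extend_zero:
  fixes W :: "'a::t2_space \<Rightarrow> real"
  assumes "open V" "continuous_on V W" "\<And>y. y \<notin> V \<Longrightarrow> W y = 0"
    "\<And>p. p \<in> frontier V \<Longrightarrow> (W \<longlongrightarrow> 0) (at p within V)"
  shows "continuous_on UNIV W"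
proof (rule continuous_at_imp_continuous_on, rule ballI)
  fix p
  consider "p \<in> V" | "p \<in> frontier V" | "p \<in> - closure V"
    using assms(1) by (auto simp: frontier_def interior_open)
  then show "isCont W p"
  proof cases
    case 1
    then show ?thesis using assms(1,2) by (simp add: continuous_on_eq_continuous_at)
  next
    case 2
    have "(W \<longlongrightarrow> 0) (at p within - V)"
      by (rule tendsto_eventually) (auto simp: eventually_at_filter assms(3))
    then have "(W \<longlongrightarrow> 0) (at p within (V \<union> - V))"
      using assms(4)[OF 2] unfolding at_within_union by (simp add: filterlim_sup del: Un_absorb Compl_partition)
    moreover have "W p = 0" using 2 assms(1,3) by (simp add: frontier_def interior_open)
    ultimately show ?thesis by (simp add: isCont_def)
  next
    case 3
    have "continuous_on (- closure V) W"
      by (rule continuous_on_eq[of _ "\<lambda>_. 0"]) (use assms(3) closure_subset in auto)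
    then show ?thesis using 3 by (simp add: continuous_on_eq_continuous_at open_Compl)
  qed
qed

text \<open>At a point outside \<open>V\<close> the mean value theorem is applied on a segment only from the last exit
  from \<open>V\<close> onwards.\<close>

lemma partial_extend_zero:
  fixes W :: "real ^ 'n::finite \<Rightarrow> real"
  assumes V: "open V"
    and cont: "continuous_on UNIV W" "continuous_on UNIV W'"
    and zero: "\<And>y. y \<notin> V \<Longrightarrow> W y = 0" "\<And>y. y \<notin> V \<Longrightarrow> W' y = 0"
    and der: "\<And>y. y \<in> V \<Longrightarrow> ((\<lambda>t. W (y + t *\<^sub>R axis i 1)) has_real_derivative W' y) (at 0)"
  shows "partial_differentiable i W" "partial i W = W'"
proof -
  let ?e = "axis i 1 :: real ^ 'n"
  have der': "((\<lambda>t. W (y + t *\<^sub>R ?e)) has_real_derivative W' (y + s *\<^sub>R ?e)) (at s)"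
    if "y + s *\<^sub>R ?e \<in> V" for y s
    using der[OF that] DERIV_shift[of "\<lambda>t. W (y + t *\<^sub>R ?e)" _ 0 s] by (simp add: algebra_simps)
  have bound: "\<exists>\<tau>. \<bar>\<tau>\<bar> \<le> \<bar>t\<bar> \<and> \<bar>W (y + t *\<^sub>R ?e)\<bar> \<le> \<bar>t\<bar> * \<bar>W' (y + \<tau> *\<^sub>R ?e)\<bar>"
    if y: "y \<notin> V" for y t
  proof (cases "y + t *\<^sub>R ?e \<in> V")
    case False
    then show ?thesis by (intro exI[of _ 0]) (simp add: zero)
  next
    case True
    define u where "u r = y + (r * t) *\<^sub>R ?e" for r
    have contu: "continuous_on A u" for A unfolding u_def by (intro continuous_intros)
    define S where "S = {0..1} \<inter> u -` (- V)"
    have "closed (u -` (- V))"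
      by (rule continuous_closed_vimage)
        (use V contu[of UNIV] in \<open>auto simp: continuous_on_eq_continuous_at\<close>)
    then have "compact S" unfolding S_def by (rule compact_Int_closed[OF compact_Icc])
    moreover have "0 \<in> S" using y by (simp add: S_def u_def)
    ultimately obtain s where s: "s \<in> S" "\<And>r. r \<in> S \<Longrightarrow> r \<le> s"
      using compact_attains_sup[of S] by blast
    have s01: "0 \<le> s" "s < 1" using s(1) True by (auto simp: S_def u_def less_le)
    have inV: "u r \<in> V" if "s < r" "r \<le> 1" for r
      using s(2)[of r] that s01 by (force simp: S_def)
    have "((\<lambda>r. W (u r)) has_real_derivative t * W' (u r)) (at r)" if "s < r" "r < 1" for r
    proof -
      have "((\<lambda>r. W (y + (r * t) *\<^sub>R ?e)) has_real_derivative W' (y + (r * t) *\<^sub>R ?e) * t) (at r)"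
        by (rule DERIV_chain2[of "\<lambda>t. W (y + t *\<^sub>R ?e)", OF der'])
          (use inV[of r] that in \<open>auto simp: u_def intro!: derivative_eq_intros\<close>)
      then show ?thesis by (simp add: u_def mult.commute)
    qed
    moreover have "continuous_on {s..1} (\<lambda>r. W (u r))"
      using continuous_on_compose2[OF cont(1) contu] by auto
    ultimately obtain r where r: "s < r" "r < 1" "W (u 1) - W (u s) = (t * W' (u r)) * (1 - s)"
      using mvt[OF s01(2), of "\<lambda>r. W (u r)" "\<lambda>r. (*) (t * W' (u r))"]
      unfolding has_field_derivative_def by blast
    have "W (u s) = 0" using s(1) zero by (auto simp: S_def)
    then have "\<bar>W (u 1)\<bar> = (1 - s) * (\<bar>t\<bar> * \<bar>W' (u r)\<bar>)"
      using r(3) s01 by (simp add: abs_mult)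
    also have "\<dots> \<le> 1 * (\<bar>t\<bar> * \<bar>W' (u r)\<bar>)" using s01 by (intro mult_right_mono) auto
    finally show ?thesis
      using r s01 by (intro exI[of _ "r * t"]) (auto simp: u_def abs_mult intro: mult_left_le_one_le)
  qed
  have "((\<lambda>t. W (y + t *\<^sub>R ?e)) has_real_derivative W' y) (at 0)" for y
  proof (cases "y \<in> V")
    case False
    \<comment> \<open>The intermediate point \<open>\<tau> t\<close> is squeezed to 0, so
      \<open>W'\<close> there tends to \<open>W' y = 0\<close> and takes the difference quotient of
      \<open>W\<close> with it.\<close>
    obtain \<tau> where tau: "\<And>t. \<bar>\<tau> t\<bar> \<le> \<bar>t\<bar>" "\<And>t. \<bar>W (y + t *\<^sub>R ?e)\<bar> \<le> \<bar>t\<bar> * \<bar>W' (y + \<tau> t *\<^sub>R ?e)\<bar>"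
      using bound[OF False] by metis
    have t0: "(\<tau> \<longlongrightarrow> 0) (at 0)"
      by (rule Lim_null_comparison[of _ "\<lambda>t. \<bar>t\<bar>"]) (auto intro!: tau always_eventually tendsto_eq_intros)
    have "((\<lambda>t. W' (y + \<tau> t *\<^sub>R ?e)) \<longlongrightarrow> W' (y + 0 *\<^sub>R ?e)) (at 0)"
      by (rule continuous_on_tendsto_compose[OF cont(2)]) (auto intro!: tendsto_eq_intros t0)
    then have lim: "((\<lambda>t. W' (y + \<tau> t *\<^sub>R ?e)) \<longlongrightarrow> 0) (at 0)" using zero False by simp
    have "((\<lambda>t. W (y + t *\<^sub>R ?e) / t) \<longlongrightarrow> 0) (at 0)"
    proof (rule Lim_null_comparison)
      show "\<forall>\<^sub>F t in at 0. norm (W (y + t *\<^sub>R ?e) / t) \<le> \<bar>W' (y + \<tau> t *\<^sub>R ?e)\<bar>"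
        using tau(2) by (auto simp: eventually_at_filter divide_simps mult.commute)
      show "((\<lambda>t. \<bar>W' (y + \<tau> t *\<^sub>R ?e)\<bar>) \<longlongrightarrow> 0) (at 0)" using lim by (rule tendsto_rabs_zero)
    qed
    then show ?thesis using False zero by (simp add: DERIV_def)
  qed (rule der)
  then show "partial_differentiable i W" "partial i W = W'" by (rule partial_differentiableI)+
qed

section \<open>Weak derivatives of classically differentiable functions\<close>

lemma partial_zero_outside:
  fixes w :: "real ^ 'n::finite \<Rightarrow> real"
  assumes "closed K" "\<And>y. y \<notin> K \<Longrightarrow> w y = 0" "y \<notin> K"
  shows "partial i w y = 0"
proof (rule partial_eqI)
  let ?u = "\<lambda>t::real. y + t *\<^sub>R axis i 1"
  have "open (?u -` (- K))"
    by (rule continuous_open_vimage) (use assms(1) in \<open>auto intro!: continuous_intros\<close>)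
  then show "((\<lambda>t. w (?u t)) has_real_derivative 0) (at 0)"
    by (rule has_field_derivative_transform_within_open[OF DERIV_const[of 0]])
      (use assms in auto)
qed

lemma lborel_integral_translate:
  fixes w :: "'a::euclidean_space \<Rightarrow> real"
  assumes [measurable]: "w \<in> borel_measurable borel"
  shows "(LINT y|lborel. w (y + c)) = (LINT y|lborel. w y)"
    and "integrable lborel (\<lambda>y. w (y + c)) \<longleftrightarrow> integrable lborel w"
proof -
  have "(LINT y|lborel. w y) = (LINT y|distr lborel borel ((+) c). w y)"
    by (simp add: lborel_distr_plus)
  also have "\<dots> = (LINT y|lborel. w (y + c))"
    by (subst integral_distr) (auto simp: add.commute)
  finally show "(LINT y|lborel. w (y + c)) = (LINT y|lborel. w y)" ..
  have "integrable lborel w \<longleftrightarrow> integrable (distr lborel borel ((+) c)) w"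
    by (simp add: lborel_distr_plus)
  also have "\<dots> \<longleftrightarrow> integrable lborel (\<lambda>y. w (y + c))"
    by (subst integrable_distr_eq) (auto simp: add.commute)
  finally show "integrable lborel (\<lambda>y. w (y + c)) \<longleftrightarrow> integrable lborel w" ..
qed

lemma integrable_compact_support:
  fixes w :: "'a::euclidean_space \<Rightarrow> real"
  assumes "continuous_on UNIV w" "compact K" "\<And>y. y \<notin> K \<Longrightarrow> w y = 0"
  shows "integrable lborel w"
proof -
  have "integrable lborel (\<lambda>y. indicator K y *\<^sub>R w y)"
    by (rule borel_integrable_compact) (auto intro: continuous_on_subset[OF assms(1)] assms(2))
  also have "(\<lambda>y. indicator K y *\<^sub>R w y) = w"
    using assms(3) by (intro ext) (auto simp: indicator_def)
  finally show ?thesis .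
qed

text \<open>Difference quotients integrate to zero by translation invariance.\<close>

lemma integral_partial_eq_0:
  fixes w :: "real ^ 'n::finite \<Rightarrow> real"
  assumes d: "partial_differentiable i w"
    and c: "continuous_on UNIV w" "continuous_on UNIV (partial i w)"
    and K: "compact K" "\<And>y. y \<notin> K \<Longrightarrow> w y = 0"
  shows "(LINT y|lborel. partial i w y) = 0"
proof -
  have z: "partial i w y = 0" if "y \<notin> K" for y
    by (rule partial_zero_outside[OF compact_imp_closed[OF K(1)] K(2) that])
  obtain r where r: "K \<subseteq> cball 0 r" "r > 0"
    using compact_imp_bounded[OF K(1)] unfolding bounded_pos by (auto simp: subset_iff)
  have "bounded (partial i w ` K)"
    by (intro compact_imp_bounded compact_continuous_image continuous_on_subset[OF c(2)] K) auto
  then obtain M where M: "M > 0" "\<And>y. y \<in> K \<Longrightarrow> \<bar>partial i w y\<bar> \<le> M"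
    unfolding bounded_pos by auto
  have M': "\<bar>partial i w y\<bar> \<le> M" for y using M z[of y] by (cases "y \<in> K") auto
  have m[measurable]: "w \<in> borel_measurable borel" "partial i w \<in> borel_measurable borel"
    by (rule borel_measurable_continuous_onI[OF c(1)], rule borel_measurable_continuous_onI[OF c(2)])
  define h where "h n = inverse (real (Suc n))" for n
  have h: "h n > 0" "h n \<le> 1" for n by (auto simp: h_def inverse_le_1_iff)
  have hlim: "h \<longlonglongrightarrow> 0" unfolding h_def by (rule LIMSEQ_inverse_real_of_nat)
  define s where "s n y = (w (y + h n *\<^sub>R axis i 1) - w y) / h n" for n y
  have "(\<lambda>n. LINT y|lborel. s n y) \<longlonglongrightarrow> (LINT y|lborel. partial i w y)"
  proof (rule integral_dominated_convergence)
    show "partial i w \<in> borel_measurable lborel" "\<And>n. s n \<in> borel_measurable lborel"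
      unfolding s_def by measurable
    \<comment> \<open>The steps \<open>h n\<close> are at most 1, so enlarging the radius by 1 makes
      the difference quotient vanish outside the ball; inside it is a value of the partial
      derivative, hence at most \<open>M\<close>.\<close>
    show "integrable lborel (\<lambda>y. indicator (cball (0::real^'n) (r + 1)) y *\<^sub>R M)"
      by (rule borel_integrable_compact) auto
    show "AE y in lborel. (\<lambda>n. s n y) \<longlonglongrightarrow> partial i w y"
    proof (rule AE_I2)
      fix y
      have "((\<lambda>t. (w (y + t *\<^sub>R axis i 1) - w y) / t) \<longlongrightarrow> partial i w y) (at 0)"
        using has_partial_0[OF d, of y] by (simp add: DERIV_def)
      moreover have "filterlim h (at 0) sequentially"
        unfolding filterlim_at using hlim h by (auto simp: less_imp_neq[symmetric])
      ultimately show "(\<lambda>n. s n y) \<longlonglongrightarrow> partial i w y"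
        unfolding s_def by (rule filterlim_compose)
    qed
    fix n
    show "AE y in lborel. norm (s n y) \<le> indicator (cball 0 (r + 1)) y *\<^sub>R M"
    proof (rule AE_I2)
      fix y
      show "norm (s n y) \<le> indicator (cball 0 (r + 1)) y *\<^sub>R M"
      proof (cases "y \<in> cball 0 (r + 1)")
        case True
        obtain t where "w (y + h n *\<^sub>R axis i 1) - w (y + 0 *\<^sub>R axis i 1)
            = (h n - 0) * partial i w (y + t *\<^sub>R axis i 1)"
          using partial_MVT[OF d h(1)[of n]] by blast
        then have "s n y = partial i w (y + t *\<^sub>R axis i 1)"
          using h(1)[of n] by (simp add: s_def)
        then show ?thesis using M' True by simp
      next
        case False
        then have "y \<notin> K" using r by auto
        moreover have "y + h n *\<^sub>R axis i 1 \<notin> K"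
        proof
          assume "y + h n *\<^sub>R axis i 1 \<in> K"
          then have "norm (y + h n *\<^sub>R axis i 1) \<le> r" using r by auto
          moreover have "norm y \<le> norm (y + h n *\<^sub>R axis i 1) + norm (h n *\<^sub>R axis i 1 :: real ^ 'n)"
            by (metis add_diff_cancel_right' norm_triangle_ineq4)
          moreover have "norm (h n *\<^sub>R axis i 1 :: real ^ 'n) \<le> 1" using h[of n] by simp
          ultimately show False using False by simp
        qed
        ultimately show ?thesis using False by (simp add: s_def K(2))
      qed
    qed
  qed
  moreover have "(LINT y|lborel. s n y) = 0" for n
  proof -
    have "integrable lborel w" by (rule integrable_compact_support[OF c(1) K])
    then show ?thesis
      unfolding s_def by (simp add: lborel_integral_translate)
  qed
  ultimately show ?thesis using LIMSEQ_unique[OF _ tendsto_const] by fastforce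
qed

text \<open>The product of \<open>u\<close> and \<open>v\<close> inherits the compact support of
  \<open>v\<close>, so its partial derivative integrates to 0.\<close>

lemma integration_by_parts:
  fixes u v :: "real ^ 'n::finite \<Rightarrow> real"
  assumes u: "partial_differentiable i u" "continuous_on UNIV u" "continuous_on UNIV (partial i u)"
    and v: "partial_differentiable i v" "continuous_on UNIV v" "continuous_on UNIV (partial i v)"
    and K: "compact K" "\<And>y. y \<notin> K \<Longrightarrow> v y = 0"
  shows "(LINT y|lborel. u y * partial i v y) = - (LINT y|lborel. partial i u y * v y)"
proof -
  have "((\<lambda>t. u (y + t *\<^sub>R axis i 1) * v (y + t *\<^sub>R axis i 1)) has_real_derivative
      partial i u y * v y + u y * partial i v y) (at 0)" for y
    using DERIV_mult[OF has_partial_0[OF u(1), of y] has_partial_0[OF v(1), of y]] by (simp add: algebra_simps)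
  note uv = partial_differentiableI[of "\<lambda>y. u y * v y", OF this]
  have z: "partial i v y = 0" if "y \<notin> K" for y
    by (rule partial_zero_outside[OF compact_imp_closed[OF K(1)] K(2) that])
  have "(LINT y|lborel. partial i (\<lambda>y. u y * v y) y) = 0"
    by (rule integral_partial_eq_0[OF uv(1) _ _ K(1)]) (auto simp: uv(2) K intro!: continuous_intros u v)
  moreover have "integrable lborel (\<lambda>y. partial i u y * v y)" "integrable lborel (\<lambda>y. u y * partial i v y)"
    by (rule integrable_compact_support[OF _ K(1)]; use u v K z in \<open>auto intro!: continuous_intros\<close>)+
  ultimately show ?thesis unfolding uv(2) by simp
qed

lemma locally_integrable_continuous:
  fixes f :: "real ^ 'n::finite \<Rightarrow> real"
  assumes "continuous_on UNIV f"
  shows "locally_integrable f"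
  using borel_measurable_continuous_onI[OF assms]
    borel_integrable_compact[OF _ continuous_on_subset[OF assms subset_UNIV]]
  unfolding locally_integrable_def set_integrable_def by blast

lemma test_functionD:
  assumes "test_function v"
  shows "v \<in> C_mixed \<nu>" "continuous_on UNIV (foldr partial is v)" "partial_differentiable i (foldr partial is v)"
    "compact (closure {y. v y \<noteq> 0})"
proof -
  show 1: "v \<in> C_mixed \<nu>" for \<nu> using assms by (auto simp: test_function_def)
  show "continuous_on UNIV (foldr partial is v)"
    by (rule C_mixedD(1)[OF 1[of "count_list is"]]) simp
  show "partial_differentiable i (foldr partial is v)"
    by (rule C_mixedD(2)[OF 1[of "\<lambda>k. Suc (count_list is k)"]]) auto
  show "compact (closure {y. v y \<noteq> 0})" using assms by (auto simp: test_function_def)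
qed

lemma foldr_partial_support:
  fixes v :: "real ^ 'n::finite \<Rightarrow> real"
  assumes "y \<notin> closure {y. v y \<noteq> 0}"
  shows "foldr partial is v y = 0"
  using assms
proof (induction "is" arbitrary: y)
  case Nil
  then show ?case using closure_subset[of "{y. v y \<noteq> 0}"] by auto
next
  case (Cons i "is")
  show ?case using partial_zero_outside[OF closed_closure Cons.IH Cons.prems] by simp
qed

lemma test_function_partial:
  assumes v: "test_function v"
  shows "test_function (partial i v)"
proof -
  have "foldr partial is (partial i v) = foldr partial (is @ [i]) v" for "is" by simp
  then have "partial i v \<in> C_mixed \<nu>" for \<nu>
    unfolding C_mixed_def using test_functionD(2,3)[OF v] by (simp del: foldr_append)
  moreover have "{y. partial i v y \<noteq> 0} \<subseteq> closure {y. v y \<noteq> 0}"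
    using foldr_partial_support[of _ v "[i]"] by auto
  then have "bounded {y. partial i v y \<noteq> 0}"
    using test_functionD(4)[OF v] by (meson bounded_subset compact_imp_bounded)
  ultimately show ?thesis unfolding test_function_def by simp
qed

text \<open>Integration by parts takes one derivative at a time off the test function, innermost
  first. The derivatives therefore arrive on \<open>f\<close> in reverse order, which
  \<open>D_eq_foldr\<close> makes irrelevant.\<close>

lemma has_weak_deriv_D:
  fixes f :: "real ^ 'n::finite \<Rightarrow> real"
  assumes f: "f \<in> C_mixed \<eta>"
  shows "has_weak_deriv \<eta> f (D \<eta> f)"
proof -
  obtain "is" where eq: "\<And>i. count_list is i = \<eta> i" using ex_list_with_counts by blast
  have "(LINT y|lborel. f y * foldr partial is v y)
      = (- 1) ^ length is * (LINT y|lborel. foldr partial (rev is) f y * v y)"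
    if "test_function v" and "\<And>i. count_list is i \<le> \<eta> i" for v "is"
    using that
  proof (induction "is" arbitrary: v rule: rev_induct)
    case (snoc i "is")
    have le: "count_list is k \<le> \<eta> k" for k using snoc.prems(2)[of k] by simp
    have le': "count_list (i # rev is) k \<le> \<eta> k" for k
      using snoc.prems(2)[of k] by (cases "i = k") auto
    have lt: "count_list (rev is) i < \<eta> i" using snoc.prems(2)[of i] by simp
    have "(LINT y|lborel. f y * foldr partial is (partial i v) y)
        = (- 1) ^ length is * (LINT y|lborel. foldr partial (rev is) f y * partial i v y)"
      by (rule snoc.IH[OF test_function_partial[OF snoc.prems(1)] le])
    also have "(LINT y|lborel. foldr partial (rev is) f y * partial i v y)
        = - (LINT y|lborel. partial i (foldr partial (rev is) f) y * v y)"
    proof (rule integration_by_parts)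
      show "partial_differentiable i (foldr partial (rev is) f)"
        "continuous_on UNIV (foldr partial (rev is) f)"
        using C_mixedD[OF f, of "rev is"] le lt by auto
      show "continuous_on UNIV (partial i (foldr partial (rev is) f))"
        using C_mixedD(1)[OF f le'] by simp
      show "partial_differentiable i v" "continuous_on UNIV v" "continuous_on UNIV (partial i v)"
        using test_functionD(2)[OF snoc.prems(1), of "[]"] test_functionD(3)[OF snoc.prems(1), of i "[]"] test_functionD(2)[OF snoc.prems(1), of "[i]"] by auto
      show "compact (closure {y. v y \<noteq> 0})" by (rule test_functionD(4)[OF snoc.prems(1)])
      show "v y = 0" if "y \<notin> closure {y. v y \<noteq> 0}" for y
        using foldr_partial_support[OF that, of "[]"] by simp
    qed
    finally show ?case by simp
  qed simp
  moreover have "D \<eta> f = foldr partial (rev is) f" by (rule D_eq_foldr[OF f]) (simp add: eq)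
  moreover have "D \<eta> v = foldr partial is v" if "test_function v" for v
    by (rule D_eq_foldr[OF test_functionD(1)[OF that] eq])
  moreover have "length is = mabs \<eta>"
    unfolding mabs_def eq[symmetric] sum_count_set[OF subset_UNIV finite, symmetric] by simp
  moreover have "locally_integrable (D \<eta> f)"
    by (rule locally_integrable_continuous[OF continuous_on_D[OF f order_refl]])
  ultimately show ?thesis
    using eq unfolding has_weak_deriv_def by simp
qed

section \<open>Smooth functions of one variable and test functions\<close>

text \<open>If every derivative of a member is a linear combination of members, the span of the
  family is closed under differentiation, and a tower of derivatives can be chosen inside it. The
  list \<open>next_terms k\<close> encodes the combination for \<open>b k\<close>.\<close>

lemma smooth_of_closed_family:
  fixes b :: "'k \<Rightarrow> real \<Rightarrow> real" and next_terms :: "'k \<Rightarrow> (real \<times> 'k) list"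
  assumes "\<And>k t. (b k has_real_derivative (\<Sum>(c, l)\<leftarrow>next_terms k. c * b l t)) (at t)"
  shows "\<exists>G. G 0 = b k \<and> (\<forall>n t. (G n has_real_derivative G (Suc n) t) (at t))"
proof -
  define S where "S F \<longleftrightarrow> (\<exists>ps. F = (\<lambda>t. \<Sum>(c, l)\<leftarrow>ps. c * b l t))" for F :: "real \<Rightarrow> real"
  have step: "\<exists>F'. S F' \<and> (\<forall>t. (F has_real_derivative F' t) (at t))" if "S F" for F
  proof -
    from that obtain ps where F: "F = (\<lambda>t. \<Sum>(c, l)\<leftarrow>ps. c * b l t)" unfolding S_def by (elim exE)
    have "\<exists>qs. \<forall>t. ((\<lambda>t. \<Sum>(c, l)\<leftarrow>ps. c * b l t) has_real_derivative (\<Sum>(c, l)\<leftarrow>qs. c * b l t)) (at t)"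
    proof (induction ps)
      case Nil
      show ?case by (rule exI[of _ "[]"]) simp
    next
      case (Cons p ps)
      obtain c l where p: "p = (c, l)" by force
      from Cons obtain qs where qs: "\<And>t. ((\<lambda>t. \<Sum>(c, l)\<leftarrow>ps. c * b l t) has_real_derivative (\<Sum>(c, l)\<leftarrow>qs. c * b l t)) (at t)"
        by blast
      have eq: "(\<Sum>(c', l')\<leftarrow>map (\<lambda>(c', l'). (c * c', l')) rs @ qs. c' * b l' t)
          = c * (\<Sum>(c', l')\<leftarrow>rs. c' * b l' t) + (\<Sum>(c', l')\<leftarrow>qs. c' * b l' t)" for t rs
        by (induction rs) (auto simp: algebra_simps)
      show ?case
      proof (intro exI[of _ "map (\<lambda>(c', l'). (c * c', l')) (next_terms l) @ qs"] allI)
        fix t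
        show "((\<lambda>t. \<Sum>(c, l)\<leftarrow>p # ps. c * b l t) has_real_derivative
            (\<Sum>(c', l')\<leftarrow>map (\<lambda>(c', l'). (c * c', l')) (next_terms l) @ qs. c' * b l' t)) (at t)"
          unfolding eq p using DERIV_add[OF DERIV_cmult[OF assms[of l t], of c] qs[of t]] by simp
      qed
    qed
    then show ?thesis unfolding F S_def by blast
  qed
  have "S (b k)" unfolding S_def by (rule exI[of _ "[(1, k)]"]) simp
  \<comment> \<open>Keeping \<open>S\<close> along the recursion guarantees that a further
    derivative can be chosen at every stage.\<close>
  define G where "G = rec_nat (b k) (\<lambda>_ F. SOME F'. S F' \<and> (\<forall>t. (F has_real_derivative F' t) (at t)))"
  have S: "S (G n)" for n
  proof (induction n)
    case (Suc n)
    show ?case unfolding G_def using someI_ex[OF step[OF Suc]] by (simp add: G_def)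
  qed (simp add: G_def \<open>S (b k)\<close>)
  have "\<forall>t. (G n has_real_derivative G (Suc n) t) (at t)" for n
    using someI_ex[OF step[OF S[of n]]] by (simp add: G_def)
  then show ?thesis by (intro exI[of _ G]) (simp add: G_def)
qed

text \<open>The whole tower of derivatives is the witness, so that products and affine substitutions
  can be treated on towers instead of on iterates of \<open>deriv\<close>.\<close>

definition smooth :: "(real \<Rightarrow> real) \<Rightarrow> bool" where
  "smooth F \<longleftrightarrow> (\<exists>G. G 0 = F \<and> (\<forall>n t. (G n has_real_derivative G (Suc n) t) (at t)))"

lemma smooth_mult:
  assumes "smooth F" "smooth H" shows "smooth (\<lambda>t. F t * H t)"
proof -
  obtain P Q where P: "P 0 = F" "\<And>n t. (P n has_real_derivative P (Suc n) t) (at t)"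
    and Q: "Q 0 = H" "\<And>n t. (Q n has_real_derivative Q (Suc n) t) (at t)"
    using assms unfolding smooth_def by blast
  define b where "b = (\<lambda>(m, n) t. P m t * Q n t)"
  have "(b k has_real_derivative (\<Sum>(c, l)\<leftarrow>(case k of (m, n) \<Rightarrow> [(1, (Suc m, n)), (1, (m, Suc n))]). c * b l t)) (at t)" for k t
    using DERIV_mult[OF P(2)[of "fst k" t] Q(2)[of "snd k" t]] by (auto simp: b_def split_beta algebra_simps)
  from smooth_of_closed_family[where b=b, OF this, of "(0, 0)"] show ?thesis
    by (simp add: smooth_def b_def P(1) Q(1))
qed

lemma smooth_affine:
  assumes "smooth F" shows "smooth (\<lambda>t. F (a * t + c))"
proof -
  obtain P where P: "P 0 = F" "\<And>n t. (P n has_real_derivative P (Suc n) t) (at t)"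
    using assms unfolding smooth_def by blast
  have "((\<lambda>t. a ^ n * P n (a * t + c)) has_real_derivative a ^ Suc n * P (Suc n) (a * t + c)) (at t)" for n t
    by (auto intro!: derivative_eq_intros DERIV_chain2[OF P(2)])
  then show ?thesis
    unfolding smooth_def by (intro exI[of _ "\<lambda>n t. a ^ n * P n (a * t + c)"]) (simp add: P)
qed

text \<open>The products of \<open>flat_exp 0 (n * (t - l))\<close> and \<open>flat_exp 0 (n * (u - t))\<close> are smooth functions
  increasing to the indicator of the interval from \<open>l\<close> to \<open>u\<close>.\<close>

definition flat_exp :: "nat \<Rightarrow> real \<Rightarrow> real" where
  "flat_exp k t = (if t > 0 then (1 / t) ^ k * exp (- (1 / t)) else 0)"

text \<open>Differentiating exp (- 1 / t) produces powers of 1 / t; carrying the power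
  \<open>k\<close> along makes the family closed under differentiation. At 0 the exponential beats
  every power.\<close>

lemma flat_exp_deriv:
  "(flat_exp k has_real_derivative - real k * flat_exp (k + 1) t + flat_exp (k + 2) t) (at t)"
proof -
  consider "t > 0" | "t < 0" | "t = 0" by linarith
  then show ?thesis
  proof cases
    case 1
    have "((\<lambda>t. (1 / t) ^ k * exp (- (1 / t))) has_real_derivative
        - real k * flat_exp (k + 1) t + flat_exp (k + 2) t) (at t)"
    proof -
      have u: "((\<lambda>t. 1 / t) has_real_derivative - ((1 / t) ^ 2)) (at t)"
        using 1 by (auto intro!: derivative_eq_intros simp: power2_eq_square)
      have "((\<lambda>t. exp (- (1 / t))) has_real_derivative exp (- (1 / t)) * (1 / t) ^ 2) (at t)"
        using DERIV_fun_exp[OF DERIV_minus[OF u]] by simp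
      from DERIV_mult[OF DERIV_power[OF u, of k] this]
      have "((\<lambda>t. (1 / t) ^ k * exp (- (1 / t))) has_real_derivative real k * (- ((1 / t) ^ 2) * (1 / t) ^ (k - Suc 0))
          * exp (- (1 / t)) + exp (- (1 / t)) * (1 / t) ^ 2 * (1 / t) ^ k) (at t)" .
      also have "real k * (- ((1 / t) ^ 2) * (1 / t) ^ (k - Suc 0))
          * exp (- (1 / t)) + exp (- (1 / t)) * (1 / t) ^ 2 * (1 / t) ^ k
          = - real k * flat_exp (k + 1) t + flat_exp (k + 2) t"
      proof -
        have "real k * (- (u ^ 2) * u ^ (k - Suc 0)) * E + E * u ^ 2 * u ^ k
            = - real k * (u ^ (k + 1) * E) + u ^ (k + 2) * E" for u E :: real
          by (cases k) (simp_all add: algebra_simps power2_eq_square)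
        then show ?thesis using 1 by (simp only: flat_exp_def if_True)
      qed
      finally show ?thesis .
    qed
    then show ?thesis
      by (rule has_field_derivative_transform_within_open[of _ _ _ "{0<..}"])
        (use 1 in \<open>auto simp: flat_exp_def\<close>)
  next
    case 2
    have "((\<lambda>t. 0) has_real_derivative - real k * flat_exp (k + 1) t + flat_exp (k + 2) t) (at t)"
      using 2 by (simp add: flat_exp_def)
    then show ?thesis
      by (rule has_field_derivative_transform_within_open[of _ _ _ "{..<0}"])
        (use 2 in \<open>auto simp: flat_exp_def\<close>)
  next
    case 3
    \<comment> \<open>The difference quotient of \<open>flat_exp k\<close> at 0 contains one more
      power of 1 / t, hence the exponent \<open>k + 1\<close>.\<close>
    have "((\<lambda>x::real. x ^ (k + 1) / exp x) \<longlongrightarrow> 0) at_top" by (rule tendsto_power_div_exp_0)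
    then have "((\<lambda>t::real. (1 / t) ^ (k + 1) / exp (1 / t)) \<longlongrightarrow> 0) (at_right 0)"
      by (rule filterlim_compose) (simp add: inverse_eq_divide[symmetric] filterlim_inverse_at_top_right)
    then have "((\<lambda>t. flat_exp k t / t) \<longlongrightarrow> 0) (at_right 0)"
      by (rule Lim_transform_eventually)
        (auto simp: eventually_at_filter flat_exp_def exp_minus field_simps)
    moreover have "((\<lambda>t. flat_exp k t / t) \<longlongrightarrow> 0) (at_left 0)"
      by (rule tendsto_eventually) (auto simp: eventually_at_filter flat_exp_def)
    ultimately have "((\<lambda>t. flat_exp k t / t) \<longlongrightarrow> 0) (at 0)"
      by (simp add: filterlim_at_split)
    then show ?thesis using 3 by (simp add: DERIV_def flat_exp_def)
  qed
qed

lemma smooth_flat_exp: "smooth (flat_exp k)"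
  unfolding smooth_def
  by (rule smooth_of_closed_family[where next_terms="\<lambda>k. [(- real k, k + 1), (1, k + 2)]"])
    (use flat_exp_deriv in auto)

lemma flat_exp_0_le: "0 \<le> flat_exp 0 t" "flat_exp 0 t \<le> 1"
  by (auto simp: flat_exp_def)

lemma flat_exp_0_lim: "(\<lambda>n. flat_exp 0 (real n * s)) \<longlonglongrightarrow> indicator {0<..} s"
proof (cases "s > 0")
  case True
  have "(\<lambda>n. inverse (real n) * (1 / s)) \<longlonglongrightarrow> 0"
    using tendsto_mult_right[OF lim_inverse_n, of "1 / s"] by simp
  then have "(\<lambda>n. exp (- (1 / (real n * s)))) \<longlonglongrightarrow> exp (- 0)"
    by (intro tendsto_intros) (simp add: field_simps)
  moreover have "\<forall>\<^sub>F n in sequentially. exp (- (1 / (real n * s))) = flat_exp 0 (real n * s)"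
    using eventually_gt_at_top[of 0] by eventually_elim (use True in \<open>simp add: flat_exp_def\<close>)
  ultimately show ?thesis using True by (auto intro: Lim_transform_eventually)
next
  case False
  then have "flat_exp 0 (real n * s) = 0" for n
    by (simp add: flat_exp_def mult_le_0_iff not_less)
  then show ?thesis using False by simp
qed

text \<open>A partial derivative touches only the factor of its own coordinate. Thus
  \<open>m\<close> records how often each factor has been differentiated, and a list of directions
  acts through its counts.\<close>

lemma foldr_partial_prod:
  fixes G :: "'n::finite \<Rightarrow> nat \<Rightarrow> real \<Rightarrow> real"
  assumes G: "\<And>i n t. (G i n has_real_derivative G i (Suc n) t) (at t)"
  defines "v \<equiv> \<lambda>m (y :: real ^ 'n). \<Prod>i\<in>UNIV. G i (m i) (y $ i)"
  shows "foldr partial is (v (\<lambda>_. 0)) = v (count_list is)"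
    and "partial_differentiable i (v m)" and "continuous_on UNIV (v m)"
proof -
  have "((\<lambda>t. v m (y + t *\<^sub>R axis i 1)) has_real_derivative v (m(i := Suc (m i))) y) (at 0)" for i m y
  proof -
    define p where "p = (\<Prod>j\<in>UNIV - {i}. G j (m j) (y $ j))"
    have "v m (y + t *\<^sub>R axis i 1) = G i (m i) (y $ i + t) * p" for t
      unfolding v_def p_def by (subst prod.remove[of UNIV i]) (auto intro!: prod.cong simp: axis_def)
    moreover have "v (m(i := Suc (m i))) y = G i (Suc (m i)) (y $ i) * p"
      unfolding v_def p_def by (subst prod.remove[of UNIV i]) (auto intro!: prod.cong)
    moreover have "((\<lambda>t. G i (m i) (y $ i + t)) has_real_derivative G i (Suc (m i)) (y $ i)) (at 0)"
      using DERIV_chain2[of "G i (m i)" "G i (Suc (m i)) (y $ i + 0)" "\<lambda>t. y $ i + t" 0 1 UNIV, OF G]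
        DERIV_add[OF DERIV_const[of "y $ i"] DERIV_ident] by simp
    ultimately show ?thesis by (simp add: DERIV_cmult_right)
  qed
  note d = partial_differentiableI[OF this]
  show "partial_differentiable i (v m)" by (rule d)
  show "foldr partial is (v (\<lambda>_. 0)) = v (count_list is)"
  proof (induction "is")
    case (Cons i "is")
    have "(count_list is)(i := Suc (count_list is i)) = count_list (i # is)" by auto
    with Cons show ?case by (simp only: foldr.simps comp_def d(2))
  qed (simp add: fun_eq_iff v_def)
  have "isCont (G i n) t" for i n t using G DERIV_isCont by blast
  then have "continuous_on UNIV (G i n)" for i n by (simp add: continuous_on_eq_continuous_at)
  then have "continuous_on UNIV (\<lambda>y :: real ^ 'n. G i (m i) (y $ i))" for i
    by (rule continuous_on_compose2[where t=UNIV]) (simp_all add: linear_continuous_on bounded_linear_vec_nth)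
  then show "continuous_on UNIV (v m)" unfolding v_def by (rule continuous_on_prod)
qed

lemma test_function_prod:
  fixes F :: "'n::finite \<Rightarrow> real \<Rightarrow> real"
  assumes "\<And>i. smooth (F i)" "\<And>y. y \<notin> K \<Longrightarrow> (\<Prod>i\<in>UNIV. F i (y $ i)) = 0" "compact K"
  shows "test_function (\<lambda>y. \<Prod>i\<in>UNIV. F i (y $ i))"
proof -
  obtain G where G: "\<And>i. G i 0 = F i" "\<And>i n t. (G i n has_real_derivative G i (Suc n) t) (at t)"
    using assms(1) unfolding smooth_def by metis
  have "{y. (\<Prod>i\<in>UNIV. F i (y $ i)) \<noteq> 0} \<subseteq> K" using assms(2) by blast
  then have "bounded {y. (\<Prod>i\<in>UNIV. F i (y $ i)) \<noteq> 0}"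
    using compact_imp_bounded[OF assms(3)] bounded_subset by blast
  then show ?thesis
    unfolding test_function_def C_mixed_def
    using foldr_partial_prod[of G, OF G(2)] by (auto simp: G(1))
qed

section \<open>Uniqueness of weak derivatives\<close>

text \<open>Products of flat exponentials are test functions with values between 0 and 1 that
  converge pointwise to the indicator of the open box. Convergence is dominated by \<open>w\<close>
  on the closed box.\<close>

lemma weak_zero_box:
  fixes w :: "real ^ 'n::finite \<Rightarrow> real"
  assumes w: "locally_integrable w"
    and 0: "\<And>v. test_function v \<Longrightarrow> (LINT y|lborel. w y * v y) = 0"
  shows "(LINT y|lborel. w y * indicator (box l u) y) = 0"
proof -
  define v where "v n (y :: real ^ 'n) = (\<Prod>i\<in>UNIV. flat_exp 0 (real n * (y $ i - l $ i)) * flat_exp 0 (real n * (u $ i - y $ i)))"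
    for n y
  have [measurable]: "w \<in> borel_measurable borel" using w by (simp add: locally_integrable_def)
  have out: "v n y = 0" if y: "y \<notin> cbox l u" for n y
  proof -
    obtain i where "y $ i < l $ i \<or> u $ i < y $ i" using y by (auto simp: mem_box_cart not_le)
    then have "flat_exp 0 (real n * (y $ i - l $ i)) * flat_exp 0 (real n * (u $ i - y $ i)) = 0"
      by (auto simp: flat_exp_def zero_less_mult_iff)
    then show ?thesis unfolding v_def by (subst prod_zero_iff) auto
  qed
  have test: "test_function (v n)" for n
    unfolding v_def
  proof (rule test_function_prod[where K="cbox l u"])
    have "smooth (\<lambda>t. flat_exp 0 (real n * t + (- (real n * l $ i))) * flat_exp 0 (- real n * t + real n * u $ i))" for i
      by (intro smooth_mult smooth_affine smooth_flat_exp)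
    then show "smooth (\<lambda>t. flat_exp 0 (real n * (t - l $ i)) * flat_exp 0 (real n * (u $ i - t)))" for i
      by (simp add: algebra_simps)
  qed (use out in \<open>auto simp: v_def\<close>)
  have v01: "0 \<le> v n y" "v n y \<le> 1" for n y
    unfolding v_def by (auto intro!: prod_nonneg prod_le_1 mult_nonneg_nonneg mult_le_one flat_exp_0_le)
  have "(\<lambda>n. LINT y|lborel. w y * v n y) \<longlonglongrightarrow> (LINT y|lborel. w y * indicator (box l u) y)"
  proof (rule integral_dominated_convergence)
    show "integrable lborel (\<lambda>y. \<bar>indicator (cbox l u) y *\<^sub>R w y\<bar>)"
      using w by (auto simp: locally_integrable_def set_integrable_def)
    have "v n \<in> borel_measurable borel" for n
      using borel_measurable_continuous_onI test_functionD(2)[OF test[of n], of "[]"] by simp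
    then show "(\<lambda>y. w y * v n y) \<in> borel_measurable lborel" for n by simp
    show "(\<lambda>y. w y * indicator (box l u) y) \<in> borel_measurable lborel" by simp
    show "AE y in lborel. norm (w y * v n y) \<le> \<bar>indicator (cbox l u) y *\<^sub>R w y\<bar>" for n
      using v01 out by (intro AE_I2) (auto simp: indicator_def abs_mult intro!: mult_left_le)
    show "AE y in lborel. (\<lambda>n. w y * v n y) \<longlonglongrightarrow> w y * indicator (box l u) y"
    proof (intro AE_I2 tendsto_mult tendsto_const)
      fix y
      have "(\<lambda>n. v n y) \<longlonglongrightarrow> (\<Prod>i\<in>UNIV. indicator {0<..} (y $ i - l $ i) * indicator {0<..} (u $ i - y $ i))"
        unfolding v_def by (intro tendsto_intros flat_exp_0_lim)
      also have "(\<Prod>i\<in>UNIV. indicator {0<..} (y $ i - l $ i) * indicator {0<..} (u $ i - y $ i)) = (indicator (box l u) y :: real)"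
        by (auto simp: indicator_def mem_box_cart intro!: prod.neutral)
      finally show "(\<lambda>n. v n y) \<longlonglongrightarrow> indicator (box l u) y" .
    qed
  qed
  then show ?thesis using 0[OF test] LIMSEQ_unique[OF _ tendsto_const] by fastforce
qed

text \<open>On a bounded cube the positive and negative parts of \<open>w\<close> are densities of
  two measures that agree and are finite on all boxes. Boxes generate the Borel sets, so the
  measures and hence the densities coincide; countably many cubes cover the space.\<close>

lemma weak_zero_AE:
  fixes w :: "real ^ 'n::finite \<Rightarrow> real"
  assumes w: "locally_integrable w"
    and 0: "\<And>v. test_function v \<Longrightarrow> (LINT y|lborel. w y * v y) = 0"
  shows "AE y in lborel. w y = 0"
proof -
  have [measurable]: "w \<in> borel_measurable borel" using w by (simp add: locally_integrable_def)
  define C where "C n = box (- (real n *\<^sub>R One)) (real n *\<^sub>R One :: real ^ 'n)" for n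
  have "AE y in lborel. y \<in> C n \<longrightarrow> w y = 0" for n
  proof -
    define p q where "p y = ennreal (w y * indicator (C n) y)" and "q y = ennreal (- w y * indicator (C n) y)" for y
    have [measurable]: "p \<in> borel_measurable borel" "q \<in> borel_measurable borel"
      unfolding p_def q_def C_def by measurable
    have int: "integrable lborel (\<lambda>y. w y * indicator (box l u) y)" for l u
    proof (rule Bochner_Integration.integrable_bound)
      show "integrable lborel (\<lambda>y. indicator (cbox l u) y *\<^sub>R w y)"
        using w by (auto simp: locally_integrable_def set_integrable_def)
      show "AE y in lborel. norm (w y * indicator (box l u) y) \<le> norm (indicator (cbox l u) y *\<^sub>R w y)"
        using box_subset_cbox[of l u] by (intro AE_I2) (auto simp: indicator_def)
    qed measurable
    let ?I = "\<lambda>w l u. \<integral>\<^sup>+y. ennreal (w y * indicator (box l u) y) \<partial>lborel"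
    have eq: "?I w l u = ?I (\<lambda>y. - w y) l u" 
      "?I w l u < \<infinity>" for l u
    proof -
      have f: "?I w l u < \<infinity>"
        "?I (\<lambda>y. - w y) l u < \<infinity>"
        using int[of l u] unfolding real_integrable_def by (auto simp: less_top)
      from real_lebesgue_integral_def[OF int[of l u]] weak_zero_box[OF assms, of l u]
      have "enn2real (?I w l u)
          = enn2real (?I (\<lambda>y. - w y) l u)" by simp
      then show "?I w l u = ?I (\<lambda>y. - w y) l u"
        using f by (metis ennreal_enn2real infinity_ennreal_def)
      show "?I w l u < \<infinity>" by (rule f)
    qed
    have dens: "emeasure (density lborel p) (box l u) = emeasure (density lborel q) (box l u)
       \<and> emeasure (density lborel p) (box l u) < \<infinity>" for l u
    proof -
      obtain l' u' where lu: "box l u \<inter> C n = box l' u'" unfolding C_def box_Int_box by blast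
      have i: "indicator (C n) y * indicator (box l u) y = (indicator (box l' u') y :: real)" for y
        unfolding lu[symmetric] by (auto simp: indicator_def)
      have "p y * indicator (box l u) y = ennreal (w y * indicator (box l' u') y)"
        "q y * indicator (box l u) y = ennreal (- w y * indicator (box l' u') y)" for y
        unfolding p_def q_def i[symmetric] by (auto simp: indicator_def)
      then show ?thesis using eq[of l' u'] by (simp add: emeasure_density)
    qed
    have "density lborel p = density lborel q"
    proof (rule measure_eqI_generator_eq)
      let ?E = "range (\<lambda>(a, b). box a b :: (real ^ 'n) set)"
      show "Int_stable ?E" by (auto simp: Int_stable_def box_Int_box)
      show "?E \<subseteq> Pow UNIV" "sets (density lborel p) = sigma_sets UNIV ?E" "sets (density lborel q) = sigma_sets UNIV ?E"
        by (simp_all add: borel_eq_box)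
      let ?A = "\<lambda>n::nat. box (- (real n *\<^sub>R One)) (real n *\<^sub>R One) :: (real ^ 'n) set"
      show "range ?A \<subseteq> ?E" "(\<Union>i. ?A i) = UNIV" unfolding UN_box_eq_UNIV by auto
      show "emeasure (density lborel p) (?A i) \<noteq> \<infinity>" for i
        using dens by (metis less_irrefl)
      show "emeasure (density lborel p) X = emeasure (density lborel q) X" if "X \<in> ?E" for X
        using that dens by auto
    qed
    then have "AE y in lborel. p y = q y"
      by (intro sigma_finite_measure.density_unique[OF sigma_finite_lborel]) auto
    then show ?thesis
    proof eventually_elim
      case (elim y)
      \<comment> \<open>\<open>ennreal\<close> sends negative numbers to 0, so at most one of
        \<open>p y\<close> and \<open>q y\<close> is nonzero and their equality makes both
        vanish.\<close>
      then show ?case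
        by (cases "w y \<ge> 0") (auto simp: p_def q_def indicator_def ennreal_neg)
    qed
  qed
  then have "AE y in lborel. \<forall>n. y \<in> C n \<longrightarrow> w y = 0" unfolding AE_all_countable ..
  moreover have "(\<Union>n. C n) = UNIV" unfolding C_def by (rule UN_box_eq_UNIV)
  ultimately show ?thesis by (auto elim!: eventually_mono)
qed

lemma locally_integrable_mult_test:
  fixes w v :: "real ^ 'n::finite \<Rightarrow> real"
  assumes "locally_integrable w" "test_function v"
  shows "integrable lborel (\<lambda>y. w y * v y)"
proof -
  let ?K = "closure {y. v y \<noteq> 0}"
  have K: "compact ?K" by (rule test_functionD(4)[OF assms(2)])
  have cv: "continuous_on UNIV v" using test_functionD(2)[OF assms(2), of "[]"] by simp
  have [measurable]: "w \<in> borel_measurable borel" "v \<in> borel_measurable borel"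
    using assms(1) borel_measurable_continuous_onI[OF cv] by (simp_all add: locally_integrable_def)
  obtain M where M: "\<And>y. y \<in> ?K \<Longrightarrow> \<bar>v y\<bar> \<le> M"
    using compact_imp_bounded[OF compact_continuous_image[OF continuous_on_subset[OF cv] K]]
    unfolding bounded_iff by auto
  have z: "v y = 0" if "y \<notin> ?K" for y using foldr_partial_support[OF that, of "[]"] by simp
  show ?thesis
  proof (rule Bochner_Integration.integrable_bound)
    show "integrable lborel (\<lambda>y. M * (indicator ?K y *\<^sub>R w y))"
      using assms(1) K by (intro integrable_mult_right) (auto simp: locally_integrable_def set_integrable_def)
    show "AE y in lborel. norm (w y * v y) \<le> norm (M * (indicator ?K y *\<^sub>R w y))"
    proof (rule AE_I2)
      fix y show "norm (w y * v y) \<le> norm (M * (indicator ?K y *\<^sub>R w y))"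
      proof (cases "y \<in> ?K")
        case True
        then have "\<bar>v y\<bar> \<le> \<bar>M\<bar>" using M by (meson abs_ge_self order_trans)
        then show ?thesis using True by (simp add: abs_mult mult.commute[of "\<bar>w y\<bar>"] mult_right_mono)
      next
        case False
        then show ?thesis using z[OF False] by simp
      qed
    qed
  qed measurable
qed

text \<open>\<open>weak_D\<close> picks some weak derivative. Its difference from the classical one
  is annihilated by all test functions.\<close>

lemma weak_D_AE:
  fixes f :: "real ^ 'n::finite \<Rightarrow> real"
  assumes "f \<in> C_mixed \<eta>"
  shows "AE y in lborel. weak_D \<eta> f y = D \<eta> f y"
proof -
  have 1: "has_weak_deriv \<eta> f (D \<eta> f)" by (rule has_weak_deriv_D[OF assms])
  then have 2: "has_weak_deriv \<eta> f (weak_D \<eta> f)" unfolding weak_D_def by (rule someI[of "has_weak_deriv \<eta> f"])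
  have L: "locally_integrable (D \<eta> f)" "locally_integrable (weak_D \<eta> f)"
    using 1 2 by (auto simp: has_weak_deriv_def)
  have "AE y in lborel. weak_D \<eta> f y - D \<eta> f y = 0"
  proof (rule weak_zero_AE)
    show "locally_integrable (\<lambda>y. weak_D \<eta> f y - D \<eta> f y)"
      using L by (auto simp: locally_integrable_def intro: set_integral_diff)
    fix v :: "real ^ 'n \<Rightarrow> real" assume v: "test_function v"
    have "(LINT y|lborel. weak_D \<eta> f y * v y) = (LINT y|lborel. D \<eta> f y * v y)"
      using 1 2 v by (auto simp: has_weak_deriv_def)
    then show "(LINT y|lborel. (weak_D \<eta> f y - D \<eta> f y) * v y) = 0"
      using locally_integrable_mult_test[OF L(1) v] locally_integrable_mult_test[OF L(2) v]
      by (simp add: left_diff_distrib)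
  qed
  then show ?thesis by simp
qed

section \<open>Level sets of a function increasing in one coordinate\<close>

lemma vcons_nth [simp]: "vcons s y $ None = s" "vcons s y $ Some j = y $ j"
  by (simp_all add: vcons_def)

lemma vcons_add_None: "vcons (s + r) y = vcons s y + r *\<^sub>R axis None 1"
  by (simp add: vec_eq_iff axis_def split_option_all)

lemma vcons_add_axis: "vcons s (y + t *\<^sub>R axis i 1) = vcons s y + t *\<^sub>R axis (Some i) 1"
  by (simp add: vec_eq_iff axis_def split_option_all)

lemma vcons_surj: "vcons (z $ None) (\<chi> j. z $ Some j) = z"
  by (simp add: vec_eq_iff split_option_all)

lemma tendsto_vcons [tendsto_intros]:
  assumes "(f \<longlongrightarrow> s) F" "(g \<longlongrightarrow> y) F"
  shows "((\<lambda>z. vcons (f z) (g z)) \<longlongrightarrow> vcons s y) F"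
proof (rule vec_tendstoI)
  fix i show "((\<lambda>z. vcons (f z) (g z) $ i) \<longlongrightarrow> vcons s y $ i) F"
    by (cases i) (auto intro: assms tendsto_vec_nth)
qed

lemma continuous_on_vcons [continuous_intros]:
  "continuous_on A f \<Longrightarrow> continuous_on A g \<Longrightarrow> continuous_on A (\<lambda>z. vcons (f z) (g z))"
  unfolding continuous_on_def by (auto intro: tendsto_vcons)

lemma vcons_derivative:
  assumes "partial_differentiable None G"
  shows "((\<lambda>s. G (vcons s y)) has_real_derivative partial None G (vcons s y)) (at s)"
  using has_partial[OF assms, of "vcons 0 y" s] by (simp add: vcons_add_None[of 0, simplified, symmetric])

lemma vcons_derivative_axis:
  assumes "partial_differentiable (Some i) G"
  shows "((\<lambda>t. G (vcons s (y + t *\<^sub>R axis i 1))) has_real_derivative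
    partial (Some i) G (vcons s (y + r *\<^sub>R axis i 1))) (at r)"
  using has_partial[OF assms, of "vcons s y" r] by (simp add: vcons_add_axis)

lemma vcons_MVT:
  assumes "partial_differentiable None G"
  shows "\<exists>c. \<bar>c - s\<bar> \<le> \<bar>s' - s\<bar> \<and> G (vcons s' y) - G (vcons s y) = (s' - s) * partial None G (vcons c y)"
proof -
  consider "s < s'" | "s' < s" | "s = s'" by linarith
  then show ?thesis
  proof cases
    case 1
    from MVT2[OF 1 vcons_derivative[OF assms, of y]] obtain c where
      "s < c" "c < s'" "G (vcons s' y) - G (vcons s y) = (s' - s) * partial None G (vcons c y)" by blast
    then show ?thesis by (intro exI[of _ c]) auto
  next
    case 2
    from MVT2[OF 2 vcons_derivative[OF assms, of y]] obtain c where
      "s' < c" "c < s" "G (vcons s y) - G (vcons s' y) = (s - s') * partial None G (vcons c y)" by blast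
    then show ?thesis by (intro exI[of _ c]) (auto simp: algebra_simps)
  next
    case 3
    then show ?thesis by (intro exI[of _ s]) auto
  qed
qed

text \<open>An exact factorization of the increment in y0, with a slope \<open>g\<close> that
  converges even while the other coordinates move. It stands in for joint differentiability, since
  only partial derivatives are at hand.\<close>

lemma tendsto_vcons_MVT:
  assumes G: "partial_differentiable None G" "continuous_on UNIV (partial None G)"
    and X: "(X \<longlongrightarrow> s) F" and Y: "(Y \<longlongrightarrow> y) F"
  obtains g where "(g \<longlongrightarrow> partial None G (vcons s y)) F"
    "\<And>t. G (vcons (X t) (Y t)) - G (vcons s (Y t)) = (X t - s) * g t"
proof -
  have "\<forall>t. \<exists>c. \<bar>c - s\<bar> \<le> \<bar>X t - s\<bar> \<and>
      G (vcons (X t) (Y t)) - G (vcons s (Y t)) = (X t - s) * partial None G (vcons c (Y t))"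
    by (intro allI vcons_MVT[OF G(1)])
  from choice[OF this] obtain c where c: "\<And>t. \<bar>c t - s\<bar> \<le> \<bar>X t - s\<bar>"
    "\<And>t. G (vcons (X t) (Y t)) - G (vcons s (Y t)) = (X t - s) * partial None G (vcons (c t) (Y t))"
    by blast
  have "((\<lambda>t. X t - s) \<longlongrightarrow> 0) F" using X by (simp add: LIM_zero_iff)
  then have "((\<lambda>t. c t - s) \<longlongrightarrow> 0) F"
    by (rule Lim_null_comparison[rotated, OF tendsto_rabs_zero]) (simp add: c)
  then have "(c \<longlongrightarrow> s) F" by (simp add: LIM_zero_iff)
  then have "((\<lambda>t. partial None G (vcons (c t) (Y t))) \<longlongrightarrow> partial None G (vcons s y)) F"
    by (intro continuous_on_tendsto_compose[OF G(2)] tendsto_vcons Y) auto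
  then show ?thesis using c(2) by (rule that)
qed

text \<open>The increment along the curve is split into a move of \<open>y\<close> with y0 frozen,
  which contributes \<open>d\<close>, and a move of y0, which is the slope from
  \<open>tendsto_vcons_MVT\<close> times the difference quotient of \<open>X\<close>.\<close>

lemma vcons_chain:
  assumes G: "partial_differentiable None G" "continuous_on UNIV (partial None G)"
    and d: "((\<lambda>t. G (vcons (X 0) (y + t *\<^sub>R axis i 1))) has_real_derivative d) (at 0)"
    and X: "(X has_real_derivative X') (at 0)"
  shows "((\<lambda>t. G (vcons (X t) (y + t *\<^sub>R axis i 1))) has_real_derivative
    d + partial None G (vcons (X 0) y) * X') (at 0)"
proof -
  have "(X \<longlongrightarrow> X 0) (at 0)" using DERIV_isCont[OF X] by (simp add: isCont_def)
  moreover have "((\<lambda>t. y + t *\<^sub>R axis i 1) \<longlongrightarrow> y) (at (0::real))" by (auto intro!: tendsto_eq_intros)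
  ultimately obtain g where g: "(g \<longlongrightarrow> partial None G (vcons (X 0) y)) (at 0)"
    "\<And>t. G (vcons (X t) (y + t *\<^sub>R axis i 1)) - G (vcons (X 0) (y + t *\<^sub>R axis i 1)) = (X t - X 0) * g t"
    by (rule tendsto_vcons_MVT[OF G]) blast
  have 1: "((\<lambda>t. (G (vcons (X 0) (y + t *\<^sub>R axis i 1)) - G (vcons (X 0) y)) / t) \<longlongrightarrow> d) (at 0)"
    using d by (simp add: DERIV_def)
  have 2: "((\<lambda>t. (X t - X 0) / t) \<longlongrightarrow> X') (at 0)" using X by (simp add: DERIV_def)
  have "((\<lambda>t. (G (vcons (X 0) (y + t *\<^sub>R axis i 1)) - G (vcons (X 0) y)) / t + g t * ((X t - X 0) / t))
      \<longlongrightarrow> d + partial None G (vcons (X 0) y) * X') (at 0)"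
    by (intro tendsto_intros 1 2 g)
  moreover have "(G (vcons (X 0) (y + t *\<^sub>R axis i 1)) - G (vcons (X 0) y)) / t + g t * ((X t - X 0) / t)
      = (G (vcons (X t) (y + t *\<^sub>R axis i 1)) - G (vcons (X 0) y)) / t" for t
    using g(2)[of t] by (simp add: add_divide_distrib[symmetric] mult.commute)
  ultimately show ?thesis by (simp add: DERIV_def)
qed

locale level_sets =
  fixes \<phi> :: "real ^ ('d::finite option) \<Rightarrow> real"
  assumes phi_diff: "partial_differentiable None \<phi>"
    and phi_cont: "continuous_on UNIV \<phi>" "continuous_on UNIV (partial None \<phi>)"
    and phi_pos: "\<And>z. partial None \<phi> z > 0"
    and phi_top: "\<And>y. filterlim (\<lambda>s. \<phi> (vcons s y)) at_top at_top"
begin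

lemma phi_strict_mono: "s < t \<Longrightarrow> \<phi> (vcons s y) < \<phi> (vcons t y)"
  using MVT2[OF _ vcons_derivative[OF phi_diff, of y], of s t] phi_pos
  by (smt (verit) mult_pos_pos)

lemma phi_inj: "\<phi> (vcons s y) = \<phi> (vcons t y) \<longleftrightarrow> s = t"
  using phi_strict_mono[of s t y] phi_strict_mono[of t s y] by (cases s t rule: linorder_cases) auto

lemma phi_less_iff: "\<phi> (vcons s y) < \<phi> (vcons t y) \<longleftrightarrow> s < t"
  using phi_strict_mono[of s t y] phi_strict_mono[of t s y] by (cases s t rule: linorder_cases) auto

lemma xi_eqI: "\<phi> (vcons s y) = x \<Longrightarrow> xi \<phi> x y = s"
  unfolding xi_def by (rule the_equality) (auto simp: phi_inj)

lemma phi_xi: "y \<in> U \<phi> x \<Longrightarrow> \<phi> (vcons (xi \<phi> x y) y) = x"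
  unfolding U_def using xi_eqI by auto

lemma phi_IVT:
  assumes "\<phi> (vcons s y) \<le> x" "x \<le> \<phi> (vcons t y)"
  shows "y \<in> U \<phi> x" "s \<le> xi \<phi> x y" "xi \<phi> x y \<le> t"
proof -
  have st: "s \<le> t" using assms phi_less_iff[of t y s] by linarith
  have "continuous_on {s..t} (\<lambda>s. \<phi> (vcons s y))"
    by (rule continuous_on_compose2[OF phi_cont(1)]) (auto intro!: continuous_intros)
  from IVT'[OF assms st this] obtain r where "s \<le> r" "r \<le> t" "\<phi> (vcons r y) = x" by blast
  then show "y \<in> U \<phi> x" "s \<le> xi \<phi> x y" "xi \<phi> x y \<le> t"
    by (auto simp: U_def xi_eqI)
qed

text \<open>Since \<phi> is unbounded above on every line in direction y0, a value at most
  \<open>x\<close> would force a crossing of the level. A line that misses the level therefore lies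
  entirely above it.\<close>

lemma phi_gt_outside: "y \<notin> U \<phi> x \<Longrightarrow> x < \<phi> (vcons s y)"
proof (rule ccontr)
  assume *: "y \<notin> U \<phi> x" "\<not> x < \<phi> (vcons s y)"
  have "\<forall>\<^sub>F t in at_top. x \<le> \<phi> (vcons t y)"
    using phi_top[of y] by (simp add: filterlim_at_top)
  then obtain t where "x \<le> \<phi> (vcons t y)" by (metis eventually_happens trivial_limit_at_top_linorder)
  with phi_IVT(1)[of s y x t] * show False by simp
qed

lemma eventually_phi:
  assumes "open V" "\<phi> (vcons s p) \<in> V"
  shows "\<forall>\<^sub>F y in nhds p. \<phi> (vcons s y) \<in> V"
proof -
  have "continuous_on UNIV (\<lambda>y. \<phi> (vcons s y))"
    by (rule continuous_on_compose2[OF phi_cont(1)]) (auto intro!: continuous_intros)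
  then have "((\<lambda>y. \<phi> (vcons s y)) \<longlongrightarrow> \<phi> (vcons s p)) (nhds p)"
    by (simp add: continuous_on_eq_continuous_at isCont_def tendsto_nhds_iff)
  then show ?thesis using assms by (rule topological_tendstoD)
qed

text \<open>The strict inequalities for \<phi> at \<xi> - e and \<xi> + e persist for nearby points,
  and the intermediate value theorem traps the level between them. This yields openness of
  \<open>U \<phi> x\<close> and continuity of \<xi> at once.\<close>

lemma eventually_xi_near:
  assumes "y \<in> U \<phi> x" "e > 0"
  shows "\<forall>\<^sub>F z in nhds y. z \<in> U \<phi> x \<and> \<bar>xi \<phi> x z - xi \<phi> x y\<bar> \<le> e"
proof -
  let ?s = "xi \<phi> x y"
  have "\<phi> (vcons (?s - e) y) \<in> {..<x}" "\<phi> (vcons (?s + e) y) \<in> {x<..}"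
    using phi_strict_mono[of "?s - e" ?s y] phi_strict_mono[of ?s "?s + e" y] assms phi_xi by auto
  from eventually_phi[OF _ this(1)] eventually_phi[OF _ this(2)]
  have "\<forall>\<^sub>F z in nhds y. \<phi> (vcons (?s - e) z) < x" "\<forall>\<^sub>F z in nhds y. x < \<phi> (vcons (?s + e) z)"
    by simp_all
  then show ?thesis
  proof eventually_elim
    case (elim z)
    then show ?case using phi_IVT[of "?s - e" z x "?s + e"] by (simp add: abs_le_iff)
  qed
qed

lemma open_U: "open (U \<phi> x)"
  unfolding open_subopen[of "U \<phi> x"]
proof
  fix y assume "y \<in> U \<phi> x"
  from eventually_xi_near[OF this, of 1] show "\<exists>T. open T \<and> y \<in> T \<and> T \<subseteq> U \<phi> x"
    unfolding eventually_nhds by auto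
qed

lemma tendsto_xi:
  assumes "y \<in> U \<phi> x"
  shows "(xi \<phi> x \<longlongrightarrow> xi \<phi> x y) (nhds y)"
proof (rule tendstoI)
  fix e :: real assume "e > 0"
  with eventually_xi_near[OF assms, of "e / 2"]
  show "\<forall>\<^sub>F z in nhds y. dist (xi \<phi> x z) (xi \<phi> x y) < e"
    by (auto simp: dist_real_def elim!: eventually_mono)
qed

lemma continuous_on_xi: "continuous_on (U \<phi> x) (xi \<phi> x)"
  by (auto simp: continuous_on_eq_continuous_at open_U isCont_def tendsto_nhds_iff
      intro: filterlim_mono[OF tendsto_xi order_refl at_within_le_nhds])

text \<open>The inequality x < \<phi> at height \<open>R\<close> over \<open>p\<close> persists near
  \<open>p\<close>, and monotonicity pushes \<xi> below \<open>R\<close>. As \<open>R\<close> is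
  arbitrary, \<xi> tends to -infinity at the frontier.\<close>

lemma eventually_xi_less:
  assumes "p \<notin> U \<phi> x"
  shows "\<forall>\<^sub>F y in nhds p. y \<in> U \<phi> x \<longrightarrow> xi \<phi> x y < R"
proof -
  have "\<phi> (vcons R p) \<in> {x<..}" using phi_gt_outside[OF assms] by simp
  from eventually_phi[OF _ this] show ?thesis
  proof (rule eventually_mono)
    fix y assume y: "\<phi> (vcons R y) \<in> {x<..}"
    show "y \<in> U \<phi> x \<longrightarrow> xi \<phi> x y < R"
    proof
      assume "y \<in> U \<phi> x"
      then have "\<phi> (vcons (xi \<phi> x y) y) < \<phi> (vcons R y)" using y phi_xi by simp
      then show "xi \<phi> x y < R" by (simp add: phi_less_iff)
    qed
  qed simp
qed

text \<open>For fixed \<open>y\<close> this is the inverse function theorem in one variable. It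
  serves the delta function, whose preintegral is a derivative in the level.\<close>

lemma xi_derivative_level:
  assumes "y \<in> U \<phi> x"
  shows "((\<lambda>s. xi \<phi> s y) has_real_derivative inverse (partial None \<phi> (vcons (xi \<phi> x y) y))) (at x)"
proof -
  let ?p = "partial None \<phi> (vcons (xi \<phi> x y) y)"
  have p: "?p \<noteq> 0" using phi_pos[of "vcons (xi \<phi> x y) y"] by simp
  show ?thesis
    unfolding has_field_derivative_def
  proof (rule has_derivative_inverse_strong_x[where S=UNIV and f="\<lambda>s. \<phi> (vcons s y)" and f'="(*) ?p"])
    show "continuous_on UNIV (\<lambda>s. \<phi> (vcons s y))"
      by (rule continuous_on_compose2[OF phi_cont(1)]) (auto intro!: continuous_intros)
    show "((\<lambda>s. \<phi> (vcons s y)) has_derivative (*) ?p) (at (xi \<phi> x y))"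
      using vcons_derivative[OF phi_diff] unfolding has_field_derivative_def .
    show "(*) ?p \<circ> (*) (inverse ?p) = id" using p by (auto simp: fun_eq_iff)
  qed (auto simp: phi_xi[OF assms] xi_eqI)
qed

lemma tendsto_xi_line:
  assumes "y \<in> U \<phi> x"
  shows "((\<lambda>t. xi \<phi> x (y + t *\<^sub>R axis i 1)) \<longlongrightarrow> xi \<phi> x y) (at 0)"
    and "\<forall>\<^sub>F t in at 0. y + t *\<^sub>R axis i 1 \<in> U \<phi> x"
proof -
  have *: "((\<lambda>t. y + t *\<^sub>R axis i 1) \<longlongrightarrow> y) (at (0::real))" by (auto intro!: tendsto_eq_intros)
  show "((\<lambda>t. xi \<phi> x (y + t *\<^sub>R axis i 1)) \<longlongrightarrow> xi \<phi> x y) (at 0)"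
    by (rule filterlim_compose[OF tendsto_xi[OF assms] *])
  show "\<forall>\<^sub>F t in at 0. y + t *\<^sub>R axis i 1 \<in> U \<phi> x"
    using * open_U assms by (rule topological_tendstoD)
qed

text \<open>Since \<phi> is constant along the level set, its increments in y0 and in direction
  \<open>i\<close> cancel. With the exact factorization of the former this can be solved for the
  difference quotient of \<xi>, whose convergence is thereby proved and not presupposed.\<close>

lemma xi_derivative:
  assumes y: "y \<in> U \<phi> x" and i: "partial_differentiable (Some i) \<phi>"
  defines "z \<equiv> vcons (xi \<phi> x y) y"
  shows "((\<lambda>t. xi \<phi> x (y + t *\<^sub>R axis i 1)) has_real_derivative
    - partial (Some i) \<phi> z / partial None \<phi> z) (at 0)"
proof -
  define X where "X t = xi \<phi> x (y + t *\<^sub>R axis i 1)" for t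
  have X0: "X 0 = xi \<phi> x y" by (simp add: X_def)
  have lim: "(X \<longlongrightarrow> X 0) (at 0)" using tendsto_xi_line(1)[OF y] unfolding X_def by simp
  moreover have "((\<lambda>t. y + t *\<^sub>R axis i 1) \<longlongrightarrow> y) (at (0::real))" by (auto intro!: tendsto_eq_intros)
  ultimately obtain g where g: "(g \<longlongrightarrow> partial None \<phi> z) (at 0)"
    "\<And>t. \<phi> (vcons (X t) (y + t *\<^sub>R axis i 1)) - \<phi> (vcons (X 0) (y + t *\<^sub>R axis i 1)) = (X t - X 0) * g t"
    unfolding z_def X0[symmetric] by (rule tendsto_vcons_MVT[OF phi_diff phi_cont(2)]) blast
  have "((\<lambda>t. (\<phi> (vcons (X 0) (y + t *\<^sub>R axis i 1)) - \<phi> (vcons (X 0) y)) / t) \<longlongrightarrow> partial (Some i) \<phi> z) (at 0)"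
    using vcons_derivative_axis[OF i, of "X 0" y 0] by (simp add: DERIV_def z_def X0)
  then have "((\<lambda>t. - ((\<phi> (vcons (X 0) (y + t *\<^sub>R axis i 1)) - \<phi> (vcons (X 0) y)) / t) / g t)
      \<longlongrightarrow> - partial (Some i) \<phi> z / partial None \<phi> z) (at 0)"
    using phi_pos[of z] by (intro tendsto_intros g) auto
  moreover have "\<forall>\<^sub>F t in at 0. - ((\<phi> (vcons (X 0) (y + t *\<^sub>R axis i 1)) - \<phi> (vcons (X 0) y)) / t) / g t
      = (X t - X 0) / t"
    using order_tendstoD(1)[OF g(1) phi_pos] tendsto_xi_line(2)[OF y, of i]
  proof eventually_elim
    case (elim t)
    have "\<phi> (vcons (X t) (y + t *\<^sub>R axis i 1)) = x" unfolding X_def by (rule phi_xi[OF elim(2)])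
    moreover have "\<phi> (vcons (X 0) y) = x" unfolding X0 by (rule phi_xi[OF y])
    ultimately have "- (\<phi> (vcons (X 0) (y + t *\<^sub>R axis i 1)) - \<phi> (vcons (X 0) y)) = (X t - X 0) * g t"
      using g(2)[of t] by simp
    then have "- ((\<phi> (vcons (X 0) (y + t *\<^sub>R axis i 1)) - \<phi> (vcons (X 0) y)) / t) / g t
        = ((X t - X 0) * g t) / t / g t" by (metis minus_divide_left)
    then show ?case using elim(1) by simp
  qed
  ultimately have "((\<lambda>t. (X t - X 0) / t) \<longlongrightarrow> - partial (Some i) \<phi> z / partial None \<phi> z) (at 0)"
    by (rule Lim_transform_eventually)
  then show ?thesis by (simp add: DERIV_def X_def)
qed

end

section \<open>Differentiation of integrals over a lower half-line\<close>

text \<open>The upper limit and the parameter are separate arguments; \<xi> is substituted for the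
  limit only afterwards, by the chain rule.\<close>

definition lowint :: "(real \<Rightarrow> real) \<Rightarrow> (real ^ ('d::finite option) \<Rightarrow> real) \<Rightarrow> real \<Rightarrow> real ^ 'd \<Rightarrow> real" where
  "lowint \<rho> k s y = (LBINT \<sigma>:{..s}. k (vcons \<sigma> y) * \<rho> \<sigma>)"

text \<open>The condition of \<open>uniform_lower_tails\<close> for a single function, to be used
  for each derivative of \<theta>.\<close>

definition uniform_lower_tail :: "(real \<Rightarrow> real) \<Rightarrow> (real ^ ('d::finite option) \<Rightarrow> real) \<Rightarrow> bool" where
  "uniform_lower_tail \<rho> k \<longleftrightarrow> (\<forall>K. compact K \<longrightarrow>
     ((\<lambda>R. SUP y\<in>K. \<integral>\<^sup>+ \<sigma>\<in>{..R}. ennreal (\<bar>k (vcons \<sigma> y)\<bar> * \<rho> \<sigma>) \<partial>lborel) \<longlongrightarrow> 0) at_bot)"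

locale lower_integral =
  fixes \<rho> :: "real \<Rightarrow> real" and k :: "real ^ ('d::finite option) \<Rightarrow> real"
  assumes rho_cont: "continuous_on UNIV \<rho>" and rho_nonneg: "\<And>t. 0 \<le> \<rho> t"
    and k_cont: "continuous_on UNIV k" and k_tail: "uniform_lower_tail \<rho> k"
begin

abbreviation "integrand y \<equiv> \<lambda>\<sigma>. k (vcons \<sigma> y) * \<rho> \<sigma>"
abbreviation "tail_mass s y \<equiv> \<integral>\<^sup>+ \<sigma>\<in>{..s}. ennreal (norm (integrand y \<sigma>)) \<partial>lborel"

lemma integrand_cont:
  assumes "continuous_on A f" "continuous_on A g"
  shows "continuous_on A (\<lambda>z. k (vcons (f z) (g z)) * \<rho> (f z))"
  by (intro continuous_on_mult continuous_on_compose2[OF k_cont] continuous_on_compose2[OF rho_cont]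
      continuous_on_vcons assms) auto

lemma integrand_cont_line: "continuous_on A (integrand y)"
  by (intro integrand_cont continuous_intros)

lemma integrand_measurable [measurable]: "(integrand y) \<in> borel_measurable borel"
  by (rule borel_measurable_continuous_onI[OF integrand_cont_line])

lemma eventually_tail:
  assumes "compact K" "e > 0"
  shows "\<forall>\<^sub>F R in at_bot. \<forall>y\<in>K. tail_mass R y < ennreal e"
proof -
  have "((\<lambda>R. SUP y\<in>K. \<integral>\<^sup>+ \<sigma>\<in>{..R}. ennreal (\<bar>k (vcons \<sigma> y)\<bar> * \<rho> \<sigma>) \<partial>lborel) \<longlongrightarrow> 0) at_bot"
    using k_tail assms(1) unfolding uniform_lower_tail_def by blast
  then have "\<forall>\<^sub>F R in at_bot. (SUP y\<in>K. \<integral>\<^sup>+ \<sigma>\<in>{..R}. ennreal (\<bar>k (vcons \<sigma> y)\<bar> * \<rho> \<sigma>) \<partial>lborel) < ennreal e"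
    by (rule order_tendstoD(2)) (use assms(2) in simp)
  then show ?thesis
    by eventually_elim (auto simp: abs_mult rho_nonneg dest: SUP_lessD)
qed

text \<open>The tail condition for the compact set \<open>{y}\<close> gives integrability near
  -infinity; continuity covers the remaining bounded interval.\<close>

lemma set_integrable_lower: "set_integrable lborel {..s} (integrand y)"
proof -
  have "\<forall>\<^sub>F R in at_bot. R \<le> s \<and> (\<forall>y\<in>{y}. tail_mass R y < ennreal 1)"
    by (intro eventually_conj eventually_tail eventually_le_at_bot) auto
  then obtain R where R: "R \<le> s"
    "tail_mass R y < ennreal 1"
    by (auto dest: eventually_happens'[OF trivial_limit_at_bot_linorder])
  have 1: "set_integrable lborel {..R} (integrand y)"
    unfolding set_integrable_def
  proof (rule integrableI_bounded)
    have "(\<integral>\<^sup>+ \<sigma>. ennreal (norm (indicator {..R} \<sigma> *\<^sub>R (k (vcons \<sigma> y) * \<rho> \<sigma>))) \<partial>lborel)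
        = tail_mass R y"
      by (intro nn_integral_cong) (auto simp: indicator_def)
    also have "\<dots> < \<infinity>" using order.strict_trans[OF R(2) ennreal_less_top] by simp
    finally show "(\<integral>\<^sup>+ \<sigma>. ennreal (norm (indicator {..R} \<sigma> *\<^sub>R (k (vcons \<sigma> y) * \<rho> \<sigma>))) \<partial>lborel) < \<infinity>" .
  qed measurable
  have 2: "set_integrable lborel {R..s} (integrand y)"
    unfolding set_integrable_def by (rule borel_integrable_compact[OF compact_Icc integrand_cont_line])
  have "{..s} = {..R} \<union> {R..s}" using R(1) by auto
  then show ?thesis using set_integrable_Un[OF 1 2] by simp
qed

lemma lowint_split:
  assumes "R \<le> s"
  shows "lowint \<rho> k s y = lowint \<rho> k R y + integral {R..s} (integrand y)"
proof -
  let ?f = "integrand y"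
  have "{..s} = {..R} \<union> {R<..s}" using assms by auto
  then have "(LBINT \<sigma>:{..s}. ?f \<sigma>) = (LBINT \<sigma>:{..R}. ?f \<sigma>) + (LBINT \<sigma>:{R<..s}. ?f \<sigma>)"
    using set_integral_Un[of "{..R}" "{R<..s}" lborel ?f] set_integrable_lower
      set_integrable_subset[OF set_integrable_lower[of s y], of "{R<..s}"]
    by (simp add: ivl_disj_int_one)
  also have "(LBINT \<sigma>:{R<..s}. ?f \<sigma>) = (LBINT \<sigma>=R..s. ?f \<sigma>)"
    using assms by (simp add: interval_integral_Ioc)
  also have "\<dots> = integral {R..s} ?f"
    by (rule interval_integral_eq_integral[OF assms])
      (use set_integrable_subset[OF set_integrable_lower[of s y], of "{R..s}"] in auto)
  finally show ?thesis by (simp add: lowint_def)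
qed

lemma lowint_bound:
  "ennreal \<bar>lowint \<rho> k s y\<bar> \<le> tail_mass s y"
proof -
  have "ennreal (norm (LINT \<sigma>|lborel. indicator {..s} \<sigma> *\<^sub>R (k (vcons \<sigma> y) * \<rho> \<sigma>)))
      \<le> (\<integral>\<^sup>+ \<sigma>. ennreal (norm (indicator {..s} \<sigma> *\<^sub>R (k (vcons \<sigma> y) * \<rho> \<sigma>))) \<partial>lborel)"
    using set_integrable_lower[of s y] unfolding set_integrable_def by (rule integral_norm_bound_ennreal)
  also have "\<dots> = tail_mass s y"
    by (intro nn_integral_cong) (auto simp: indicator_def)
  finally show ?thesis by (simp add: lowint_def set_lebesgue_integral_def)
qed

lemma eventually_lowint_small:
  assumes "compact K" "e > 0"
  shows "\<forall>\<^sub>F R in at_bot. \<forall>s\<le>R. \<forall>y\<in>K. \<bar>lowint \<rho> k s y\<bar> < e"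
  using eventually_tail[OF assms]
proof eventually_elim
  case (elim R)
  show ?case
  proof (intro allI impI ballI)
    fix s y assume "s \<le> R" "y \<in> K"
    have "ennreal \<bar>lowint \<rho> k s y\<bar> \<le> tail_mass s y"
      by (rule lowint_bound)
    also have "\<dots> \<le> tail_mass R y"
      using \<open>s \<le> R\<close> by (intro nn_integral_mono) (auto simp: indicator_def)
    also have "\<dots> < ennreal e" using elim \<open>y \<in> K\<close> by blast
    finally show "\<bar>lowint \<rho> k s y\<bar> < e" by (simp add: ennreal_less_iff)
  qed
qed

lemma lowint_derivative:
  "((\<lambda>s. lowint \<rho> k s y) has_real_derivative k (vcons s y) * \<rho> s) (at s)"
proof -
  let ?f = "integrand y"
  have "((\<lambda>u. integral {s - 1..u} ?f) has_real_derivative ?f s) (at s within {s - 1..s + 1})"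
    by (rule integral_has_real_derivative[OF integrand_cont_line]) auto
  moreover have "at s within {s - 1..s + 1} = at s" by (rule at_within_interior) simp
  ultimately have "((\<lambda>u. integral {s - 1..u} ?f) has_real_derivative ?f s) (at s)" by (simp only:)
  from DERIV_add[OF DERIV_const[of "lowint \<rho> k (s - 1) y"] this]
  have "((\<lambda>u. lowint \<rho> k (s - 1) y + integral {s - 1..u} ?f) has_real_derivative ?f s) (at s)"
    by (simp only: add_0)
  then show ?thesis
  proof (rule has_field_derivative_transform_within_open[of _ _ _ "{s - 1<..}"])
    show "lowint \<rho> k (s - 1) y + integral {s - 1..u} ?f = lowint \<rho> k u y" if "u \<in> {s - 1<..}" for u
      using that by (intro lowint_split[symmetric]) simp
  qed auto
qed

text \<open>Uniformity of the tails enters here: uniform convergence of the truncated integrals is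
  what carries continuity and differentiability in the parameter over from bounded
  intervals.\<close>

lemma lowint_truncate_uniform:
  assumes "compact K"
  shows "uniform_limit K (\<lambda>n y. integral {s - real n..s} (integrand y)) (lowint \<rho> k s) sequentially"
proof (rule uniform_limitI)
  fix e :: real assume "e > 0"
  have "filterlim (\<lambda>n. s - real n) at_bot sequentially" by real_asymp
  from eventually_compose_filterlim[OF eventually_lowint_small[OF assms \<open>e > 0\<close>] this]
  show "\<forall>\<^sub>F n in sequentially. \<forall>y\<in>K. dist (integral {s - real n..s} (integrand y)) (lowint \<rho> k s y) < e"
  proof eventually_elim
    case (elim n)
    then show ?case using lowint_split[of "s - real n" s] by (simp add: dist_real_def)
  qed
qed

lemma continuous_on_lowint_param: "continuous_on UNIV (lowint \<rho> k s)"
proof (rule continuous_at_imp_continuous_on, rule ballI)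
  fix y :: "real ^ 'd"
  have "continuous_on (cball y 1) (lowint \<rho> k s)"
  proof (rule uniform_limit_theorem[OF _ lowint_truncate_uniform])
    show "\<forall>\<^sub>F n in sequentially. continuous_on (cball y 1) (\<lambda>y. integral {s - real n..s} (integrand y))"
    proof (rule always_eventually, rule allI)
      fix n
      have "continuous_on (cball y 1) (\<lambda>y. integral (cbox (s - real n) s) (integrand y))"
        by (rule integral_continuous_on_param)
          (simp add: split_beta, intro integrand_cont continuous_on_fst continuous_on_snd continuous_on_id)
      then show "continuous_on (cball y 1) (\<lambda>y. integral {s - real n..s} (integrand y))" by simp
    qed
  qed auto
  then show "isCont (lowint \<rho> k s) y" by (rule continuous_on_interior) auto
qed

text \<open>The lower integral as a function on the whole space, so that \<open>vcons_chain\<close> differentiates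
  \<open>lowint \<rho> k (\<xi> y) y\<close>.\<close>

definition "lowint_joint z = lowint \<rho> k (z $ None) (\<chi> j. z $ Some j)"

lemma lowint_joint_vcons [simp]: "lowint_joint (vcons s y) = lowint \<rho> k s y"
  by (simp add: lowint_joint_def)

lemma lowint_joint_partial:
  "partial_differentiable None lowint_joint"
  "partial None lowint_joint = (\<lambda>z. k z * \<rho> (z $ None))"
proof -
  have "((\<lambda>t. lowint_joint (z + t *\<^sub>R axis None 1)) has_real_derivative k z * \<rho> (z $ None)) (at 0)" for z
  proof -
    define s y where "s = z $ None" and "y = (\<chi> j. z $ Some j)"
    have z: "z = vcons s y" unfolding s_def y_def by (simp add: vcons_surj)
    have "((\<lambda>t. lowint \<rho> k (s + t) y) has_real_derivative k (vcons s y) * \<rho> s) (at 0)"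
      using DERIV_chain2[OF lowint_derivative DERIV_add[OF DERIV_const[of s] DERIV_ident], of y 0] by simp
    then show ?thesis unfolding z vcons_add_None[symmetric] by simp
  qed
  then show "partial_differentiable None lowint_joint"
    "partial None lowint_joint = (\<lambda>z. k z * \<rho> (z $ None))"
    by (rule partial_differentiableI)+
qed

lemma lowint_joint_partial_cont: "continuous_on UNIV (partial None lowint_joint)"
  unfolding lowint_joint_partial
  by (intro continuous_on_mult k_cont continuous_on_compose2[OF rho_cont linear_continuous_on[OF bounded_linear_vec_nth]]) auto

text \<open>Joint continuity, which separate continuity would not give: the increment in the limit
  is factored with a convergent slope, and the rest is continuity in the parameter for a fixed
  limit.\<close>

lemma continuous_on_lowint:
  assumes "continuous_on A f" "continuous_on A g"
  shows "continuous_on A (\<lambda>z. lowint \<rho> k (f z) (g z))"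
  unfolding continuous_on_def
proof
  fix z assume z: "z \<in> A"
  have f: "(f \<longlongrightarrow> f z) (at z within A)" and g: "(g \<longlongrightarrow> g z) (at z within A)"
    using assms z by (auto simp: continuous_on_def)
  obtain h where h: "(h \<longlongrightarrow> partial None lowint_joint (vcons (f z) (g z))) (at z within A)"
    "\<And>t. lowint_joint (vcons (f t) (g t)) - lowint_joint (vcons (f z) (g t)) = (f t - f z) * h t"
    by (rule tendsto_vcons_MVT[OF lowint_joint_partial(1) lowint_joint_partial_cont f g]) blast
  have "((\<lambda>t. (f t - f z) * h t + lowint \<rho> k (f z) (g t)) \<longlongrightarrow> (f z - f z) * partial None lowint_joint (vcons (f z) (g z)) + lowint \<rho> k (f z) (g z)) (at z within A)"
    by (intro tendsto_intros f h continuous_on_tendsto_compose[OF continuous_on_lowint_param g]) auto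
  moreover have "(f t - f z) * h t + lowint \<rho> k (f z) (g t) = lowint \<rho> k (f t) (g t)" for t
    using h(2)[of t] by simp
  ultimately show "((\<lambda>z. lowint \<rho> k (f z) (g z)) \<longlongrightarrow> lowint \<rho> k (f z) (g z)) (at z within A)" by simp
qed

end

text \<open>The Leibniz rule applies to the truncated integrals, and the tails of the differentiated
  integrand make their derivatives converge uniformly on a segment. The limit function
  \<open>g\<close> of the truncations is then identified through the tails of \<open>k\<close>
  itself.\<close>

lemma lowint_derivative_axis:
  assumes "lower_integral \<rho> k" "lower_integral \<rho> (partial (Some i) k)"
    and diff: "partial_differentiable (Some i) k"
  shows "((\<lambda>t. lowint \<rho> k s (y + t *\<^sub>R axis i 1)) has_real_derivative lowint \<rho> (partial (Some i) k) s y) (at 0)"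
proof -
  let ?k' = "partial (Some i) k"
  interpret K: lower_integral \<rho> k by fact
  interpret L: lower_integral \<rho> ?k' by fact
  let ?l = "\<lambda>t. y + t *\<^sub>R axis i 1"
  let ?S = "{-1..1::real}"
  define f where "f n t = integral {s - real n..s} (\<lambda>\<sigma>. k (vcons \<sigma> (?l t)) * \<rho> \<sigma>)" for n t
  define f' where "f' n t = integral {s - real n..s} (\<lambda>\<sigma>. ?k' (vcons \<sigma> (?l t)) * \<rho> \<sigma>)" for n t
  have K: "compact (?l ` ?S)" by (intro compact_continuous_image continuous_intros) auto
  have "\<exists>g. \<forall>t\<in>?S. (\<lambda>n. f n t) \<longlonglongrightarrow> g t \<and>
      (g has_derivative (*) (lowint \<rho> ?k' s (?l t))) (at t within ?S)"
  proof (rule has_derivative_sequence)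
    show "(f n has_derivative (*) (f' n t)) (at t within ?S)" if "t \<in> ?S" for n t
    proof -
      have "((\<lambda>t. integral (cbox (s - real n) s) (\<lambda>\<sigma>. k (vcons \<sigma> (?l t)) * \<rho> \<sigma>)) has_field_derivative
          integral (cbox (s - real n) s) (\<lambda>\<sigma>. ?k' (vcons \<sigma> (?l t)) * \<rho> \<sigma>)) (at t within ?S)"
      proof (rule leibniz_rule_field_derivative[where U="?S"])
        show "((\<lambda>t. k (vcons \<sigma> (?l t)) * \<rho> \<sigma>) has_field_derivative ?k' (vcons \<sigma> (?l t)) * \<rho> \<sigma>) (at t within ?S)"
          for t \<sigma>
          by (rule has_field_derivative_at_within[OF DERIV_cmult_right[OF vcons_derivative_axis[OF diff]]])
        show "(\<lambda>\<sigma>. k (vcons \<sigma> (?l t)) * \<rho> \<sigma>) integrable_on cbox (s - real n) s" for t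
          by (rule integrable_continuous[OF K.integrand_cont_line])
        show "continuous_on (?S \<times> cbox (s - real n) s) (\<lambda>(t, \<sigma>). ?k' (vcons \<sigma> (?l t)) * \<rho> \<sigma>)"
          unfolding split_beta by (intro L.integrand_cont continuous_intros)
      qed (use that in auto)
      then show ?thesis unfolding f_def f'_def has_field_derivative_def by simp
    qed
    fix e :: real assume "e > 0"
    from uniform_limitD[OF L.lowint_truncate_uniform[OF K] this, of s]
    show "\<forall>\<^sub>F n in sequentially. \<forall>t\<in>?S. \<forall>h. norm (f' n t * h - lowint \<rho> ?k' s (?l t) * h) \<le> e * norm h"
    proof eventually_elim
      case (elim n)
      show ?case
      proof (intro ballI allI)
        fix t h assume "t \<in> ?S"
        then have "\<bar>f' n t - lowint \<rho> ?k' s (?l t)\<bar> \<le> e"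
          using elim by (auto simp: f'_def dist_real_def intro: less_imp_le)
        then show "norm (f' n t * h - lowint \<rho> ?k' s (?l t) * h) \<le> e * norm h"
          by (simp add: left_diff_distrib[symmetric] abs_mult mult_right_mono)
      qed
    qed
  next
    show "(\<lambda>n. f n 0) \<longlonglongrightarrow> lowint \<rho> k s (?l 0)"
      unfolding f_def by (rule tendsto_uniform_limitI[OF K.lowint_truncate_uniform[OF K]]) auto
  qed auto
  then obtain g where g: "\<And>t. t \<in> ?S \<Longrightarrow> (\<lambda>n. f n t) \<longlonglongrightarrow> g t"
    "\<And>t. t \<in> ?S \<Longrightarrow> (g has_derivative (*) (lowint \<rho> ?k' s (?l t))) (at t within ?S)"
    by blast
  have "g t = lowint \<rho> k s (?l t)" if "t \<in> ?S" for t
  proof (rule LIMSEQ_unique[OF g(1)[OF that]])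
    show "(\<lambda>n. f n t) \<longlonglongrightarrow> lowint \<rho> k s (?l t)"
      unfolding f_def by (rule tendsto_uniform_limitI[OF K.lowint_truncate_uniform[OF K]]) (use that in auto)
  qed
  moreover have "(g has_real_derivative lowint \<rho> ?k' s y) (at 0)"
  proof -
    have "at 0 within ?S = at (0::real)" by (rule at_within_interior) simp
    then show ?thesis using g(2)[of 0] unfolding has_field_derivative_def by simp
  qed
  ultimately show ?thesis
    by (elim has_field_derivative_transform_within_open[of _ _ _ "{-1<..<1}"]) auto
qed

section \<open>Derivatives of the preintegrated functions\<close>

lemma mcons_simps [simp]: "mcons k \<nu> None = k" "mcons k \<nu> (Some i) = \<nu> i"
  by (simp_all add: mcons_def)

lemma mcons_le_iff: "\<mu> \<le> mcons k \<nu> \<longleftrightarrow> \<mu> None \<le> k \<and> (\<forall>i. \<mu> (Some i) \<le> \<nu> i)"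
  by (simp add: le_fun_def split_option_all)

lemma madd_mcons [simp]: "(mcons k \<nu>)(Some i := Suc (\<nu> i)) = mcons k (madd i \<nu>)"
  by (auto simp: fun_eq_iff split_option_all)

lemma mabs_madd [simp]: "mabs (madd i \<eta>) = Suc (mabs \<eta>)"
  unfolding mabs_def by (simp add: sum.remove[of UNIV i])

lemma mabs_mono: "\<eta> \<le> \<nu> \<Longrightarrow> mabs \<eta> \<le> mabs \<nu>"
  unfolding mabs_def le_fun_def by (simp add: sum_mono)

lemma mabs_mcons [simp]: "mabs (mcons k \<nu>) = k + mabs \<nu>"
  by (simp add: mabs_def UNIV_option_conv sum.reindex)

lemma count_list_Cons: "count_list (i # is) = madd i (count_list is)"
  by (auto simp: fun_eq_iff)

lemma count_list_tail_le:
  assumes "count_list (i # is) \<le> \<nu>"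
  shows "count_list is \<le> \<nu>"
proof (rule le_funI)
  fix j show "count_list is j \<le> \<nu> j" using le_funD[OF assms, of j] by (simp split: if_splits)
qed

lemma mabs_count_list: "mabs (count_list is) = length is"
proof (induction "is")
  case (Cons i "is")
  then show ?case by (simp only: count_list_Cons mabs_madd list.size)
qed (simp add: mabs_def)

lemma munit_simps [simp]: "munit i i = 1" "j \<noteq> i \<Longrightarrow> munit i j = 0"
  by (simp_all add: munit_def)

lemma munit_Some [simp]: "munit (Some i) (Some j) = (if j = i then 1 else 0)"
  by (simp add: munit_def)

lemma munit_neq [simp]: "munit i \<noteq> (\<lambda>_. 0)" "munit (Some j) \<noteq> munit None"
    "\<mu>(i := Suc n) \<noteq> (\<lambda>_. 0)" "\<mu>'(Some j := Suc n) \<noteq> munit None"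
  by (auto simp: munit_def fun_eq_iff)

text \<open>The product rule for a product over a list sums over these lists.\<close>

primrec substs :: "('a \<Rightarrow> 'a) \<Rightarrow> 'a list \<Rightarrow> 'a list list" where
  "substs f [] = []"
| "substs f (a # as) = (f a # as) # map ((#) a) (substs f as)"

lemma length_substs [simp]: "length (substs f as) = length as"
  by (induction as) auto

lemma length_in_substs: "bs \<in> set (substs f as) \<Longrightarrow> length bs = length as"
  by (induction as arbitrary: bs) auto

lemma in_substs: "bs \<in> set (substs f as) \<Longrightarrow> b \<in> set bs \<Longrightarrow> b \<in> set as \<or> b \<in> f ` set as"
  by (induction as arbitrary: bs) fastforce+

lemma sum_list_substs:
  fixes g :: "'a \<Rightarrow> nat"
  shows "bs \<in> set (substs f as) \<Longrightarrow> (\<And>a. g (f a) = g a + c) \<Longrightarrow> (\<Sum>b\<leftarrow>bs. g b) = (\<Sum>a\<leftarrow>as. g a) + c"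
  by (induction as arbitrary: bs) auto

text \<open>Every factor varies both directly, through \<open>f\<close>, and through \<xi>, through
  \<open>g\<close> with the common coefficient \<open>c\<close>; this separates the product rule
  into two sums.\<close>

lemma prod_list_derivative:
  fixes F :: "'a \<Rightarrow> real \<Rightarrow> real"
  assumes "\<And>a. a \<in> set as \<Longrightarrow> (F a has_real_derivative v (f a) + v (g a) * c) (at t)"
    "\<And>a. F a t = v a"
  shows "((\<lambda>t. \<Prod>a\<leftarrow>as. F a t) has_real_derivative
    (\<Sum>bs\<leftarrow>substs f as. \<Prod>b\<leftarrow>bs. v b) + c * (\<Sum>bs\<leftarrow>substs g as. \<Prod>b\<leftarrow>bs. v b)) (at t)"
  using assms(1)
proof (induction as)
  case (Cons a as)
  have "((\<lambda>t. \<Prod>a\<leftarrow>as. F a t) has_real_derivative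
    (\<Sum>bs\<leftarrow>substs f as. \<Prod>b\<leftarrow>bs. v b) + c * (\<Sum>bs\<leftarrow>substs g as. \<Prod>b\<leftarrow>bs. v b)) (at t)"
    by (rule Cons.IH) (use Cons.prems in auto)
  from DERIV_mult[OF Cons.prems[of a] this] show ?case
    by (simp add: comp_def sum_list_const_mult assms(2) algebra_simps)
qed simp

lemma tendsto_sum_list:
  fixes f :: "'a \<Rightarrow> 'b \<Rightarrow> real"
  assumes "\<And>t. t \<in> set ts \<Longrightarrow> (f t \<longlongrightarrow> g t) F"
  shows "((\<lambda>y. \<Sum>t\<leftarrow>ts. f t y) \<longlongrightarrow> (\<Sum>t\<leftarrow>ts. g t)) F"
  using assms by (induction ts) (auto intro!: tendsto_add)

lemma DERIV_sum_list:
  fixes f :: "'a \<Rightarrow> real \<Rightarrow> real"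
  assumes "\<And>t. t \<in> set ts \<Longrightarrow> (f t has_real_derivative g t) (at z within S)"
  shows "((\<lambda>y. \<Sum>t\<leftarrow>ts. f t y) has_real_derivative (\<Sum>t\<leftarrow>ts. g t)) (at z within S)"
  using assms by (induction ts) (auto intro!: DERIV_add)

section \<open>Formal terms of the derivatives and their number\<close>

type_synonym 'd hterm = "('d option \<Rightarrow> nat) list \<times> nat \<times> ('d option \<Rightarrow> nat)"

text \<open>The summands of the derivative of \<open>h_fun\<close> in direction \<open>i\<close>; the entries \<open>munit (Some i)\<close>
  come from \<open>\<partial>\<^sub>i\<xi> = - \<partial>\<^sub>i\<phi> / \<partial>\<^sub>0\<phi>\<close>.\<close>

fun step :: "'d \<Rightarrow> nat \<Rightarrow> 'd hterm \<Rightarrow> 'd hterm list" where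
  "step i q (\<alpha>s, \<beta>, \<mu>) =
     [(\<alpha>s, \<beta>, madd (Some i) \<mu>), (munit (Some i) # \<alpha>s, \<beta>, madd None \<mu>), (munit (Some i) # \<alpha>s, Suc \<beta>, \<mu>)]
     @ map (\<lambda>\<beta>s. (\<beta>s, \<beta>, \<mu>)) (substs (madd (Some i)) \<alpha>s)
     @ map (\<lambda>\<beta>s. (munit (Some i) # \<beta>s, \<beta>, \<mu>)) (substs (madd None) \<alpha>s)
     @ replicate (length \<alpha>s + q) (madd (Some i) (munit None) # \<alpha>s, \<beta>, \<mu>)
     @ replicate (length \<alpha>s + q) (madd None (munit None) # munit (Some i) # \<alpha>s, \<beta>, \<mu>)"

fun adm :: "nat \<Rightarrow> ('d::finite \<Rightarrow> nat) \<Rightarrow> 'd hterm \<Rightarrow> bool" where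
  "adm q \<eta> (\<alpha>s, \<beta>, \<mu>) = h_admissible q \<eta> \<alpha>s \<beta> \<mu>"

text \<open>For \<open>q = 0\<close> the function also has an integral over \<open>y\<^sub>0 \<le> \<xi>\<close>; its upper limit contributes the
  first term of \<open>deriv_terms 0 (i # is)\<close>.\<close>

fun deriv_terms :: "nat \<Rightarrow> 'd list \<Rightarrow> 'd hterm list" where
  "deriv_terms q [] = (if q = 0 then [] else [([], 0, \<lambda>_. 0)])"
| "deriv_terms q (i # is) =
     (if q = 0 then [([munit (Some i)], 0, mcons 0 (count_list is))] else [])
     @ concat (map (step i q) (deriv_terms q is))"

text \<open>In every summand the order in y_i rises by one, while the total order in y0 and the
  length r rise by the same amount 0, 1 or 2; the bound 2 |\<eta>| + q - 1 on r grows by exactly 2.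
  The entry of order 2 in y0 is allowed because admissibility of \<open>t\<close> already forces
  |\<eta>| + q to be at least 1.\<close>

lemma adm_step:
  assumes "adm q \<eta> t" "s \<in> set (step i q t)"
  shows "adm q (madd i \<eta>) s"
proof -
  obtain \<alpha>s \<beta> \<mu> where t: "t = (\<alpha>s, \<beta>, \<mu>)" by (cases t)
  have a: "\<And>\<alpha>. \<alpha> \<in> set \<alpha>s \<Longrightarrow> \<alpha> \<noteq> (\<lambda>_. 0)" "\<And>\<alpha>. \<alpha> \<in> set \<alpha>s \<Longrightarrow> \<alpha> \<noteq> munit None"
      "\<And>\<alpha>. \<alpha> \<in> set \<alpha>s \<Longrightarrow> \<alpha> None \<le> mabs \<eta> + q"
      "length \<alpha>s + 1 \<le> 2 * mabs \<eta> + q" "\<beta> + 1 \<le> mabs \<eta> + q" "mabs \<mu> \<le> mabs \<eta>"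
      "\<mu> None + \<beta> + (\<Sum>\<alpha>\<leftarrow>\<alpha>s. \<alpha> None) + 1 = length \<alpha>s + q"
      "\<And>j. \<mu> (Some j) + (\<Sum>\<alpha>\<leftarrow>\<alpha>s. \<alpha> (Some j)) = \<eta> j"
    using assms(1) by (auto simp: t h_admissible_def Let_def)
  have a3: "\<And>\<alpha>. \<alpha> \<in> set \<alpha>s \<Longrightarrow> \<alpha> None \<le> Suc (mabs \<eta> + q)" using a(3) le_SucI by blast
  have n1: "madd None \<alpha> \<noteq> munit None" if "\<alpha> \<noteq> (\<lambda>_. 0)" for \<alpha> :: "'a option \<Rightarrow> nat"
  proof
    assume *: "madd None \<alpha> = munit None"
    have "\<alpha> j = 0" for j using fun_cong[OF *, of j] by (cases j) (auto simp: munit_def)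
    then show False using that by auto
  qed
  have n2: "madd (Some i) \<alpha> \<noteq> munit None" for \<alpha> :: "'a option \<Rightarrow> nat"
    by (metis fun_upd_same munit_simps(2) nat.distinct(1) option.distinct(1))
  have n3: "madd None (munit None) \<noteq> (munit None :: 'a option \<Rightarrow> nat)"
    by (rule n1) simp
  define \<eta>' where "\<eta>' = madd i \<eta>"
  have m: "mabs \<eta>' = Suc (mabs \<eta>)" by (simp add: \<eta>'_def)
  have e: "\<eta>' j = \<mu> (Some j) + (\<Sum>\<alpha>\<leftarrow>\<alpha>s. \<alpha> (Some j)) + (if j = i then 1 else 0)" for j
    using a(8)[of j] by (simp add: \<eta>'_def)
  consider
      "s = (\<alpha>s, \<beta>, madd (Some i) \<mu>)"
    | "s = (munit (Some i) # \<alpha>s, \<beta>, madd None \<mu>)"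
    | "s = (munit (Some i) # \<alpha>s, Suc \<beta>, \<mu>)"
    | \<beta>s where "s = (\<beta>s, \<beta>, \<mu>)" "\<beta>s \<in> set (substs (madd (Some i)) \<alpha>s)"
    | \<beta>s where "s = (munit (Some i) # \<beta>s, \<beta>, \<mu>)" "\<beta>s \<in> set (substs (madd None) \<alpha>s)"
    | "s = (madd (Some i) (munit None) # \<alpha>s, \<beta>, \<mu>)"
    | "s = (madd None (munit None) # munit (Some i) # \<alpha>s, \<beta>, \<mu>)"
    using assms(2) unfolding t by (auto split: if_splits)
  then have "adm q \<eta>' s"
  proof cases
    case 4
    have "\<alpha> \<noteq> (\<lambda>_. 0) \<and> \<alpha> \<noteq> munit None \<and> \<alpha> None \<le> Suc (mabs \<eta> + q)" if "\<alpha> \<in> set \<beta>s" for \<alpha>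
      using in_substs[OF 4(2) that] a(1,2) a3 n2 by auto
    moreover have "(\<Sum>\<alpha>\<leftarrow>\<beta>s. \<alpha> None) = (\<Sum>\<alpha>\<leftarrow>\<alpha>s. \<alpha> None)"
      using sum_list_substs[OF 4(2), of "\<lambda>\<alpha>. \<alpha> None" 0] by simp
    moreover have "(\<Sum>\<alpha>\<leftarrow>\<beta>s. \<alpha> (Some j)) = (\<Sum>\<alpha>\<leftarrow>\<alpha>s. \<alpha> (Some j)) + (if j = i then 1 else 0)" for j
      using sum_list_substs[OF 4(2), of "\<lambda>\<alpha>. \<alpha> (Some j)" "if j = i then 1 else 0"] by simp
    ultimately show ?thesis
      using a(4-7) length_in_substs[OF 4(2)] by (simp add: m e 4(1) h_admissible_def Let_def)
  next
    case 5
    have "\<alpha> \<noteq> (\<lambda>_. 0) \<and> \<alpha> \<noteq> munit None \<and> \<alpha> None \<le> Suc (mabs \<eta> + q)" if "\<alpha> \<in> set \<beta>s" for \<alpha>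
      using in_substs[OF 5(2) that] a(1,2) a3 a(3) n1 by auto
    moreover have "(\<Sum>\<alpha>\<leftarrow>\<beta>s. \<alpha> None) = (\<Sum>\<alpha>\<leftarrow>\<alpha>s. \<alpha> None) + 1"
      using sum_list_substs[OF 5(2), of "\<lambda>\<alpha>. \<alpha> None" 1] by simp
    moreover have "(\<Sum>\<alpha>\<leftarrow>\<beta>s. \<alpha> (Some j)) = (\<Sum>\<alpha>\<leftarrow>\<alpha>s. \<alpha> (Some j))" for j
      using sum_list_substs[OF 5(2), of "\<lambda>\<alpha>. \<alpha> (Some j)" 0] by simp
    ultimately show ?thesis
      using a(4-7) length_in_substs[OF 5(2)] by (simp add: m e 5(1) h_admissible_def Let_def)
  qed (use a(4-7) a(1,2) a3 n2 n3 in \<open>simp_all add: m e h_admissible_def Let_def\<close>)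
  then show ?thesis by (simp only: \<eta>'_def)
qed

text \<open>For q = 1 the empty product balances the orders in y0. For q = 0 no term of order zero
  is admissible, and the terms start from the upper limit of the integral.\<close>

lemma adm_deriv_terms: "q \<le> 1 \<Longrightarrow> t \<in> set (deriv_terms q is) \<Longrightarrow> adm q (count_list is) t"
proof (induction "is" arbitrary: t)
  case Nil
  then show ?case by (auto simp: h_admissible_def mabs_def split: if_splits)
next
  case (Cons i "is")
  have init: "h_admissible 0 (madd i \<eta>) [munit (Some i)] 0 (mcons 0 \<eta>)" for \<eta>
    by (simp add: h_admissible_def)
  from Cons consider "q = 0" "t = ([munit (Some i)], 0, mcons 0 (count_list is))"
    | s where "s \<in> set (deriv_terms q is)" "t \<in> set (step i q s)"
    by (auto split: if_splits)
  then show ?case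
  proof cases
    case 1
    then show ?thesis
      unfolding count_list_Cons using init[of "count_list is"] 1 by (simp only: adm.simps)
  next
    case 2
    show ?thesis
      unfolding count_list_Cons by (rule adm_step[OF Cons.IH[OF Cons.prems(1) 2(1)] 2(2)])
  qed
qed

text \<open>A term with r factors yields 3 + 2 r + 2 (r + q) summands, and r is at most 2 |\<eta>| +
  q - 1, so there are at most 8 |\<eta>| + 6 q - 1 of them.\<close>

lemma length_step:
  assumes "adm q \<eta> t"
  shows "length (step i q t) + 1 \<le> 8 * mabs \<eta> + 6 * q"
  using assms by (cases t) (auto simp: h_admissible_def Let_def)

lemma length_concat_le:
  "(\<And>x. x \<in> set xs \<Longrightarrow> length (f x) \<le> c) \<Longrightarrow> length (concat (map f xs)) \<le> length xs * c"
  by (induction xs) (auto simp: add_mono)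

text \<open>The 1 to spare in \<open>length_step\<close> pays for the new term from the upper limit:
  M (8 n - 1) + 1 is at most 8 n M once M is at least 1. The first differentiation creates just that
  one term, hence the shift by one in the power and the factorial.\<close>

lemma length_deriv_terms_0:
  fixes "is" :: "'d::finite list"
  shows "is \<noteq> [] \<Longrightarrow> length (deriv_terms 0 is) \<le> 8 ^ (length is - 1) * fact (length is - 1)"
proof (induction "is")
  case (Cons i "is")
  show ?case
  proof (cases "is = []")
    case False
    define M :: nat where "M = 8 ^ (length is - 1) * fact (length is - 1)"
    have M: "1 \<le> M" by (simp add: M_def)
    obtain n where n: "length is = Suc n" using False by (cases "is") auto
    have "length (step i 0 t) \<le> 8 * length is - 1" if "t \<in> set (deriv_terms 0 is)" for t
      using length_step[OF adm_deriv_terms[OF _ that], of i] by (simp add: mabs_count_list)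
    then have "length (concat (map (step i 0) (deriv_terms 0 is))) \<le> length (deriv_terms 0 is) * (8 * length is - 1)"
      by (rule length_concat_le)
    also have "\<dots> \<le> M * (8 * length is - 1)"
      using Cons.IH[OF False] by (simp add: M_def)
    also have "\<dots> + 1 \<le> M * (8 * length is)"
      using M by (simp add: n algebra_simps)
    finally have "length (deriv_terms 0 (i # is)) \<le> M * (8 * length is)" by simp
    also have "\<dots> = 8 ^ length is * fact (length is)" using n by (simp add: M_def algebra_simps)
    finally show ?thesis by simp
  qed simp
qed simp

text \<open>From a single term of order zero, the step at order n multiplies the count by at most 8
  n + 5, which is below 8 (n + 1).\<close>

lemma length_deriv_terms_1:
  fixes "is" :: "'d::finite list"
  shows "length (deriv_terms 1 is) \<le> 8 ^ length is * fact (length is)"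
proof (induction "is")
  case (Cons i "is")
  have "length (step i 1 t) \<le> 8 * Suc (length is)" if "t \<in> set (deriv_terms 1 is)" for t
    using length_step[OF adm_deriv_terms[OF _ that], of i] by (simp add: mabs_count_list)
  then have "length (concat (map (step i 1) (deriv_terms 1 is))) \<le> length (deriv_terms 1 is) * (8 * Suc (length is))"
    by (rule length_concat_le)
  also have "\<dots> \<le> (8 ^ length is * fact (length is)) * (8 * Suc (length is))"
    by (rule mult_right_mono[OF Cons.IH]) simp
  also have "\<dots> = 8 ^ length (i # is) * fact (length (i # is))" by (simp add: algebra_simps)
  finally show ?case by simp
qed simp


section \<open>Classical derivatives of the preintegrated functions\<close>

locale preintegration = level_sets \<phi>
  for \<phi> :: "real ^ ('d::finite option) \<Rightarrow> real" +
  fixes \<rho> :: "real \<Rightarrow> real" and \<theta> :: "real ^ ('d option) \<Rightarrow> real" and \<nu> :: "'d \<Rightarrow> nat"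
    and x :: real and q :: nat
  assumes theta_C: "\<theta> \<in> C_mixed (mcons (mabs \<nu> + 1) \<nu>)"
    and phi_C: "\<phi> \<in> C_mixed (mcons (mabs \<nu> + 1) \<nu>)"
    and rho_C: "\<rho> \<in> C_real (mabs \<nu>)"
    and rho_nonneg: "\<And>t. 0 \<le> \<rho> t"
    and q: "q \<le> 1"
    and tails: "q = 0 \<Longrightarrow> uniform_lower_tails \<rho> \<nu> \<theta>"
    and boundary: "\<And>\<eta> \<alpha>s \<beta> \<mu> p. \<eta> \<le> \<nu> \<Longrightarrow> h_admissible q \<eta> \<alpha>s \<beta> \<mu> \<Longrightarrow> p \<in> frontier (U \<phi> x) \<Longrightarrow>
      (h_fun \<rho> \<theta> \<phi> q \<alpha>s \<beta> \<mu> x \<longlongrightarrow> 0) (at p within U \<phi> x)"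
begin

abbreviation "\<kappa> \<equiv> mcons (mabs \<nu> + 1) \<nu>"
abbreviation "V \<equiv> U \<phi> x"

definition "pt y = vcons (xi \<phi> x y) y"

lemma continuous_on_pt: "continuous_on V pt"
  unfolding pt_def by (intro continuous_intros continuous_on_xi)

lemma phi0_pos: "D (munit None) \<phi> z > 0"
  using phi_pos by (simp add: D_munit)

lemma rho_cont: "continuous_on UNIV ((deriv ^^ \<beta>) \<rho>)" if "\<beta> \<le> mabs \<nu>"
  using rho_C that by (simp add: C_real_def)

lemma rho_derivative:
  "((deriv ^^ \<beta>) \<rho> has_real_derivative (deriv ^^ Suc \<beta>) \<rho> t) (at t)" if "\<beta> < mabs \<nu>"
  using rho_C that by (simp add: C_real_def DERIV_deriv_iff_field_differentiable)

abbreviation "dxi i y \<equiv> - D (munit (Some i)) \<phi> (pt y) * (1 / D (munit None) \<phi> (pt y))"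

lemma xi_line_derivative:
  assumes "y \<in> V" "\<nu> i \<noteq> 0"
  shows "((\<lambda>t. xi \<phi> x (y + t *\<^sub>R axis i 1)) has_real_derivative dxi i y) (at 0)"
proof -
  have "madd (Some i) (\<lambda>_. 0) \<le> \<kappa>" using assms(2) by (auto simp: le_fun_def split_option_all)
  then have "partial_differentiable (Some i) \<phi>" using partial_D(1)[OF phi_C] by fastforce
  from xi_derivative[OF assms(1) this] show ?thesis by (simp add: pt_def D_munit)
qed

lemma D_line_derivative:
  assumes f: "f \<in> C_mixed \<kappa>" and \<mu>: "madd None \<mu> \<le> \<kappa>" "madd (Some i) \<mu> \<le> \<kappa>" and y: "y \<in> V"
  shows "((\<lambda>t. D \<mu> f (pt (y + t *\<^sub>R axis i 1))) has_real_derivative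
    D (madd (Some i) \<mu>) f (pt y) + D (madd None \<mu>) f (pt y) * dxi i y) (at 0)"
proof -
  note p0 = partial_D[OF f \<mu>(1)] and pi = partial_D[OF f \<mu>(2)]
  have "\<nu> i \<noteq> 0" using le_funD[OF \<mu>(2), of "Some i"] by simp
  note xi' = xi_line_derivative[OF y this]
  have "continuous_on UNIV (partial None (D \<mu> f))"
    unfolding p0 by (rule continuous_on_D[OF f \<mu>(1)])
  moreover have "((\<lambda>t. D \<mu> f (vcons (xi \<phi> x (y + 0 *\<^sub>R axis i 1)) (y + t *\<^sub>R axis i 1)))
      has_real_derivative D (madd (Some i) \<mu>) f (pt y)) (at 0)"
    using vcons_derivative_axis[OF pi(1), of "xi \<phi> x y" y 0] by (simp add: pi(2) pt_def)
  ultimately show ?thesis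
    using vcons_chain[OF p0(1) _ _ xi'] by (simp add: p0(2) pt_def)
qed

fun hterm :: "'d hterm \<Rightarrow> real ^ 'd \<Rightarrow> real" where
  "hterm (\<alpha>s, \<beta>, \<mu>) y = h_fun \<rho> \<theta> \<phi> q \<alpha>s \<beta> \<mu> x y"

text \<open>The denominator is written as a power of a reciprocal, so that the product rule applies
  without quotients.\<close>

lemma hterm_eq:
  "hterm (\<alpha>s, \<beta>, \<mu>) y = (- 1) ^ length \<alpha>s * (D \<mu> \<theta> (pt y) * (deriv ^^ \<beta>) \<rho> (xi \<phi> x y) *
     (\<Prod>\<alpha>\<leftarrow>\<alpha>s. D \<alpha> \<phi> (pt y)) * (1 / D (munit None) \<phi> (pt y)) ^ (length \<alpha>s + q))"
  by (simp add: h_fun_def Let_def pt_def power_one_over)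

text \<open>A factor of \<phi> may be differentiated |\<eta>| + q times in y0, which for q = 1 can
  reach the order |\<nu>| + 1 of Assumption 1. The order of \<rho> stays within |\<eta>| + q - 1, at
  most |\<nu>|.\<close>

lemma adm_bounds:
  assumes "adm q \<eta> (\<alpha>s, \<beta>, \<mu>)" "\<eta> \<le> \<nu>"
  shows "\<mu> \<le> \<kappa>" "\<And>\<alpha>. \<alpha> \<in> set \<alpha>s \<Longrightarrow> \<alpha> \<le> \<kappa>" "\<beta> \<le> mabs \<nu>"
proof -
  have a: "\<And>\<alpha>. \<alpha> \<in> set \<alpha>s \<Longrightarrow> \<alpha> None \<le> mabs \<eta> + q" "mabs \<mu> \<le> mabs \<eta>"
      "\<And>j. \<mu> (Some j) + (\<Sum>\<alpha>\<leftarrow>\<alpha>s. \<alpha> (Some j)) = \<eta> j" "\<beta> + 1 \<le> mabs \<eta> + q"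
    using assms(1) by (auto simp: h_admissible_def Let_def)
  have m: "mabs \<eta> \<le> mabs \<nu>" by (rule mabs_mono[OF assms(2)])
  have "\<mu> None \<le> mabs \<mu>" unfolding mabs_def by (rule member_le_sum) auto
  moreover have "\<mu> (Some j) \<le> \<nu> j" for j using a(3)[of j] le_funD[OF assms(2), of j] by linarith
  ultimately show "\<mu> \<le> \<kappa>" using a(2) m by (auto simp: mcons_le_iff)
  show "\<alpha> \<le> \<kappa>" if "\<alpha> \<in> set \<alpha>s" for \<alpha>
  proof -
    have "\<alpha> (Some j) \<le> \<nu> j" for j
      using a(3)[of j] le_funD[OF assms(2), of j] member_le_sum_list[of "\<alpha> (Some j)" "map (\<lambda>\<alpha>. \<alpha> (Some j)) \<alpha>s"] that
      by auto
    then show ?thesis using a(1)[OF that] m q by (auto simp: mcons_le_iff)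
  qed
  show "\<beta> \<le> mabs \<nu>" using a(4) m q by linarith
qed

lemma hterm_continuous:
  assumes "adm q \<eta> t" "\<eta> \<le> \<nu>"
  shows "continuous_on V (hterm t)"
proof -
  obtain \<alpha>s \<beta> \<mu> where t: "t = (\<alpha>s, \<beta>, \<mu>)" by (cases t)
  note b = adm_bounds[OF assms[unfolded t]]
  have c: "continuous_on V (\<lambda>y. D \<alpha> f (pt y))" if "f \<in> C_mixed \<kappa>" "\<alpha> \<le> \<kappa>" for f \<alpha>
    by (rule continuous_on_compose2[OF continuous_on_D[OF that] continuous_on_pt]) auto
  have "continuous_on V (\<lambda>y. \<Prod>\<alpha>\<leftarrow>\<alpha>s. D \<alpha> \<phi> (pt y))"
    using b(2) by (induction \<alpha>s) (auto intro!: continuous_on_mult c phi_C)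
  moreover have "continuous_on V (\<lambda>y. (deriv ^^ \<beta>) \<rho> (xi \<phi> x y))"
    by (rule continuous_on_compose2[OF rho_cont[OF b(3)] continuous_on_xi]) auto
  moreover have "munit None \<le> \<kappa>" by (auto simp: mcons_le_iff munit_def)
  then have "continuous_on V (\<lambda>y. 1 / D (munit None) \<phi> (pt y))"
    using phi0_pos by (intro continuous_on_divide continuous_on_const c phi_C) (auto simp: less_imp_neq[symmetric])
  ultimately show ?thesis
    unfolding t hterm_eq by (intro continuous_on_mult continuous_on_power continuous_on_const c theta_C b)
qed

text \<open>A derivative passing through \<xi> contributes - D_i \<phi> / D_0 \<phi>: the entry
  \<open>munit (Some i)\<close>, one more power of the reciprocal, and a sign absorbed by (-1)^r as
  r grows by one. Differentiating the reciprocal power gives the two groups of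
  \<open>length \<alpha>s + q\<close> equal terms.\<close>

lemma hterm_derivative:
  assumes adm: "adm q \<eta> t" and \<eta>: "madd i \<eta> \<le> \<nu>" and y: "y \<in> V"
  shows "((\<lambda>r. hterm t (y + r *\<^sub>R axis i 1)) has_real_derivative (\<Sum>s\<leftarrow>step i q t. hterm s y)) (at 0)"
proof -
  obtain \<alpha>s \<beta> \<mu> where t: "t = (\<alpha>s, \<beta>, \<mu>)" by (cases t)
  have a: "\<And>\<alpha>. \<alpha> \<in> set \<alpha>s \<Longrightarrow> \<alpha> None \<le> mabs \<eta> + q" "mabs \<mu> \<le> mabs \<eta>" "\<beta> + 1 \<le> mabs \<eta> + q"
      "\<And>j. \<mu> (Some j) + (\<Sum>\<alpha>\<leftarrow>\<alpha>s. \<alpha> (Some j)) = \<eta> j"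
    using adm by (auto simp: t h_admissible_def Let_def)
  have m: "Suc (mabs \<eta>) \<le> mabs \<nu>" using mabs_mono[OF \<eta>] by simp
  have le: "\<eta> j + (if j = i then 1 else 0) \<le> \<nu> j" for j
    using le_funD[OF \<eta>, of j] by (cases "j = i") auto
  have bound: "madd None \<alpha> \<le> \<kappa>" "madd (Some i) \<alpha> \<le> \<kappa>"
    if "\<alpha> None \<le> mabs \<eta> + q" "\<And>j. \<alpha> (Some j) \<le> \<eta> j" for \<alpha>
  proof -
    have "\<alpha> (Some j) + (if j = i then 1 else 0) \<le> \<nu> j" for j
      by (rule order_trans[OF add_right_mono[OF that(2)] le])
    note this[of i] and le' = this
    then show "madd None \<alpha> \<le> \<kappa>" "madd (Some i) \<alpha> \<le> \<kappa>"
      using that(1) m q le' by (auto simp: mcons_le_iff intro: order_trans[OF le_add1 le'])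
  qed
  have "\<mu> None \<le> mabs \<mu>" unfolding mabs_def by (rule member_le_sum) auto
  then have b1: "madd None \<mu> \<le> \<kappa>" "madd (Some i) \<mu> \<le> \<kappa>"
    using bound[of \<mu>] a(2) by (simp_all add: a(4)[symmetric])
  have b2: "madd None \<alpha> \<le> \<kappa> \<and> madd (Some i) \<alpha> \<le> \<kappa>" if "\<alpha> \<in> set \<alpha>s" for \<alpha>
  proof -
    have "\<alpha> (Some j) \<le> \<eta> j" for j
      using a(4)[of j] member_le_sum_list[of "\<alpha> (Some j)" "map (\<lambda>\<alpha>. \<alpha> (Some j)) \<alpha>s"] that by auto
    then show ?thesis using bound[of \<alpha>, OF a(1)[OF that]] by blast
  qed
  have b3: "madd None (munit None) \<le> \<kappa>" "madd (Some i) (munit None) \<le> \<kappa>"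
    using bound[of "munit None"] a(3) by simp_all
  have b4: "\<beta> < mabs \<nu>" using a(3) m q by linarith
  have b5: "\<nu> i \<noteq> 0" using le[of i] by simp
  \<comment> \<open>With names for all values at \<open>y\<close>, the comparison with the sum over
    \<open>step\<close> becomes a polynomial identity between reals.\<close>
  define n where "n = length \<alpha>s + q"
  define A A1 A0 where "A = D \<mu> \<theta> (pt y)" and "A1 = D (madd (Some i) \<mu>) \<theta> (pt y)"
    and "A0 = D (madd None \<mu>) \<theta> (pt y)"
  define R R1 where "R = (deriv ^^ \<beta>) \<rho> (xi \<phi> x y)" and "R1 = (deriv ^^ Suc \<beta>) \<rho> (xi \<phi> x y)"
  define Pr where "Pr \<alpha>s = (\<Prod>\<alpha>\<leftarrow>\<alpha>s. D \<alpha> \<phi> (pt y))" for \<alpha>s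
  define S1 S0 where "S1 = (\<Sum>\<beta>s\<leftarrow>substs (madd (Some i)) \<alpha>s. Pr \<beta>s)"
    and "S0 = (\<Sum>\<beta>s\<leftarrow>substs (madd None) \<alpha>s. Pr \<beta>s)"
  define u where "u = 1 / D (munit None) \<phi> (pt y)"
  define qi p1 p0 where "qi = D (munit (Some i)) \<phi> (pt y)" and "p1 = D (madd (Some i) (munit None)) \<phi> (pt y)"
    and "p0 = D (madd None (munit None)) \<phi> (pt y)"
  define sg :: real where "sg = (- 1) ^ length \<alpha>s"
  have dxi: "dxi i y = - qi * u" by (simp add: qi_def u_def)
  let ?l = "\<lambda>r. y + r *\<^sub>R axis i 1"
  have dA: "((\<lambda>r. D \<mu> \<theta> (pt (?l r))) has_real_derivative A1 + A0 * (- qi * u)) (at 0)"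
    using D_line_derivative[OF theta_C b1 y] unfolding dxi A1_def A0_def .
  have dR: "((\<lambda>r. (deriv ^^ \<beta>) \<rho> (xi \<phi> x (?l r))) has_real_derivative R1 * (- qi * u)) (at 0)"
  proof -
    have "((deriv ^^ \<beta>) \<rho> has_real_derivative R1) (at (xi \<phi> x (?l 0)))"
      using rho_derivative[OF b4] by (simp add: R1_def)
    from DERIV_chain2[OF this xi_line_derivative[OF y b5]] show ?thesis unfolding dxi .
  qed
  have dP: "((\<lambda>r. \<Prod>\<alpha>\<leftarrow>\<alpha>s. D \<alpha> \<phi> (pt (?l r))) has_real_derivative S1 + (- qi * u) * S0) (at 0)"
    unfolding S1_def S0_def Pr_def
  proof (rule prod_list_derivative)
    fix \<alpha> assume "\<alpha> \<in> set \<alpha>s"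
    from D_line_derivative[OF phi_C conjunct1[OF b2[OF this]] conjunct2[OF b2[OF this]] y]
    show "((\<lambda>r. D \<alpha> \<phi> (pt (?l r))) has_real_derivative
        D (madd (Some i) \<alpha>) \<phi> (pt y) + D (madd None \<alpha>) \<phi> (pt y) * (- qi * u)) (at 0)"
      unfolding dxi .
  qed simp
  have "((\<lambda>r. D (munit None) \<phi> (pt (?l r))) has_real_derivative p1 + p0 * (- qi * u)) (at 0)"
    using D_line_derivative[OF phi_C b3 y] unfolding dxi p1_def p0_def .
  from DERIV_divide[OF DERIV_const[of 1] this] phi0_pos[of "pt y"]
  have du: "((\<lambda>r. 1 / D (munit None) \<phi> (pt (?l r))) has_real_derivative - (p1 + p0 * (- qi * u)) * u ^ 2) (at 0)"
    by (simp add: u_def power2_eq_square)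
  have dun: "((\<lambda>r. (1 / D (munit None) \<phi> (pt (?l r))) ^ n) has_real_derivative
      - real n * (p1 + p0 * (- qi * u)) * u ^ (n + 1)) (at 0)"
  proof -
    \<comment> \<open>For \<open>n = 0\<close> both sides vanish, so the truncated exponent
      \<open>n - Suc 0\<close> does no harm.\<close>
    have "real n * (- w * u ^ 2 * u ^ (n - Suc 0)) = - real n * w * u ^ (n + 1)" for w
      by (cases n) (simp_all add: power2_eq_square algebra_simps)
    then show ?thesis using DERIV_power[OF du, of n] by (simp only: u_def scaleR_zero_left add_0_right)
  qed
  have deriv: "((\<lambda>r. hterm t (?l r)) has_real_derivative
      sg * (((A1 + A0 * (- qi * u)) * R + R1 * (- qi * u) * A) * Pr \<alpha>s * u ^ n
        + (S1 + (- qi * u) * S0) * (A * R) * u ^ n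
        + - real n * (p1 + p0 * (- qi * u)) * u ^ (n + 1) * (A * R * Pr \<alpha>s))) (at 0)"
    using DERIV_cmult[OF DERIV_mult[OF DERIV_mult[OF DERIV_mult[OF dA dR] dP] dun], of sg]
    unfolding t hterm_eq n_def[symmetric] sg_def[symmetric]
    by (simp add: A_def R_def Pr_def u_def algebra_simps)
  have s1: "hterm (\<alpha>s, \<beta>, madd (Some i) \<mu>) y = sg * (A1 * R * Pr \<alpha>s * u ^ n)"
    and s2: "hterm (munit (Some i) # \<alpha>s, \<beta>, madd None \<mu>) y = - sg * (A0 * R * (qi * Pr \<alpha>s) * u ^ (n + 1))"
    and s3: "hterm (munit (Some i) # \<alpha>s, Suc \<beta>, \<mu>) y = - sg * (A * R1 * (qi * Pr \<alpha>s) * u ^ (n + 1))"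
    and s6: "hterm (madd (Some i) (munit None) # \<alpha>s, \<beta>, \<mu>) y = - sg * (A * R * (p1 * Pr \<alpha>s) * u ^ (n + 1))"
    and s7: "hterm (madd None (munit None) # munit (Some i) # \<alpha>s, \<beta>, \<mu>) y
        = sg * (A * R * (p0 * (qi * Pr \<alpha>s)) * u ^ (n + 2))"
    unfolding hterm_eq
    by (simp_all add: sg_def A_def A1_def A0_def R_def R1_def Pr_def u_def n_def qi_def p0_def p1_def)
  have s4: "(\<Sum>\<beta>s\<leftarrow>substs (madd (Some i)) \<alpha>s. hterm (\<beta>s, \<beta>, \<mu>) y) = sg * (A * R * u ^ n) * S1"
  proof -
    have "(\<Sum>\<beta>s\<leftarrow>substs (madd (Some i)) \<alpha>s. hterm (\<beta>s, \<beta>, \<mu>) y)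
        = (\<Sum>\<beta>s\<leftarrow>substs (madd (Some i)) \<alpha>s. sg * (A * R * u ^ n) * Pr \<beta>s)"
      by (intro arg_cong[of _ _ sum_list] map_cong refl, unfold hterm_eq)
        (simp add: length_in_substs sg_def A_def R_def Pr_def u_def n_def)
    then show ?thesis by (simp add: sum_list_const_mult S1_def)
  qed
  have s5: "(\<Sum>\<beta>s\<leftarrow>substs (madd None) \<alpha>s. hterm (munit (Some i) # \<beta>s, \<beta>, \<mu>) y)
      = - sg * (A * R * qi * u ^ (n + 1)) * S0"
  proof -
    have "(\<Sum>\<beta>s\<leftarrow>substs (madd None) \<alpha>s. hterm (munit (Some i) # \<beta>s, \<beta>, \<mu>) y)
        = (\<Sum>\<beta>s\<leftarrow>substs (madd None) \<alpha>s. - sg * (A * R * qi * u ^ (n + 1)) * Pr \<beta>s)"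
      by (intro arg_cong[of _ _ sum_list] map_cong refl, unfold hterm_eq)
        (simp add: length_in_substs sg_def A_def R_def Pr_def u_def n_def qi_def)
    then show ?thesis by (simp only: sum_list_const_mult S0_def)
  qed
  have "(\<Sum>s\<leftarrow>step i q t. hterm s y) =
      sg * (A1 * R * Pr \<alpha>s * u ^ n) + - sg * (A0 * R * (qi * Pr \<alpha>s) * u ^ (n + 1))
      + - sg * (A * R1 * (qi * Pr \<alpha>s) * u ^ (n + 1)) + sg * (A * R * u ^ n) * S1
      + - sg * (A * R * qi * u ^ (n + 1)) * S0 + real n * (- sg * (A * R * (p1 * Pr \<alpha>s) * u ^ (n + 1)))
      + real n * (sg * (A * R * (p0 * (qi * Pr \<alpha>s)) * u ^ (n + 2)))"
    unfolding t step.simps map_append sum_list_append map_map comp_def map_replicate sum_list_replicate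
      s4 s5 s6 s7 list.map sum_list.Cons sum_list.Nil s1 s2 s3 n_def[symmetric]
    by simp
  also have "\<dots> = sg * (((A1 + A0 * (- qi * u)) * R + R1 * (- qi * u) * A) * Pr \<alpha>s * u ^ n
        + (S1 + (- qi * u) * S0) * (A * R) * u ^ n
        + - real n * (p1 + p0 * (- qi * u)) * u ^ (n + 1) * (A * R * Pr \<alpha>s))"
    by (simp add: algebra_simps)
  finally show ?thesis using deriv by simp
qed

lemma lower_integral_D:
  assumes "q = 0" "\<eta> \<le> \<nu>"
  shows "lower_integral \<rho> (D (mcons 0 \<eta>) \<theta>)"
proof
  show "continuous_on UNIV \<rho>" using rho_cont[of 0] by simp
  show "continuous_on UNIV (D (mcons 0 \<eta>) \<theta>)"
    by (rule continuous_on_D[OF theta_C], unfold mcons_le_iff) (use assms(2) in \<open>simp add: le_fun_def\<close>)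
  show "uniform_lower_tail \<rho> (D (mcons 0 \<eta>) \<theta>)"
    using tails[OF assms(1)] assms(2) by (simp add: uniform_lower_tails_def uniform_lower_tail_def)
qed (rule rho_nonneg)

abbreviation "hsum is \<equiv> \<lambda>y. \<Sum>t\<leftarrow>deriv_terms q is. hterm t y"

text \<open>The part of the derivative in which only the integrand is differentiated; the value 0
  for \<open>q = 1\<close> lets both preintegrals share one argument.\<close>

definition bulk :: "'d list \<Rightarrow> real ^ 'd \<Rightarrow> real" where
  "bulk is y = (if q = 0 then lowint \<rho> (D (mcons 0 (count_list is)) \<theta>) (xi \<phi> x y) y else 0)"

lemma bulk_cases:
  "q = 0 \<Longrightarrow> bulk is = (\<lambda>y. lowint \<rho> (D (mcons 0 (count_list is)) \<theta>) (xi \<phi> x y) y)"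
  "q \<noteq> 0 \<Longrightarrow> bulk is = (\<lambda>_. 0)"
  unfolding bulk_def[abs_def] by simp_all

text \<open>\<open>W []\<close> is the preintegrated function, for \<open>q = 0\<close> that of the indicator and for \<open>q = 1\<close> that of
  the delta function; \<open>W is\<close> is its derivative along \<open>is\<close>.\<close>

definition W :: "'d list \<Rightarrow> real ^ 'd \<Rightarrow> real" where
  "W is y = (if y \<in> V then bulk is y + hsum is y else 0)"

text \<open>The upper limit \<xi> tends to -infinity while \<open>y\<close> itself moves towards
  \<open>p\<close>, so the smallness of the lower integrals is used uniformly on a ball around
  \<open>p\<close>.\<close>

lemma bulk_boundary:
  assumes "count_list is \<le> \<nu>" "p \<in> frontier V"
  shows "(bulk is \<longlongrightarrow> 0) (at p within V)"
proof (cases "q = 0")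
  case True
  interpret K: lower_integral \<rho> "D (mcons 0 (count_list is)) \<theta>"
    by (rule lower_integral_D[OF True assms(1)])
  have p: "p \<notin> V" using assms(2) open_U by (simp add: frontier_def interior_open)
  show ?thesis
  proof (rule tendstoI)
    fix e :: real assume "e > 0"
    from eventually_happens'[OF trivial_limit_at_bot_linorder K.eventually_lowint_small[OF compact_cball this, of p 1]]
    obtain R where R: "\<And>s y. s \<le> R \<Longrightarrow> y \<in> cball p 1 \<Longrightarrow> \<bar>lowint \<rho> (D (mcons 0 (count_list is)) \<theta>) s y\<bar> < e"
      by blast
    have 1: "\<forall>\<^sub>F y in nhds p. y \<in> ball p 1" by (rule eventually_nhds_in_open) auto
    have "\<forall>\<^sub>F y in nhds p. y \<in> V \<longrightarrow> dist (bulk is y) 0 < e"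
      using eventually_xi_less[OF p, of R] 1
      by eventually_elim (auto simp: bulk_cases(1)[OF True] intro!: R)
    then show "\<forall>\<^sub>F y in at p within V. dist (bulk is y) 0 < e"
      by (auto simp: eventually_at_filter elim: eventually_mono)
  qed
qed (simp add: bulk_cases(2))

lemma bulk_continuous:
  assumes "count_list is \<le> \<nu>"
  shows "continuous_on V (bulk is)"
proof (cases "q = 0")
  case True
  interpret K: lower_integral \<rho> "D (mcons 0 (count_list is)) \<theta>"
    by (rule lower_integral_D[OF True assms(1)])
  show ?thesis
    unfolding bulk_cases(1)[OF True]
    by (intro K.continuous_on_lowint continuous_on_xi continuous_on_id)
qed (simp add: bulk_cases(2))

lemma W_continuous:
  assumes "count_list is \<le> \<nu>"
  shows "continuous_on UNIV (W is)"
proof (rule continuous_on_extend_zero[OF open_U[of x]])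
  note adm = adm_deriv_terms[OF q]
  have "continuous_on V (\<lambda>y. bulk is y + hsum is y)"
    using hterm_continuous[OF adm assms] bulk_continuous[OF assms]
    unfolding continuous_on_def by (auto intro!: tendsto_add tendsto_sum_list)
  then show "continuous_on V (W is)"
    by (rule continuous_on_eq) (simp add: W_def)
  fix p assume p: "p \<in> frontier V"
  have "((\<lambda>y. bulk is y + hsum is y) \<longlongrightarrow> 0 + (\<Sum>t\<leftarrow>deriv_terms q is. 0)) (at p within V)"
  proof (intro tendsto_add tendsto_sum_list bulk_boundary[OF assms p])
    fix t assume t: "t \<in> set (deriv_terms q is)"
    obtain \<alpha>s \<beta> \<mu> where t': "t = (\<alpha>s, \<beta>, \<mu>)" by (cases t)
    have "hterm t = h_fun \<rho> \<theta> \<phi> q \<alpha>s \<beta> \<mu> x" by (simp add: t' fun_eq_iff)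
    then show "(hterm t \<longlongrightarrow> 0) (at p within V)"
      using boundary[OF assms _ p, of \<alpha>s \<beta> \<mu>] adm[OF t] by (simp add: t')
  qed
  then have "((\<lambda>y. bulk is y + hsum is y) \<longlongrightarrow> 0) (at p within V)"
    by (simp add: sum_list_triv)
  then show "(W is \<longlongrightarrow> 0) (at p within V)"
    by (rule Lim_transform_eventually) (auto simp: eventually_at_filter W_def)
qed (simp add: W_def)

text \<open>The dependence on \<open>y\<close> inside the integral gives the integral of the next
  derivative. The moving upper limit gives the integrand at \<xi> times the derivative of \<xi>,
  which is an \<open>hterm\<close> with one factor whose sign is (-1)^1.\<close>

lemma bulk_derivative:
  assumes \<eta>: "count_list (i # is) \<le> \<nu>" and y: "y \<in> V" and q0: "q = 0"
  shows "((\<lambda>r. bulk is (y + r *\<^sub>R axis i 1)) has_real_derivative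
    bulk (i # is) y + hterm ([munit (Some i)], 0, mcons 0 (count_list is)) y) (at 0)"
proof -
  let ?k = "D (mcons 0 (count_list is)) \<theta>"
  note le = count_list_tail_le[OF \<eta>]
  have "madd (Some i) (mcons 0 (count_list is)) \<le> \<kappa>"
    using le_funD[OF \<eta>] unfolding count_list_Cons by (simp add: mcons_le_iff)
  note k = partial_D[OF theta_C this]
  have keq: "partial (Some i) ?k = D (mcons 0 (count_list (i # is))) \<theta>"
    unfolding count_list_Cons k(2) by simp
  interpret K: lower_integral \<rho> ?k by (rule lower_integral_D[OF q0 le])
  have L: "lower_integral \<rho> (partial (Some i) ?k)"
    unfolding keq by (rule lower_integral_D[OF q0 \<eta>])
  have "\<nu> i \<noteq> 0" using le_funD[OF \<eta>, of i] by auto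
  note xi' = xi_line_derivative[OF y this]
  have "((\<lambda>r. K.lowint_joint (vcons (xi \<phi> x (y + 0 *\<^sub>R axis i 1)) (y + r *\<^sub>R axis i 1))) has_real_derivative
      lowint \<rho> (partial (Some i) ?k) (xi \<phi> x y) y) (at 0)"
    using lowint_derivative_axis[OF K.lower_integral_axioms L k(1)] by simp
  from vcons_chain[OF K.lowint_joint_partial(1) K.lowint_joint_partial_cont this xi']
  have "((\<lambda>r. lowint \<rho> ?k (xi \<phi> x (y + r *\<^sub>R axis i 1)) (y + r *\<^sub>R axis i 1)) has_real_derivative
      lowint \<rho> (D (mcons 0 (count_list (i # is))) \<theta>) (xi \<phi> x y) y + ?k (pt y) * \<rho> (xi \<phi> x y) * dxi i y) (at 0)"
    unfolding keq by (simp add: K.lowint_joint_partial(2) pt_def)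
  then show ?thesis
    unfolding bulk_def hterm_eq if_P[OF q0] by (simp add: q0)
qed

text \<open>On \<open>V\<close> this is termwise differentiation. Across the frontier it is
  \<open>partial_extend_zero\<close>, which requires continuity of the next candidate
  \<open>W (i # is)\<close> as well, and so the boundary condition for its terms.\<close>

lemma W_partial:
  assumes \<eta>: "count_list (i # is) \<le> \<nu>"
  shows "partial_differentiable i (W is)" "partial i (W is) = W (i # is)"
proof -
  note le = count_list_tail_le[OF \<eta>]
  have der: "((\<lambda>r. W is (y + r *\<^sub>R axis i 1)) has_real_derivative W (i # is) y) (at 0)" if y: "y \<in> V" for y
  proof -
    let ?l = "\<lambda>r. y + r *\<^sub>R axis i 1"
    have d1: "((\<lambda>r. hsum is (?l r)) has_real_derivative
        (\<Sum>t\<leftarrow>deriv_terms q is. \<Sum>s\<leftarrow>step i q t. hterm s y)) (at 0)"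
      by (intro DERIV_sum_list hterm_derivative[OF adm_deriv_terms[OF q] _ y])
        (use \<eta> in \<open>simp_all only: count_list_Cons\<close>)
    have concat_eq: "(\<Sum>s\<leftarrow>concat (map (step i q) ts). hterm s y) = (\<Sum>t\<leftarrow>ts. \<Sum>s\<leftarrow>step i q t. hterm s y)" for ts
      by (induction ts) auto
    have d2: "((\<lambda>r. bulk is (?l r)) has_real_derivative (if q = 0 then
        bulk (i # is) y + hterm ([munit (Some i)], 0, mcons 0 (count_list is)) y else 0)) (at 0)"
    proof (cases "q = 0")
      case True
      from bulk_derivative[OF \<eta> y True] show ?thesis by (simp only: if_P[OF True])
    next
      case False
      then have "bulk js = (\<lambda>_. 0)" for js by (rule bulk_cases(2))
      then show ?thesis by (simp only: if_not_P[OF False] DERIV_const)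
    qed
    from DERIV_add[OF d2 d1] have "((\<lambda>r. bulk is (?l r) + hsum is (?l r)) has_real_derivative
        (if q = 0 then bulk (i # is) y + hterm ([munit (Some i)], 0, mcons 0 (count_list is)) y else 0)
        + (\<Sum>s\<leftarrow>concat (map (step i q) (deriv_terms q is)). hterm s y)) (at 0)"
      unfolding concat_eq .
    also have "(if q = 0 then bulk (i # is) y + hterm ([munit (Some i)], 0, mcons 0 (count_list is)) y else 0)
        + (\<Sum>s\<leftarrow>concat (map (step i q) (deriv_terms q is)). hterm s y)
        = bulk (i # is) y + hsum (i # is) y"
    proof (cases "q = 0")
      case True
      show ?thesis
        unfolding deriv_terms.simps if_P[OF True] map_append sum_list_append list.map sum_list.Cons sum_list.Nil
        by simp
    next
      case False
      then have "bulk js y = 0" for js by (simp add: bulk_def)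
      then show ?thesis unfolding deriv_terms.simps if_not_P[OF False] by simp
    qed
    finally have "((\<lambda>r. bulk is (?l r) + hsum is (?l r)) has_real_derivative
        bulk (i # is) y + hsum (i # is) y) (at 0)" .
    then have "((\<lambda>r. bulk is (?l r) + hsum is (?l r)) has_real_derivative W (i # is) y) (at 0)"
      using y by (simp only: W_def if_True)
    moreover have "open (?l -` V)"
      by (rule continuous_open_vimage[OF open_U]) (auto intro!: continuous_intros)
    ultimately show ?thesis
      by (elim has_field_derivative_transform_within_open) (use y in \<open>auto simp: W_def\<close>)
  qed
  show "partial_differentiable i (W is)" "partial i (W is) = W (i # is)"
    by (rule partial_extend_zero[OF open_U[of x] W_continuous[OF le] W_continuous[OF \<eta>] _ _ der]; simp add: W_def)+
qed

lemma foldr_partial_W: "count_list is \<le> \<nu> \<Longrightarrow> foldr partial is (W []) = W is"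
proof (induction "is")
  case (Cons i "is")
  from Cons.IH[OF count_list_tail_le[OF Cons.prems]] W_partial(2)[OF Cons.prems] show ?case by simp
qed simp

lemma W_C_mixed: "W [] \<in> C_mixed \<nu>"
  unfolding C_mixed_def
proof (intro CollectI allI impI conjI)
  fix "is" assume "\<forall>i. count_list is i \<le> \<nu> i"
  then have le: "count_list is \<le> \<nu>" by (simp add: le_fun_def)
  show "continuous_on UNIV (foldr partial is (W []))"
    by (simp add: foldr_partial_W[OF le] W_continuous[OF le])
  fix i assume "count_list is i < \<nu> i"
  then have "count_list (i # is) \<le> \<nu>"
    unfolding count_list_Cons using le by (auto simp: le_fun_def)
  then show "partial_differentiable i (foldr partial is (W []))"
    unfolding foldr_partial_W[OF le] by (rule W_partial(1))
qed

lemma D_W: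
  assumes "\<eta> \<le> \<nu>"
  obtains "is" where "count_list is = \<eta>" "D \<eta> (W []) = W is"
proof -
  obtain "is" where "\<And>i. count_list is i = \<eta> i" using ex_list_with_counts by blast
  then have "is": "count_list is = \<eta>" by blast
  have "D \<eta> (W []) = foldr partial is (W [])"
    by (rule D_eq_foldr[OF C_mixed_mono[OF W_C_mixed assms]]) (simp add: "is")
  then show ?thesis using that[OF "is"] foldr_partial_W assms "is" by auto
qed

end

section \<open>Integrals and Sobolev norms\<close>

lemma prod_Basis_cart:
  "(\<Prod>b\<in>(Basis :: (real ^ 'n::finite) set). f b) = (\<Prod>i\<in>UNIV. f (axis i 1))"
proof -
  have "(Basis :: (real ^ 'n) set) = range (\<lambda>i. axis i 1)" by (auto simp: Basis_vec_def)
  then have "prod f Basis = prod f (range (\<lambda>i. axis i 1))" by (rule arg_cong)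
  also have "\<dots> = (\<Prod>i\<in>UNIV. f (axis i 1))"
    by (subst prod.reindex) (auto simp: inj_on_def axis_eq_axis)
  finally show ?thesis .
qed

lemma measurable_vcons [measurable]:
  "case_prod vcons \<in> borel_measurable (borel \<Otimes>\<^sub>M borel :: (real \<times> (real ^ 'd::finite)) measure)"
proof -
  have "continuous_on UNIV (\<lambda>p :: real \<times> (real ^ 'd). vcons (fst p) (snd p))"
    by (intro continuous_intros)
  from borel_measurable_continuous_onI[OF this] show ?thesis by (simp add: split_beta borel_prod)
qed

text \<open>Both measures agree on boxes, since a box pulls back to an interval times a box. This
  makes Tonelli available for splitting off y0.\<close>

lemma lborel_vcons:
  "(lborel :: (real ^ ('d::finite option)) measure) = distr (lborel \<Otimes>\<^sub>M lborel) borel (case_prod vcons)"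
proof (rule lborel_eqI)
  fix l u :: "real ^ ('d option)"
  assume le: "\<And>b. b \<in> Basis \<Longrightarrow> l \<bullet> b \<le> u \<bullet> b"
  have le': "l $ i \<le> u $ i" for i using le[of "axis i 1"] by (simp add: inner_axis)
  let ?l = "\<chi> j. l $ Some j" and ?u = "\<chi> j. u $ Some j"
  let ?M = "distr (lborel \<Otimes>\<^sub>M lborel) borel (case_prod vcons) :: (real ^ ('d option)) measure"
  have pre: "(case_prod vcons) -` box l u \<inter> space (lborel \<Otimes>\<^sub>M lborel) = {l $ None <..< u $ None} \<times> box ?l ?u"
    by (auto simp: mem_box_cart space_pair_measure split_option_all)
  have "emeasure ?M (box l u)
      = emeasure (lborel \<Otimes>\<^sub>M lborel) ({l $ None <..< u $ None} \<times> box ?l ?u)"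
    by (subst emeasure_distr) (auto simp: pre)
  also have "\<dots> = emeasure lborel {l $ None <..< u $ None} * emeasure lborel (box ?l ?u)"
    by (rule lborel.emeasure_pair_measure_Times) auto
  also have "\<dots> = ennreal (u $ None - l $ None) * ennreal (\<Prod>b\<in>Basis. (?u - ?l) \<bullet> b)"
    by (intro arg_cong2[where f="(*)"] emeasure_lborel_box) (auto simp: Basis_vec_def inner_axis le')
  also have "\<dots> = ennreal ((u $ None - l $ None) * (\<Prod>j\<in>UNIV. u $ Some j - l $ Some j))"
    using le' by (simp add: prod_Basis_cart inner_axis ennreal_mult prod_nonneg)
  also have "(u $ None - l $ None) * (\<Prod>j\<in>UNIV. u $ Some j - l $ Some j) = (\<Prod>b\<in>Basis. (u - l) \<bullet> b)"
    by (simp add: prod_Basis_cart inner_axis UNIV_option_conv prod.reindex)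
  finally show "emeasure ?M (box l u) = (\<Prod>b\<in>Basis. (u - l) \<bullet> b)" .
qed simp

lemma nn_integral_vcons:
  fixes f :: "real ^ ('d::finite option) \<Rightarrow> ennreal"
  assumes [measurable]: "f \<in> borel_measurable borel"
  shows "(\<integral>\<^sup>+ z. f z \<partial>lborel) = (\<integral>\<^sup>+ y. \<integral>\<^sup>+ s. f (vcons s y) \<partial>lborel \<partial>lborel)"
proof -
  have m: "case_prod vcons \<in> borel_measurable (lborel \<Otimes>\<^sub>M (lborel :: (real ^ 'd) measure))"
    using measurable_vcons by (simp cong: measurable_cong_sets sets_pair_measure_cong)
  have "(\<integral>\<^sup>+ z. f z \<partial>lborel) = (\<integral>\<^sup>+ p. f ((case_prod vcons) p) \<partial>(lborel \<Otimes>\<^sub>M lborel))"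
    by (subst lborel_vcons, subst nn_integral_distr[OF m]) simp_all
  also have "\<dots> = (\<integral>\<^sup>+ y. \<integral>\<^sup>+ s. f ((case_prod vcons) (s, y)) \<partial>lborel \<partial>lborel)"
    by (rule lborel_pair.nn_integral_snd[symmetric]) (rule measurable_compose[OF m], simp)
  finally show ?thesis by simp
qed

lemma nn_integral_prod_cart:
  fixes f :: "'n::finite \<Rightarrow> real \<Rightarrow> ennreal"
  assumes [measurable]: "\<And>i. f i \<in> borel_measurable borel"
  shows "(\<integral>\<^sup>+ y. (\<Prod>i\<in>UNIV. f i (y $ i)) \<partial>(lborel :: (real ^ 'n) measure)) = (\<Prod>i\<in>UNIV. \<integral>\<^sup>+ t. f i t \<partial>lborel)"
proof -
  interpret product_sigma_finite "\<lambda>_ :: real ^ 'n. lborel :: real measure" ..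
  \<comment> \<open>Lebesgue measure is given as a product over basis vectors, so the factors are
    reindexed from coordinates to these.\<close>
  define g where "g b = f (THE i. b = axis i 1)" for b :: "real ^ 'n"
  have g: "g (axis i 1) = f i" for i by (simp add: g_def axis_eq_axis)
  have [measurable]: "g b \<in> borel_measurable borel" for b by (simp add: g_def)
  have "(\<integral>\<^sup>+ y. (\<Prod>i\<in>UNIV. f i (y $ i)) \<partial>(lborel :: (real ^ 'n) measure))
      = (\<integral>\<^sup>+ y. (\<Prod>b\<in>Basis. g b (y \<bullet> b)) \<partial>(lborel :: (real ^ 'n) measure))"
    by (simp add: prod_Basis_cart g inner_axis)
  also have "\<dots> = (\<integral>\<^sup>+ x. (\<Prod>b\<in>Basis. g b (x b)) \<partial>(\<Pi>\<^sub>M b\<in>(Basis :: (real ^ 'n) set). lborel))"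
    by (subst lborel_eq, subst nn_integral_distr) (auto intro!: nn_integral_cong prod.cong)
  also have "\<dots> = (\<Prod>b\<in>Basis. \<integral>\<^sup>+ t. g b t \<partial>lborel)"
    by (rule product_nn_integral_prod) auto
  finally show ?thesis by (simp add: prod_Basis_cart g)
qed

lemma mixed_weight_measurable:
  assumes "\<And>i. \<psi> i \<in> borel_measurable borel" "\<rho> \<in> borel_measurable borel"
  shows "mixed_weight \<psi> \<rho> \<eta> \<in> borel_measurable borel"
  unfolding mixed_weight_def[abs_def] using assms by (auto intro!: borel_measurable_times borel_measurable_prod measurable_compose[of "\<lambda>y. y $ _"])

lemma mixed_weight_nonneg:
  assumes "\<And>i t. 0 \<le> \<psi> i t" "\<And>t. 0 \<le> \<rho> t"
  shows "0 \<le> mixed_weight \<psi> \<rho> \<eta> y"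
  unfolding mixed_weight_def using assms by (auto intro!: mult_nonneg_nonneg prod_nonneg)

text \<open>A multi-index of order 0 in y0 puts the density \<rho> on that coordinate, so the
  weighted norm of \<theta> contains exactly the inner integral that bounds a squared lower
  integral.\<close>

lemma mixed_weight_mcons:
  "mixed_weight \<psi> \<rho> (mcons 0 \<eta>) (vcons s y) = mixed_weight (\<lambda>i. \<psi> (Some i)) \<rho> \<eta> y * \<rho> s"
proof -
  have 1: "{i. mcons 0 \<eta> i \<noteq> 0} = Some ` {i. \<eta> i \<noteq> 0}"
  proof (rule set_eqI)
    fix i show "i \<in> {i. mcons 0 \<eta> i \<noteq> 0} \<longleftrightarrow> i \<in> Some ` {i. \<eta> i \<noteq> 0}" by (cases i) auto
  qed
  have 2: "{i. mcons 0 \<eta> i = 0} = insert None (Some ` {i. \<eta> i = 0})"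
  proof (rule set_eqI)
    fix i show "i \<in> {i. mcons 0 \<eta> i = 0} \<longleftrightarrow> i \<in> insert None (Some ` {i. \<eta> i = 0})" by (cases i) auto
  qed
  show ?thesis
    unfolding mixed_weight_def 1 2 by (simp add: prod.reindex)
qed

text \<open>The total mass of the product density is the origin of the summand 1 in the bound for
  constant \<theta>.\<close>

lemma nn_integral_mixed_weight_0:
  assumes "probability_density \<rho>"
  shows "(\<integral>\<^sup>+ y. ennreal (mixed_weight \<psi> \<rho> (\<lambda>_. 0) y) \<partial>(lborel :: (real ^ 'n::finite) measure)) = 1"
proof -
  have [measurable]: "\<rho> \<in> borel_measurable borel" and "\<And>t. 0 \<le> \<rho> t"
    and 1: "(\<integral>\<^sup>+ t. ennreal (\<rho> t) \<partial>lborel) = 1"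
    using assms by (auto simp: probability_density_def)
  then have "(\<integral>\<^sup>+ y. ennreal (mixed_weight \<psi> \<rho> (\<lambda>_. 0) y) \<partial>(lborel :: (real ^ 'n) measure))
      = (\<integral>\<^sup>+ y. (\<Prod>i\<in>UNIV. ennreal (\<rho> (y $ i))) \<partial>(lborel :: (real ^ 'n) measure))"
    by (simp add: mixed_weight_def prod_ennreal)
  also have "\<dots> = (\<Prod>i\<in>(UNIV :: 'n set). \<integral>\<^sup>+ t. ennreal (\<rho> t) \<partial>lborel)"
    by (rule nn_integral_prod_cart) simp
  finally show ?thesis by (simp add: 1)
qed

lemma sobolev_sqnorm_C_mixed:
  assumes "f \<in> C_mixed \<nu>"
  shows "sobolev_sqnorm \<gamma> \<psi> \<rho> \<nu> f = (\<Sum>\<eta>\<in>{\<eta>. \<eta> \<le> \<nu>}. ennreal (1 / \<gamma> {i. \<eta> i \<noteq> 0}) *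
        (\<integral>\<^sup>+ y. ennreal (\<bar>D \<eta> f y\<bar>\<^sup>2 * mixed_weight \<psi> \<rho> \<eta> y) \<partial>lborel))"
  unfolding sobolev_sqnorm_def
proof (intro sum.cong refl arg_cong2[where f="(*)"] nn_integral_cong_AE)
  fix \<eta> assume "\<eta> \<in> {\<eta>. \<eta> \<le> \<nu>}"
  then have "f \<in> C_mixed \<eta>" using C_mixed_mono[OF assms] by simp
  from weak_D_AE[OF this] show "AE y in lborel. ennreal (\<bar>weak_D \<eta> f y\<bar>\<^sup>2 * mixed_weight \<psi> \<rho> \<eta> y)
      = ennreal (\<bar>D \<eta> f y\<bar>\<^sup>2 * mixed_weight \<psi> \<rho> \<eta> y)"
    by eventually_elim simp
qed

lemma finite_multi_indices: "finite {\<eta> :: 'n::finite \<Rightarrow> nat. \<eta> \<le> \<nu>}"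
proof -
  have "{\<eta> :: 'n \<Rightarrow> nat. \<eta> \<le> \<nu>} = (\<Pi>\<^sub>E i\<in>UNIV. {..\<nu> i})"
    by (auto simp: le_fun_def PiE_def)
  then show ?thesis by (simp add: finite_PiE)
qed

lemma sobolev_C_mixedI:
  assumes f: "f \<in> C_mixed \<nu>"
    and le: "sobolev_sqnorm \<gamma> \<psi> \<rho> \<nu> f \<le> ennreal c" and c: "0 \<le> c"
  shows "f \<in> sobolev \<gamma> \<psi> \<rho> \<nu>" "sobolev_norm \<gamma> \<psi> \<rho> \<nu> f \<le> sqrt c"
proof -
  have "continuous_on UNIV f" using C_mixedD(1)[OF f, of "[]"] by simp
  moreover have "has_weak_deriv \<eta> f (D \<eta> f)" if "\<eta> \<le> \<nu>" for \<eta>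
    by (rule has_weak_deriv_D[OF C_mixed_mono[OF f that]])
  moreover have "sobolev_sqnorm \<gamma> \<psi> \<rho> \<nu> f < \<infinity>"
    using le by (simp add: order.strict_trans1)
  ultimately show "f \<in> sobolev \<gamma> \<psi> \<rho> \<nu>"
    unfolding sobolev_def using locally_integrable_continuous by blast
  show "sobolev_norm \<gamma> \<psi> \<rho> \<nu> f \<le> sqrt c"
    unfolding sobolev_norm_def using enn2real_mono[OF le] c by simp
qed

lemma sum_list_squared_le:
  fixes f :: "'a \<Rightarrow> real"
  shows "(\<Sum>t\<leftarrow>ts. f t)\<^sup>2 \<le> real (length ts) * (\<Sum>t\<leftarrow>ts. (f t)\<^sup>2)"
  using sum_squared_le_sum_of_squares[of "\<lambda>i. f (ts ! i)" "{0..<length ts}"]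
  by (simp add: sum_list_sum_nth mult.commute)

text \<open>The tail is the distribution function of \<rho>, which tends to 0 at -infinity and does
  not depend on \<open>y\<close>.\<close>

lemma uniform_lower_tail_const:
  assumes \<rho>: "probability_density \<rho>"
  shows "uniform_lower_tail \<rho> (\<lambda>_. 1 :: real)"
  unfolding uniform_lower_tail_def
proof (intro allI impI)
  fix K :: "(real ^ 'd) set"
  have [measurable]: "\<rho> \<in> borel_measurable borel" using \<rho> by (simp add: probability_density_def)
  let ?M = "density lborel (\<lambda>t. ennreal (\<rho> t))"
  interpret prob_space ?M
    by (rule prob_spaceI) (use \<rho> in \<open>simp add: emeasure_density probability_density_def\<close>)
  interpret finite_borel_measure ?M by unfold_locales simp
  have "((\<lambda>R. ennreal (cdf ?M R)) \<longlongrightarrow> ennreal 0) at_bot"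
    by (intro tendsto_ennrealI cdf_lim_at_bot)
  then have lim: "((\<lambda>R. ennreal (cdf ?M R)) \<longlongrightarrow> 0) at_bot" by simp
  have "\<forall>\<^sub>F R in at_bot. (SUP y\<in>K. \<integral>\<^sup>+ \<sigma>\<in>{..R}. ennreal (\<bar>1 :: real\<bar> * \<rho> \<sigma>) \<partial>lborel) \<le> ennreal (cdf ?M R)"
    by (intro always_eventually allI SUP_least)
      (simp add: cdf_def emeasure_eq_measure[symmetric] emeasure_density)
  from tendsto_sandwich[OF _ this tendsto_const lim]
  show "((\<lambda>R. SUP y\<in>K. \<integral>\<^sup>+ \<sigma>\<in>{..R}. ennreal (\<bar>1 :: real\<bar> * \<rho> \<sigma>) \<partial>lborel) \<longlongrightarrow> 0) at_bot"
    by simp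
qed

section \<open>Norm estimates\<close>

lemma partial_const [simp]: "partial i (\<lambda>_. c) = (\<lambda>_. 0)"
  by (rule ext, rule partial_eqI) simp

lemma D_const: "D \<mu> (\<lambda>_. c) = (if \<mu> = (\<lambda>_. 0) then (\<lambda>_. c) else (\<lambda>_. 0))"
proof (cases "\<mu> = (\<lambda>_. 0)")
  case False
  define ks where "ks = (SOME is. \<forall>i. count_list is i = \<mu> i)"
  have "\<forall>i. count_list ks i = \<mu> i"
    unfolding ks_def by (rule someI_ex[OF ex_list_with_counts])
  with False have "ks \<noteq> []" by (auto simp: fun_eq_iff)
  then obtain i js where "ks = i # js" by (cases ks) auto
  moreover have "foldr partial js (\<lambda>_. c) = (\<lambda>_. c) \<or> foldr partial js (\<lambda>_. c) = (\<lambda>_. 0)"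
    by (induction js) auto
  ultimately have "foldr partial ks (\<lambda>_. c) = (\<lambda>_. 0)" by auto
  then show ?thesis using False by (simp add: D_def ks_def)
qed simp

lemma uniform_lower_tails_const:
  assumes "probability_density \<rho>"
  shows "uniform_lower_tails \<rho> \<nu> (\<lambda>_. 1)"
  unfolding uniform_lower_tails_def
proof (intro allI impI)
  fix \<eta> and K :: "(real ^ 'a) set" assume "compact K"
  then have "((\<lambda>R. SUP y\<in>K. \<integral>\<^sup>+ y0\<in>{..R}. ennreal (\<bar>1 :: real\<bar> * \<rho> y0) \<partial>lborel) \<longlongrightarrow> 0) at_bot"
    using uniform_lower_tail_const[OF assms] unfolding uniform_lower_tail_def by blast
  moreover have "((\<lambda>R :: real. SUP y\<in>K. 0 :: ennreal) \<longlongrightarrow> 0) at_bot"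
    \<comment> \<open>The supremum over the empty set is the bottom element, which is 0 in
      \<open>ennreal\<close>.\<close>
    by (cases "K = {}") (auto simp: bot_ennreal)
  ultimately show "((\<lambda>R. SUP y\<in>K. \<integral>\<^sup>+ y0\<in>{..R}. ennreal (\<bar>D (mcons 0 \<eta>) (\<lambda>_. 1) (vcons y0 y)\<bar> * \<rho> y0) \<partial>lborel) \<longlongrightarrow> 0) at_bot"
    by (auto simp: D_const)
qed

text \<open>In this form the derivative of the distribution function is an instance of
  \<open>lowint_derivative\<close>; \<open>y\<close> is a dummy.\<close>

lemma distr_fun_eq_lowint:
  assumes "probability_density \<rho>"
  shows "distr_fun \<rho> t = lowint \<rho> (\<lambda>_. 1) t y"
proof -
  have [measurable]: "\<rho> \<in> borel_measurable borel" and nn: "\<And>t. 0 \<le> \<rho> t"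
    using assms by (auto simp: probability_density_def)
  have "lowint \<rho> (\<lambda>_. 1) t y = enn2real (\<integral>\<^sup>+ \<sigma>. ennreal (indicator {..t} \<sigma> *\<^sub>R (1 * \<rho> \<sigma>)) \<partial>lborel)"
    unfolding lowint_def set_lebesgue_integral_def by (rule integral_eq_nn_integral) (auto simp: nn)
  also have "(\<integral>\<^sup>+ \<sigma>. ennreal (indicator {..t} \<sigma> *\<^sub>R (1 * \<rho> \<sigma>)) \<partial>lborel) = (\<integral>\<^sup>+ \<sigma>\<in>{..t}. ennreal (\<rho> \<sigma>) \<partial>lborel)"
    by (intro nn_integral_cong) (auto simp: indicator_def)
  also have "\<dots> = emeasure (density lborel (\<lambda>t. ennreal (\<rho> t))) {..t}" by (simp add: emeasure_density)
  finally show ?thesis by (simp add: distr_fun_def cdf_def measure_def)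
qed

text \<open>Cauchy-Schwarz with \<rho> split into two square roots, the second of which contributes
  total mass 1. Integrating over the whole line on the right frees the bound from the upper limit,
  and so later from \<xi>.\<close>

lemma (in lower_integral) lowint_square_le:
  assumes "(\<integral>\<^sup>+ t. ennreal (\<rho> t) \<partial>lborel) = 1"
  shows "ennreal ((lowint \<rho> k s y)\<^sup>2) \<le> (\<integral>\<^sup>+ \<sigma>. ennreal ((k (vcons \<sigma> y))\<^sup>2 * \<rho> \<sigma>) \<partial>lborel)"
proof -
  have "continuous_on UNIV (\<lambda>\<sigma>. k (vcons \<sigma> y))"
    by (intro continuous_on_compose2[OF k_cont] continuous_intros) auto
  note [measurable] = borel_measurable_continuous_onI[OF this] borel_measurable_continuous_onI[OF rho_cont]
  have "ennreal ((lowint \<rho> k s y)\<^sup>2) = (ennreal \<bar>lowint \<rho> k s y\<bar>)\<^sup>2"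
    by (simp add: ennreal_power)
  also have "\<dots> \<le> (tail_mass s y)\<^sup>2"
    by (intro power_mono lowint_bound) simp
  also have "\<dots> \<le> (\<integral>\<^sup>+ \<sigma>. ennreal (\<bar>k (vcons \<sigma> y)\<bar> * sqrt (\<rho> \<sigma>)) * ennreal (sqrt (\<rho> \<sigma>)) \<partial>lborel)\<^sup>2"
  proof (intro power_mono nn_integral_mono)
    fix \<sigma>
    have "ennreal (\<bar>k (vcons \<sigma> y)\<bar> * sqrt (\<rho> \<sigma>)) * ennreal (sqrt (\<rho> \<sigma>)) = ennreal (norm (k (vcons \<sigma> y) * \<rho> \<sigma>))"
      using rho_nonneg[of \<sigma>] by (simp add: ennreal_mult[symmetric] abs_mult mult.assoc)
    then show "ennreal (norm (k (vcons \<sigma> y) * \<rho> \<sigma>)) * indicator {..s} \<sigma>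
        \<le> ennreal (\<bar>k (vcons \<sigma> y)\<bar> * sqrt (\<rho> \<sigma>)) * ennreal (sqrt (\<rho> \<sigma>))"
      by (auto simp: indicator_def)
  qed simp
  also have "\<dots> \<le> (\<integral>\<^sup>+ \<sigma>. (ennreal (\<bar>k (vcons \<sigma> y)\<bar> * sqrt (\<rho> \<sigma>)))\<^sup>2 \<partial>lborel) * (\<integral>\<^sup>+ \<sigma>. (ennreal (sqrt (\<rho> \<sigma>)))\<^sup>2 \<partial>lborel)"
    by (rule Cauchy_Schwarz_nn_integral) simp_all
  also have "(\<integral>\<^sup>+ \<sigma>. (ennreal (sqrt (\<rho> \<sigma>)))\<^sup>2 \<partial>lborel) = 1"
    using rho_nonneg by (simp add: ennreal_power assms)
  also have "(\<integral>\<^sup>+ \<sigma>. (ennreal (\<bar>k (vcons \<sigma> y)\<bar> * sqrt (\<rho> \<sigma>)))\<^sup>2 \<partial>lborel) = (\<integral>\<^sup>+ \<sigma>. ennreal ((k (vcons \<sigma> y))\<^sup>2 * \<rho> \<sigma>) \<partial>lborel)"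
    using rho_nonneg by (simp add: ennreal_power power_mult_distrib)
  finally show ?thesis by simp
qed

section \<open>Weighted square integrals of the derivatives\<close>

locale preintegration_bounds = preintegration +
  fixes \<psi> :: "'a option \<Rightarrow> real \<Rightarrow> real" and B :: "('a \<Rightarrow> nat) \<Rightarrow> real"
  assumes density: "probability_density \<rho>"
    and psi_measurable: "\<And>i. \<psi> i \<in> borel_measurable borel" and psi_nonneg: "\<And>i t. 0 \<le> \<psi> i t"
    and B_nonneg: "\<And>\<eta>. \<eta> \<le> \<nu> \<Longrightarrow> 0 \<le> B \<eta>"
    and B_bound: "\<And>\<eta> \<alpha>s \<beta> \<mu>. \<eta> \<le> \<nu> \<Longrightarrow> h_admissible q \<eta> \<alpha>s \<beta> \<mu> \<Longrightarrow>
      (\<integral>\<^sup>+ y\<in>U \<phi> x. ennreal (\<bar>h_fun \<rho> \<theta> \<phi> q \<alpha>s \<beta> \<mu> x y\<bar>\<^sup>2 * mixed_weight (drop0 \<psi>) \<rho> \<eta> y) \<partial>lborel) \<le> ennreal (B \<eta>)"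
begin

abbreviation "wt \<eta> \<equiv> mixed_weight (drop0 \<psi>) \<rho> \<eta>"

abbreviation "energy f \<eta> \<equiv> \<integral>\<^sup>+ y. ennreal (\<bar>f y\<bar>\<^sup>2 * wt \<eta> y) \<partial>lborel"
abbreviation "energy_on_V f \<eta> \<equiv> \<integral>\<^sup>+ y\<in>V. ennreal ((f y)\<^sup>2 * wt \<eta> y) \<partial>lborel"

lemma wt_measurable [measurable]: "wt \<eta> \<in> borel_measurable borel"
  by (rule mixed_weight_measurable) (use psi_measurable density in \<open>auto simp: probability_density_def\<close>)

lemma wt_nonneg [simp]: "0 \<le> wt \<eta> y"
  by (rule mixed_weight_nonneg) (use psi_nonneg rho_nonneg in auto)

text \<open>Continuity is known only on the open set \<open>V\<close>, so measurability is obtained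
  for the function cut off outside it.\<close>

lemma measurable_on_V:
  assumes "continuous_on V f"
  shows "(\<lambda>y. ennreal ((f y)\<^sup>2 * wt \<eta> y) * indicator V y) \<in> borel_measurable borel"
proof -
  have [measurable]: "(\<lambda>y. indicator V y *\<^sub>R f y) \<in> borel_measurable borel"
    by (rule borel_measurable_continuous_on_indicator[OF borel_open[OF open_U] assms])
  have "(\<lambda>y. ennreal ((indicator V y *\<^sub>R f y)\<^sup>2 * wt \<eta> y)) \<in> borel_measurable borel" by measurable
  also have "(\<lambda>y. ennreal ((indicator V y *\<^sub>R f y)\<^sup>2 * wt \<eta> y)) = (\<lambda>y. ennreal ((f y)\<^sup>2 * wt \<eta> y) * indicator V y)"
    by (auto simp: indicator_def fun_eq_iff)
  finally show ?thesis .
qed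

lemma hterm_bound:
  assumes "\<eta> \<le> \<nu>" "adm q \<eta> t"
  shows "energy_on_V (hterm t) \<eta> \<le> ennreal (B \<eta>)"
  using B_bound[OF assms(1)] assms(2) by (cases t) simp

text \<open>The square of a sum of n terms is at most n times the sum of the squares, and that sum
  contributes n times \<open>B\<close>. Hence the squared counts in the final bounds.\<close>

lemma hterm_sum_bound:
  assumes le: "count_list is \<le> \<nu>" and L: "real (length (deriv_terms q is)) \<le> L"
  defines "\<eta> \<equiv> count_list is"
  shows "energy_on_V (hsum is) \<eta> \<le> ennreal (L\<^sup>2 * B \<eta>)"
proof -
  have le': "\<eta> \<le> \<nu>" using le by (simp add: \<eta>_def)
  have adm: "adm q \<eta> t" if "t \<in> set (deriv_terms q is)" for t
    unfolding \<eta>_def by (rule adm_deriv_terms[OF q that])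
  let ?n = "real (length (deriv_terms q is))"
  define G where "G t y = ennreal ((hterm t y)\<^sup>2 * wt \<eta> y) * indicator V y" for t y
  let ?J = "\<lambda>ts. \<integral>\<^sup>+ y. (\<Sum>t\<leftarrow>ts. G t y) \<partial>lborel"
  \<comment> \<open>Measurability of the partial sums is carried through the induction because
    additivity of the integral asks for it.\<close>
  have sum: "(\<lambda>y. \<Sum>t\<leftarrow>ts. G t y) \<in> borel_measurable borel \<and>
      ?J ts \<le> ennreal (real (length ts) * B \<eta>)"
    if "\<And>t. t \<in> set ts \<Longrightarrow> adm q \<eta> t" for ts
    using that
  proof (induction ts)
    case (Cons t ts)
    then have IH: "(\<lambda>y. \<Sum>t\<leftarrow>ts. G t y) \<in> borel_measurable borel"
      "?J ts \<le> ennreal (real (length ts) * B \<eta>)" by auto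
    have a: "adm q \<eta> t" using Cons.prems by simp
    have m: "G t \<in> borel_measurable borel"
      unfolding G_def[abs_def] by (rule measurable_on_V[OF hterm_continuous[OF a le']])
    have "(\<integral>\<^sup>+ y. G t y + (\<Sum>t\<leftarrow>ts. G t y) \<partial>lborel) = (\<integral>\<^sup>+ y. G t y \<partial>lborel) + ?J ts"
      by (rule nn_integral_add) (use m IH in simp_all)
    also have "\<dots> \<le> ennreal (B \<eta>) + ennreal (real (length ts) * B \<eta>)"
      by (intro add_mono IH) (use hterm_bound[OF le' a] in \<open>simp add: G_def\<close>)
    also have "\<dots> = ennreal (real (length (t # ts)) * B \<eta>)"
      using B_nonneg[OF le'] by (simp add: ennreal_plus[symmetric] algebra_simps del: ennreal_plus)
    finally show ?case using m IH by simp
  qed simp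
  note S = sum[of "deriv_terms q is", OF adm]
  have "energy_on_V (hsum is) \<eta>
      \<le> (\<integral>\<^sup>+ y. ennreal ?n * (\<Sum>t\<leftarrow>deriv_terms q is. G t y) \<partial>lborel)"
  proof (rule nn_integral_mono)
    fix y
    let ?Q = "\<Sum>t\<leftarrow>deriv_terms q is. (hterm t y)\<^sup>2"
    have G: "(\<Sum>t\<leftarrow>ts. G t y) = ennreal ((\<Sum>t\<leftarrow>ts. (hterm t y)\<^sup>2) * wt \<eta> y)" if "y \<in> V" for ts
    proof (induction ts)
      case (Cons t ts)
      have "0 \<le> (\<Sum>t\<leftarrow>ts. (hterm t y)\<^sup>2)" by (rule sum_list_nonneg) auto
      with Cons show ?case
        using that by (simp add: G_def ennreal_plus[symmetric] distrib_right del: ennreal_plus)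
    qed simp
    have "ennreal ((hsum is y)\<^sup>2 * wt \<eta> y)
        \<le> ennreal (?n * (?Q * wt \<eta> y))"
      unfolding mult.assoc[symmetric] by (intro ennreal_leI mult_right_mono sum_list_squared_le wt_nonneg)
    also have "\<dots> = ennreal ?n * ennreal (?Q * wt \<eta> y)"
      by (rule ennreal_mult') simp
    finally show "ennreal ((hsum is y)\<^sup>2 * wt \<eta> y) * indicator V y
        \<le> ennreal ?n * (\<Sum>t\<leftarrow>deriv_terms q is. G t y)"
      by (cases "y \<in> V") (simp_all add: G)
  qed
  also have "\<dots> = ennreal ?n * ?J (deriv_terms q is)"
    by (rule nn_integral_cmult) (use S in simp)
  also have "\<dots> \<le> ennreal ?n * ennreal (?n * B \<eta>)"
    by (intro mult_left_mono) (use S in auto)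
  also have "\<dots> = ennreal (?n\<^sup>2 * B \<eta>)"
    by (simp add: ennreal_mult'[symmetric] power2_eq_square mult.assoc)
  also have "\<dots> \<le> ennreal (L\<^sup>2 * B \<eta>)"
    by (intro ennreal_leI mult_right_mono power_mono L B_nonneg le') simp
  finally show ?thesis .
qed

definition bulk_energy :: "('a \<Rightarrow> nat) \<Rightarrow> ennreal" where
  "bulk_energy \<eta> = (\<integral>\<^sup>+ z. ennreal (\<bar>D (mcons 0 \<eta>) \<theta> z\<bar>\<^sup>2 * mixed_weight \<psi> \<rho> (mcons 0 \<eta>) z) \<partial>lborel)"

text \<open>For each \<open>y\<close> the squared integral is bounded by
  \<open>lowint_square_le\<close>; integrating against the weight in \<open>y\<close> and applying
  Tonelli gives the summand of the norm of \<theta>.\<close>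

lemma bulk_bound:
  assumes "q = 0" "count_list is \<le> \<nu>"
  shows "energy_on_V (bulk is) (count_list is) \<le> bulk_energy (count_list is)"
proof -
  let ?\<eta> = "count_list is"
  let ?k = "D (mcons 0 ?\<eta>) \<theta>"
  interpret K: lower_integral \<rho> ?k by (rule lower_integral_D[OF assms])
  have 1: "(\<integral>\<^sup>+ t. ennreal (\<rho> t) \<partial>lborel) = 1" using density by (simp add: probability_density_def)
  have [measurable]: "\<rho> \<in> borel_measurable borel" using density by (simp add: probability_density_def)
  have [measurable]: "?k \<in> borel_measurable borel" by (rule borel_measurable_continuous_onI[OF K.k_cont])
  have [measurable]: "mixed_weight \<psi> \<rho> (mcons 0 ?\<eta>) \<in> borel_measurable borel"
    by (rule mixed_weight_measurable) (use psi_measurable in auto)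
  have "continuous_on UNIV (\<lambda>\<sigma>. ?k (vcons \<sigma> y))" for y
    by (intro continuous_on_compose2[OF K.k_cont] continuous_intros) auto
  note [measurable] = borel_measurable_continuous_onI[OF this]
  have "energy_on_V (bulk is) ?\<eta>
      \<le> (\<integral>\<^sup>+ y. \<integral>\<^sup>+ s. ennreal (\<bar>?k (vcons s y)\<bar>\<^sup>2 * mixed_weight \<psi> \<rho> (mcons 0 ?\<eta>) (vcons s y)) \<partial>lborel \<partial>lborel)"
  proof (rule nn_integral_mono)
    fix y
    have "ennreal ((bulk is y)\<^sup>2 * wt ?\<eta> y) = ennreal ((bulk is y)\<^sup>2) * ennreal (wt ?\<eta> y)"
      by (rule ennreal_mult') simp
    also have "\<dots> \<le> (\<integral>\<^sup>+ s. ennreal ((?k (vcons s y))\<^sup>2 * \<rho> s) \<partial>lborel) * ennreal (wt ?\<eta> y)"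
      unfolding bulk_cases(1)[OF assms(1)] by (intro mult_right_mono K.lowint_square_le[OF 1]) simp
    also have "\<dots> = (\<integral>\<^sup>+ s. ennreal ((?k (vcons s y))\<^sup>2 * \<rho> s) * ennreal (wt ?\<eta> y) \<partial>lborel)"
      by (rule nn_integral_multc[symmetric]) simp
    also have "\<dots> = (\<integral>\<^sup>+ s. ennreal (\<bar>?k (vcons s y)\<bar>\<^sup>2 * mixed_weight \<psi> \<rho> (mcons 0 ?\<eta>) (vcons s y)) \<partial>lborel)"
      using rho_nonneg by (simp add: mixed_weight_mcons ennreal_mult'[symmetric] mult_ac)
    finally show "ennreal ((bulk is y)\<^sup>2 * wt ?\<eta> y) * indicator V y
        \<le> (\<integral>\<^sup>+ s. ennreal (\<bar>?k (vcons s y)\<bar>\<^sup>2 * mixed_weight \<psi> \<rho> (mcons 0 ?\<eta>) (vcons s y)) \<partial>lborel)"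
      by (auto simp: indicator_def)
  qed
  also have "\<dots> = bulk_energy ?\<eta>"
    unfolding bulk_energy_def by (rule nn_integral_vcons[symmetric]) simp
  finally show ?thesis .
qed

text \<open>The inequality (a + b)^2 \<le> 2 a^2 + 2 b^2 is the origin of both factors 2 in the
  first bound.\<close>

lemma W_split_bound:
  assumes le: "count_list is \<le> \<nu>" and L: "real (length (deriv_terms q is)) \<le> L"
  defines "\<eta> \<equiv> count_list is"
  shows "energy (W is) \<eta>
    \<le> 2 * energy_on_V (bulk is) \<eta> + ennreal (2 * L\<^sup>2 * B \<eta>)"
proof -
  have cH: "continuous_on V (hsum is)"
    using hterm_continuous[OF adm_deriv_terms[OF q] le] unfolding continuous_on_def
    by (auto intro!: tendsto_sum_list)
  note mb = measurable_on_V[OF bulk_continuous[OF le], of \<eta>] and mh = measurable_on_V[OF cH, of \<eta>]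
  have "energy (W is) \<eta>
      \<le> (\<integral>\<^sup>+ y. 2 * (ennreal ((bulk is y)\<^sup>2 * wt \<eta> y) * indicator V y)
          + 2 * (ennreal ((hsum is y)\<^sup>2 * wt \<eta> y) * indicator V y) \<partial>lborel)"
  proof (rule nn_integral_mono)
    fix y
    have "(bulk is y + hsum is y)\<^sup>2 \<le> 2 * (bulk is y)\<^sup>2 + 2 * (hsum is y)\<^sup>2"
      using sum_squares_bound[of "bulk is y" "hsum is y"] by (simp add: power2_sum)
    then have "(bulk is y + hsum is y)\<^sup>2 * wt \<eta> y \<le> (2 * (bulk is y)\<^sup>2 + 2 * (hsum is y)\<^sup>2) * wt \<eta> y"
      by (rule mult_right_mono) simp
    then have "ennreal ((bulk is y + hsum is y)\<^sup>2 * wt \<eta> y) \<le> ennreal (2 * ((bulk is y)\<^sup>2 * wt \<eta> y) + 2 * ((hsum is y)\<^sup>2 * wt \<eta> y))"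
      by (intro ennreal_leI) (simp add: algebra_simps)
    also have "\<dots> = 2 * ennreal ((bulk is y)\<^sup>2 * wt \<eta> y) + 2 * ennreal ((hsum is y)\<^sup>2 * wt \<eta> y)"
      by (simp add: ennreal_plus ennreal_mult')
    finally show "ennreal (\<bar>W is y\<bar>\<^sup>2 * wt \<eta> y) \<le> 2 * (ennreal ((bulk is y)\<^sup>2 * wt \<eta> y) * indicator V y)
          + 2 * (ennreal ((hsum is y)\<^sup>2 * wt \<eta> y) * indicator V y)"
      by (cases "y \<in> V") (simp_all add: W_def)
  qed
  also have "\<dots> = 2 * energy_on_V (bulk is) \<eta>
      + 2 * energy_on_V (hsum is) \<eta>"
    using mb mh by (simp add: nn_integral_add nn_integral_cmult)
  also have "\<dots> \<le> 2 * energy_on_V (bulk is) \<eta> + 2 * ennreal (L\<^sup>2 * B \<eta>)"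
    unfolding \<eta>_def by (intro add_mono mult_left_mono hterm_sum_bound le L) simp_all
  also have "2 * ennreal (L\<^sup>2 * B \<eta>) = ennreal (2 * L\<^sup>2 * B \<eta>)"
    by (simp add: ennreal_mult' mult.assoc)
  finally show ?thesis .
qed

text \<open>Without the integral there is nothing to split and no factor 2. This covers the delta
  function, and constant \<theta> at every nonzero order.\<close>

lemma W_bound_no_bulk:
  assumes le: "count_list is \<le> \<nu>" and L: "real (length (deriv_terms q is)) \<le> L"
    and bulk: "\<And>y. bulk is y = 0"
  shows "energy (W is) (count_list is) \<le> ennreal (L\<^sup>2 * B (count_list is))"
proof -
  have "energy (W is) (count_list is)
      = energy_on_V (hsum is) (count_list is)"
    by (intro nn_integral_cong) (auto simp: W_def bulk indicator_def)
  also have "\<dots> \<le> ennreal (L\<^sup>2 * B (count_list is))" by (rule hterm_sum_bound[OF le L])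
  finally show ?thesis .
qed

text \<open>At order zero with \<open>q = 0\<close> there are no terms \<open>h_fun\<close>, so
  again no factor 2 arises; for constant \<theta> this matters, as the right-hand side is then
  1.\<close>

lemma W_Nil_bound:
  assumes "q = 0"
  shows "energy (W []) (\<lambda>_. 0) \<le> bulk_energy (\<lambda>_. 0)"
proof -
  have c: "count_list [] = (\<lambda>_ :: 'a. 0)" by (simp add: fun_eq_iff)
  have "deriv_terms q ([] :: 'a list) = []" using assms by simp
  then have H: "(\<Sum>t\<leftarrow>deriv_terms q []. hterm t y) = 0" for y
    by (simp only: list.map sum_list.Nil)
  have "energy (W []) (\<lambda>_. 0)
      = energy_on_V (bulk []) (\<lambda>_. 0)"
    by (intro nn_integral_cong) (simp del: deriv_terms.simps add: W_def H indicator_def)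
  also have "\<dots> \<le> bulk_energy (\<lambda>_. 0)"
    using bulk_bound[OF assms, of "[]"] unfolding c by (simp add: le_fun_def)
  finally show ?thesis .
qed

end

lemma sobolev_sqnorm_le:
  assumes f: "f \<in> C_mixed \<nu>" and \<gamma>: "\<And>u. \<gamma> u > 0"
    and c: "\<And>\<eta>. \<eta> \<le> \<nu> \<Longrightarrow> 0 \<le> c \<eta>"
      "\<And>\<eta>. \<eta> \<le> \<nu> \<Longrightarrow> (\<integral>\<^sup>+ y. ennreal (\<bar>D \<eta> f y\<bar>\<^sup>2 * mixed_weight \<psi> \<rho> \<eta> y) \<partial>lborel) \<le> ennreal (c \<eta>)"
  shows "sobolev_sqnorm \<gamma> \<psi> \<rho> \<nu> f \<le> ennreal (\<Sum>\<eta>\<in>{\<eta>. \<eta> \<le> \<nu>}. c \<eta> / \<gamma> {i. \<eta> i \<noteq> 0})"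
proof -
  let ?E = "\<lambda>\<eta>. \<integral>\<^sup>+ y. ennreal (\<bar>D \<eta> f y\<bar>\<^sup>2 * mixed_weight \<psi> \<rho> \<eta> y) \<partial>lborel"
  let ?g = "\<lambda>\<eta>. ennreal (1 / \<gamma> {i. \<eta> i \<noteq> 0})" and ?r = "\<lambda>\<eta>. ennreal (c \<eta> / \<gamma> {i. \<eta> i \<noteq> 0})"
  have "sobolev_sqnorm \<gamma> \<psi> \<rho> \<nu> f \<le> (\<Sum>\<eta>\<in>{\<eta>. \<eta> \<le> \<nu>}. ?r \<eta>)"
    unfolding sobolev_sqnorm_C_mixed[OF f]
  proof (rule sum_mono)
    fix \<eta> assume "\<eta> \<in> {\<eta>. \<eta> \<le> \<nu>}"
    then have le: "\<eta> \<le> \<nu>" by simp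
    have "?g \<eta> * ?E \<eta>
        \<le> ?g \<eta> * ennreal (c \<eta>)"
      by (intro mult_left_mono c le) simp
    also have "\<dots> = ?r \<eta>"
      using c(1)[OF le] by (simp add: ennreal_mult''[symmetric])
    finally show "?g \<eta> * ?E \<eta>
        \<le> ?r \<eta>" .
  qed
  also have "\<dots> = ennreal (\<Sum>\<eta>\<in>{\<eta>. \<eta> \<le> \<nu>}. c \<eta> / \<gamma> {i. \<eta> i \<noteq> 0})"
    by (rule sum_ennreal) (use c(1) \<gamma> in \<open>auto simp: less_imp_le\<close>)
  finally show ?thesis .
qed

lemma (in preintegration_bounds) W_sobolev:
  assumes \<gamma>: "\<And>u. \<gamma> u > 0" and c: "\<And>\<eta>. \<eta> \<le> \<nu> \<Longrightarrow> 0 \<le> c \<eta>"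
    and bound: "\<And>is. count_list is \<le> \<nu> \<Longrightarrow>
      energy (W is) (count_list is) \<le> ennreal (c (count_list is))"
  shows "W [] \<in> sobolev_drop0 \<gamma> \<psi> \<rho> \<nu> \<inter> C_mixed \<nu>" (is ?thesis1)
    "sobolev_drop0_norm \<gamma> \<psi> \<rho> \<nu> (W []) \<le> sqrt (\<Sum>\<eta>\<in>{\<eta>. \<eta> \<le> \<nu>}. c \<eta> / \<gamma> (Some ` {i. \<eta> i \<noteq> 0}))" (is ?thesis2)
proof -
  have "sobolev_sqnorm (drop0_weights \<gamma>) (drop0 \<psi>) \<rho> \<nu> (W [])
      \<le> ennreal (\<Sum>\<eta>\<in>{\<eta>. \<eta> \<le> \<nu>}. c \<eta> / \<gamma> (Some ` {i. \<eta> i \<noteq> 0}))"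
  proof (rule sobolev_sqnorm_le[OF W_C_mixed \<gamma> c])
    fix \<eta> assume "\<eta> \<le> \<nu>"
    from D_W[OF this] obtain "is" where "is": "count_list is = \<eta>" "D \<eta> (W []) = W is" .
    show "energy (D \<eta> (W [])) \<eta> \<le> ennreal (c \<eta>)"
      using bound[of "is"] \<open>\<eta> \<le> \<nu>\<close> unfolding "is" by simp
  qed
  moreover have "0 \<le> (\<Sum>\<eta>\<in>{\<eta>. \<eta> \<le> \<nu>}. c \<eta> / \<gamma> (Some ` {i. \<eta> i \<noteq> 0}))"
    by (intro sum_nonneg divide_nonneg_pos \<gamma> c) auto
  ultimately show ?thesis1 ?thesis2
    unfolding sobolev_drop0_def sobolev_drop0_norm_def
    using sobolev_C_mixedI[OF W_C_mixed] W_C_mixed by auto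
qed

section \<open>Identification of the preintegrated functions\<close>

text \<open>By monotonicity \<phi> \<le> x holds on the line over \<open>y\<close> exactly up to
  \<xi>, and nowhere if \<open>y\<close> lies outside \<open>V\<close>.\<close>

lemma (in preintegration) P0_ind_eq_W:
  assumes q0: "q = 0"
  shows "P0 \<rho> (\<lambda>z. \<theta> z * ind (x - \<phi> z)) = W []"
proof
  fix y
  have H: "(\<Sum>t\<leftarrow>deriv_terms q []. hterm t y) = 0" using q0 by simp
  have c: "mcons 0 (count_list []) = (\<lambda>_ :: 'd option. 0)" by (simp add: fun_eq_iff split_option_all)
  show "P0 \<rho> (\<lambda>z. \<theta> z * ind (x - \<phi> z)) y = W [] y"
  proof (cases "y \<in> V")
    case True
    have i: "ind (x - \<phi> (vcons s y)) = indicator {..xi \<phi> x y} s" for s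
      using phi_less_iff[of "xi \<phi> x y" y s] phi_xi[OF True] by (auto simp: ind_def indicator_def)
    have "P0 \<rho> (\<lambda>z. \<theta> z * ind (x - \<phi> z)) y = lowint \<rho> \<theta> (xi \<phi> x y) y"
      unfolding P0_def lowint_def set_lebesgue_integral_def i
      by (intro Bochner_Integration.integral_cong) (auto simp: indicator_def)
    then show ?thesis
      unfolding W_def if_P[OF True] H bulk_cases(1)[OF q0] c by simp
  next
    case False
    then have "ind (x - \<phi> (vcons s y)) = 0" for s
      using phi_gt_outside[OF False, of s] by (simp add: ind_def)
    then show ?thesis by (simp add: P0_def W_def False)
  qed
qed

text \<open>The chain rule in the level gives \<rho>(\<xi>) / D_0 \<phi>. The single term of order
  zero for \<open>q = 1\<close> carries \<theta> as an additional factor, and \<theta> = 1 makes the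
  two agree.\<close>

lemma (in preintegration) P0_delta_eq_W:
  assumes q1: "q = 1" and \<theta>: "\<theta> = (\<lambda>_. 1)" and \<rho>: "probability_density \<rho>"
  shows "P0_delta \<rho> \<phi> x = W []"
proof
  fix y
  show "P0_delta \<rho> \<phi> x y = W [] y"
  proof (cases "y \<in> V")
    case True
    interpret K: lower_integral \<rho> "\<lambda>_ :: real ^ 'd option. 1"
      by unfold_locales (use rho_cont[of 0] rho_nonneg uniform_lower_tail_const[OF \<rho>] in auto)
    have "distr_fun \<rho> = (\<lambda>s. lowint \<rho> (\<lambda>_. 1) s y)"
      by (rule ext) (rule distr_fun_eq_lowint[OF \<rho>])
    then have "(distr_fun \<rho> has_real_derivative \<rho> t) (at t)" for t
      using K.lowint_derivative[of y t] by simp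
    from DERIV_chain2[OF this xi_derivative_level[OF True]]
    have "P0_delta \<rho> \<phi> x y = \<rho> (xi \<phi> x y) * inverse (partial None \<phi> (pt y))"
      using True by (simp add: P0_delta_def DERIV_imp_deriv pt_def)
    moreover have "W [] y = \<rho> (xi \<phi> x y) * inverse (partial None \<phi> (pt y))"
    proof -
      have "deriv_terms q ([] :: 'd list) = [([], 0, \<lambda>_. 0)]" using q1 by simp
      moreover have "bulk [] y = 0" using bulk_cases(2)[of "[]"] q1 by simp
      ultimately have "W [] y = hterm ([], 0, \<lambda>_. 0) y"
        unfolding W_def if_P[OF True] by (simp only: list.map sum_list.Cons sum_list.Nil)
      then show ?thesis
        unfolding hterm_eq by (simp add: q1 \<theta> D_munit inverse_eq_divide)
    qed
    ultimately show ?thesis by simp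
  qed (simp add: P0_delta_def W_def)
qed

section \<open>Assembly of the bounds\<close>

lemma sum_multi_indices_split:
  fixes f :: "('n::finite \<Rightarrow> nat) \<Rightarrow> real"
  shows "(\<Sum>\<eta>\<in>{\<eta>. \<eta> \<le> \<nu>}. f \<eta>) = f (\<lambda>_. 0) + (\<Sum>\<eta>\<in>{\<eta>. \<eta> \<noteq> (\<lambda>_. 0) \<and> \<eta> \<le> \<nu>}. f \<eta>)"
proof -
  have "{\<eta>. \<eta> \<le> \<nu>} - {\<lambda>_. 0} = {\<eta>. \<eta> \<noteq> (\<lambda>_. 0) \<and> \<eta> \<le> \<nu>}" by auto
  moreover have "(\<lambda>_. 0) \<in> {\<eta>. \<eta> \<le> \<nu>}" by (simp add: le_fun_def)
  ultimately show ?thesis using sum.remove[OF finite_multi_indices, of "\<lambda>_. 0" \<nu> f] by simp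
qed

text \<open>The multi-indices below \<open>mcons 0 \<nu>\<close> are those that ignore y0, and their
  supports are images under \<open>Some\<close>; thus the norm of \<theta> uses the same weights as
  the space without y0.\<close>

lemma sobolev_sqnorm_mcons_0:
  fixes \<theta> :: "real ^ ('d::finite option) \<Rightarrow> real"
  assumes "\<theta> \<in> C_mixed (mcons 0 \<nu>)"
  shows "sobolev_sqnorm \<gamma> \<psi> \<rho> (mcons 0 \<nu>) \<theta> = (\<Sum>\<eta>\<in>{\<eta>. \<eta> \<le> \<nu>}. ennreal (1 / \<gamma> (Some ` {i. \<eta> i \<noteq> 0})) *
    (\<integral>\<^sup>+ z. ennreal (\<bar>D (mcons 0 \<eta>) \<theta> z\<bar>\<^sup>2 * mixed_weight \<psi> \<rho> (mcons 0 \<eta>) z) \<partial>lborel))"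
proof -
  have *: "{\<mu>. \<mu> \<le> mcons 0 \<nu>} = mcons 0 ` {\<eta>. \<eta> \<le> \<nu>}"
  proof (intro set_eqI iffI)
    fix \<mu> assume "\<mu> \<in> {\<mu>. \<mu> \<le> mcons 0 \<nu>}"
    then have "\<mu> = mcons 0 (\<lambda>i. \<mu> (Some i))" "(\<lambda>i. \<mu> (Some i)) \<le> \<nu>"
      by (auto simp: mcons_le_iff le_fun_def fun_eq_iff split_option_all)
    then show "\<mu> \<in> mcons 0 ` {\<eta>. \<eta> \<le> \<nu>}" by blast
  next
    fix \<mu> assume "\<mu> \<in> mcons 0 ` {\<eta>. \<eta> \<le> \<nu>}"
    then obtain \<eta> where "\<mu> = mcons 0 \<eta>" "\<eta> \<le> \<nu>" by auto
    then show "\<mu> \<in> {\<mu>. \<mu> \<le> mcons 0 \<nu>}" by (simp add: mcons_le_iff le_funD)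
  qed
  have inj: "inj_on (mcons 0) {\<eta>. \<eta> \<le> \<nu>}"
    by (rule inj_onI) (metis ext mcons_simps(2))
  have s: "{i. mcons 0 \<eta> i \<noteq> 0} = Some ` {i. \<eta> i \<noteq> 0}" for \<eta> :: "'d \<Rightarrow> nat"
  proof (rule set_eqI)
    fix i show "i \<in> {i. mcons 0 \<eta> i \<noteq> 0} \<longleftrightarrow> i \<in> Some ` {i. \<eta> i \<noteq> 0}" by (cases i) auto
  qed
  show ?thesis
    unfolding sobolev_sqnorm_C_mixed[OF assms] * sum.reindex[OF inj] comp_def s ..
qed

lemma sobolev_mono:
  fixes h :: "real ^ 'n::finite \<Rightarrow> real"
  assumes h: "h \<in> sobolev \<gamma> \<psi> \<rho> \<nu>" and le: "\<eta> \<le> \<nu>"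
  shows "h \<in> sobolev \<gamma> \<psi> \<rho> \<eta>"
proof -
  have "sobolev_sqnorm \<gamma> \<psi> \<rho> \<eta> h \<le> sobolev_sqnorm \<gamma> \<psi> \<rho> \<nu> h"
    unfolding sobolev_sqnorm_def by (rule sum_mono2[OF finite_multi_indices]) (use le in auto)
  with h le show ?thesis unfolding sobolev_def by (auto intro: order.strict_trans1 order_trans)
qed

text \<open>The memberships next to the bounds give the norms their meaning, since an infinite
  square norm would be turned into 0. In the second part the summand of order zero is 1 /
  \<open>\<gamma> {}\<close>, which is the 1 of the bound for \<open>\<gamma> {} = 1\<close>. In the
  third part \<theta> = 1 identifies the functions of Assumption 2 for q = 1 with those arising from
  \<rho> / D_0 \<phi>.\<close>

theorem theorem2:
  fixes \<rho> :: "real \<Rightarrow> real"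
    and \<gamma> :: "'d::finite option set \<Rightarrow> real"
    and \<psi> :: "'d option \<Rightarrow> real \<Rightarrow> real"
    and \<nu> :: "'d \<Rightarrow> nat"
    and \<theta> \<phi> :: "real ^ ('d option) \<Rightarrow> real"
    and B :: "nat \<Rightarrow> ('d \<Rightarrow> nat) \<Rightarrow> real"
    and a b x :: real
  assumes "CARD('d) \<ge> 2"
    and "probability_density \<rho>"
    and "\<forall>i. weight_function \<rho> (\<psi> i)"
    and "\<forall>u. \<gamma> u > 0"
    and "assumption1 \<gamma> \<psi> \<rho> \<nu> \<theta> \<phi>"
    and "\<forall>q\<in>{0, 1}. \<forall>\<eta>\<le>\<nu>. assumption2 \<psi> \<rho> \<theta> \<phi> a b q \<eta> (B q \<eta>)"
    and "x \<in> {a..b}"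
  shows
    "(uniform_lower_tails \<rho> \<nu> \<theta> \<longrightarrow>
       P0 \<rho> (\<lambda>z. \<theta> z * ind (x - \<phi> z)) \<in> sobolev_drop0 \<gamma> \<psi> \<rho> \<nu> \<inter> C_mixed \<nu> \<and>
       \<theta> \<in> sobolev \<gamma> \<psi> \<rho> (mcons 0 \<nu>) \<and>
       sobolev_drop0_norm \<gamma> \<psi> \<rho> \<nu> (P0 \<rho> (\<lambda>z. \<theta> z * ind (x - \<phi> z)))
         \<le> sqrt (2 * (sobolev_norm \<gamma> \<psi> \<rho> (mcons 0 \<nu>) \<theta>)\<^sup>2
             + 2 * (\<Sum>\<eta>\<in>{\<eta>. \<eta> \<noteq> (\<lambda>_. 0) \<and> \<eta> \<le> \<nu>}.
                 (8 ^ (mabs \<eta> - 1) * fact (mabs \<eta> - 1))\<^sup>2 * B 0 \<eta> / \<gamma> (Some ` {i. \<eta> i \<noteq> 0}))))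
   \<and> (\<theta> = (\<lambda>_. 1) \<longrightarrow>
       P0 \<rho> (\<lambda>z. \<theta> z * ind (x - \<phi> z)) \<in> sobolev_drop0 \<gamma> \<psi> \<rho> \<nu> \<inter> C_mixed \<nu> \<and>
       (\<gamma> {} = 1 \<longrightarrow>
         sobolev_drop0_norm \<gamma> \<psi> \<rho> \<nu> (P0 \<rho> (\<lambda>z. \<theta> z * ind (x - \<phi> z)))
         \<le> sqrt (1 + (\<Sum>\<eta>\<in>{\<eta>. \<eta> \<noteq> (\<lambda>_. 0) \<and> \<eta> \<le> \<nu>}.
                 (8 ^ (mabs \<eta> - 1) * fact (mabs \<eta> - 1))\<^sup>2 * B 0 \<eta> / \<gamma> (Some ` {i. \<eta> i \<noteq> 0})))))
   \<and> (\<theta> = (\<lambda>_. 1) \<longrightarrow>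
       P0_delta \<rho> \<phi> x \<in> sobolev_drop0 \<gamma> \<psi> \<rho> \<nu> \<inter> C_mixed \<nu> \<and>
       sobolev_drop0_norm \<gamma> \<psi> \<rho> \<nu> (P0_delta \<rho> \<phi> x)
         \<le> sqrt (\<Sum>\<eta>\<in>{\<eta>. \<eta> \<le> \<nu>}.
                 (8 ^ mabs \<eta> * fact (mabs \<eta>))\<^sup>2 * B 1 \<eta> / \<gamma> (Some ` {i. \<eta> i \<noteq> 0})))"
proof -
  note density = assms(2)
  have \<gamma>: "\<gamma> u > 0" for u using assms(4) by blast
  have rho_nonneg: "0 \<le> \<rho> t" for t using density by (simp add: probability_density_def)
  have psi: "\<psi> i \<in> borel_measurable borel" "0 \<le> \<psi> i t" for i t
    using assms(3) by (auto simp: weight_function_def)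
  have pos: "\<And>z. D (munit None) \<phi> z > 0"
    and top: "\<And>y. filterlim (\<lambda>s. \<phi> (vcons s y)) at_top at_top"
    and theta: "\<theta> \<in> sobolev \<gamma> \<psi> \<rho> (mcons (mabs \<nu> + 1) \<nu>)" "\<theta> \<in> C_mixed (mcons (mabs \<nu> + 1) \<nu>)"
    and phi_C: "\<phi> \<in> C_mixed (mcons (mabs \<nu> + 1) \<nu>)" and rho_C: "\<rho> \<in> C_real (mabs \<nu>)"
    using assms(5) by (auto simp: assumption1_def Let_def)
  have A2: "0 \<le> B q \<eta>"
      "h_admissible q \<eta> \<alpha>s \<beta> \<mu> \<Longrightarrow> p \<in> frontier (U \<phi> x) \<Longrightarrow>
        (h_fun \<rho> \<theta> \<phi> q \<alpha>s \<beta> \<mu> x \<longlongrightarrow> 0) (at p within U \<phi> x)"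
      "h_admissible q \<eta> \<alpha>s \<beta> \<mu> \<Longrightarrow> (\<integral>\<^sup>+ y\<in>U \<phi> x.
        ennreal (\<bar>h_fun \<rho> \<theta> \<phi> q \<alpha>s \<beta> \<mu> x y\<bar>\<^sup>2 * mixed_weight (drop0 \<psi>) \<rho> \<eta> y) \<partial>lborel) \<le> ennreal (B q \<eta>)"
    if "q \<le> 1" "\<eta> \<le> \<nu>" for q \<eta> \<alpha>s \<beta> \<mu> p
  proof -
    have "q \<in> {0, 1}" using that(1) by auto
    then have A: "assumption2 \<psi> \<rho> \<theta> \<phi> a b q \<eta> (B q \<eta>)" using assms(6) that(2) by blast
    then show "0 \<le> B q \<eta>" by (simp add: assumption2_def)
    show "(h_fun \<rho> \<theta> \<phi> q \<alpha>s \<beta> \<mu> x \<longlongrightarrow> 0) (at p within U \<phi> x)"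
      if "h_admissible q \<eta> \<alpha>s \<beta> \<mu>" "p \<in> frontier (U \<phi> x)"
      using A that assms(7) unfolding assumption2_def by blast
    assume "h_admissible q \<eta> \<alpha>s \<beta> \<mu>"
    then have "(SUP x\<in>{a..b}. \<integral>\<^sup>+ y\<in>U \<phi> x.
        ennreal (\<bar>h_fun \<rho> \<theta> \<phi> q \<alpha>s \<beta> \<mu> x y\<bar>\<^sup>2 * mixed_weight (drop0 \<psi>) \<rho> \<eta> y) \<partial>lborel) \<le> ennreal (B q \<eta>)"
      using A unfolding assumption2_def by blast
    then show "(\<integral>\<^sup>+ y\<in>U \<phi> x.
        ennreal (\<bar>h_fun \<rho> \<theta> \<phi> q \<alpha>s \<beta> \<mu> x y\<bar>\<^sup>2 * mixed_weight (drop0 \<psi>) \<rho> \<eta> y) \<partial>lborel) \<le> ennreal (B q \<eta>)"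
      by (rule order_trans[OF SUP_upper[OF assms(7)]])
  qed
  interpret level_sets \<phi>
  proof
    have m: "madd None (\<lambda>_. 0) \<le> mcons (mabs \<nu> + 1) \<nu>" by (simp add: mcons_le_iff)
    have e: "madd None (\<lambda>_. 0) = munit None" by (auto simp: munit_def fun_eq_iff)
    show "partial_differentiable None \<phi>" using partial_D(1)[OF phi_C m] by simp
    show "continuous_on UNIV \<phi>" using C_mixedD(1)[OF phi_C, of "[]"] by simp
    show "continuous_on UNIV (partial None \<phi>)"
      using continuous_on_D[OF phi_C m] unfolding e D_munit .
    show "partial None \<phi> z > 0" for z using pos by (simp add: D_munit)
  qed (rule top)
  have bounds: "preintegration_bounds \<phi> \<rho> \<theta> \<nu> x q \<psi> (B q)"
    if "q \<le> 1" "q = 0 \<Longrightarrow> uniform_lower_tails \<rho> \<nu> \<theta>" for q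
    by unfold_locales (use that A2[OF that(1)] theta phi_C rho_C rho_nonneg psi density in \<open>simp_all\<close>)
  define N0 :: "('d \<Rightarrow> nat) \<Rightarrow> real" where "N0 \<eta> = 8 ^ (mabs \<eta> - 1) * fact (mabs \<eta> - 1)" for \<eta>
  define N1 :: "('d \<Rightarrow> nat) \<Rightarrow> real" where "N1 \<eta> = 8 ^ mabs \<eta> * fact (mabs \<eta>)" for \<eta>
  have N0: "real (length (deriv_terms 0 is)) \<le> N0 (count_list is)" if "is \<noteq> []" for "is"
    using of_nat_mono[OF length_deriv_terms_0[OF that], where 'a=real] by (simp add: N0_def mabs_count_list)
  have N1: "real (length (deriv_terms 1 is)) \<le> N1 (count_list is)" for "is"
    using of_nat_mono[OF length_deriv_terms_1[of "is"], where 'a=real] by (simp add: N1_def mabs_count_list)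
  have Nil_iff: "count_list is = (\<lambda>_. 0) \<longleftrightarrow> is = []" for "is" :: "'d list"
    by (cases "is") (auto simp: fun_eq_iff)
  let ?w = "\<lambda>\<eta>. \<gamma> (Some ` {i :: 'd. \<eta> i \<noteq> (0::nat)})"
  let ?S0 = "\<Sum>\<eta>\<in>{\<eta>. \<eta> \<noteq> (\<lambda>_. 0) \<and> \<eta> \<le> \<nu>}. (N0 \<eta>)\<^sup>2 * B 0 \<eta> / ?w \<eta>"
  let ?P = "P0 \<rho> (\<lambda>z. \<theta> z * ind (x - \<phi> z))"
  let ?T = "sobolev_sqnorm \<gamma> \<psi> \<rho> (mcons 0 \<nu>) \<theta>"
  have i: "?P \<in> sobolev_drop0 \<gamma> \<psi> \<rho> \<nu> \<inter> C_mixed \<nu> \<and>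
       \<theta> \<in> sobolev \<gamma> \<psi> \<rho> (mcons 0 \<nu>) \<and>
       sobolev_drop0_norm \<gamma> \<psi> \<rho> \<nu> ?P
         \<le> sqrt (2 * (sobolev_norm \<gamma> \<psi> \<rho> (mcons 0 \<nu>) \<theta>)\<^sup>2
             + 2 * ?S0)"
    if "uniform_lower_tails \<rho> \<nu> \<theta>"
  proof -
    interpret preintegration_bounds \<phi> \<rho> \<theta> \<nu> x 0 \<psi> "B 0" by (rule bounds) (use that in auto)
    have le0: "mcons 0 \<nu> \<le> mcons (mabs \<nu> + 1) \<nu>" by (simp add: mcons_le_iff)
    have sob: "\<theta> \<in> sobolev \<gamma> \<psi> \<rho> (mcons 0 \<nu>)" by (rule sobolev_mono[OF theta(1) le0])
    have S: "?T = (\<Sum>\<eta>\<in>{\<eta>. \<eta> \<le> \<nu>}. ennreal (1 / ?w \<eta>) * bulk_energy \<eta>)"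
      unfolding bulk_energy_def by (rule sobolev_sqnorm_mcons_0[OF C_mixed_mono[OF theta(2) le0]])
    have S_fin: "?T < \<infinity>" using sob by (simp add: sobolev_def)
    define k where "k \<eta> = enn2real (bulk_energy \<eta>)" for \<eta>
    have k_nonneg: "0 \<le> k \<eta>" for \<eta> by (simp add: k_def)
    \<comment> \<open>The factor 1 / \<gamma> is nonzero, so finiteness of the weighted summand
      passes to \<open>bulk_energy\<close>; only then can the sums be taken over reals.\<close>
    have k: "bulk_energy \<eta> = ennreal (k \<eta>)" if "\<eta> \<le> \<nu>" for \<eta>
    proof -
      have "ennreal (1 / ?w \<eta>) * bulk_energy \<eta> \<le> ?T"
        unfolding S by (rule member_le_sum) (use that finite_multi_indices in auto)
      then have "ennreal (1 / ?w \<eta>) * bulk_energy \<eta> < \<infinity>" using S_fin by (rule order.strict_trans1)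
      moreover have "ennreal (1 / ?w \<eta>) \<noteq> 0"
        using \<gamma>[of "Some ` {i. \<eta> i \<noteq> 0}"] by (simp add: ennreal_eq_0_iff not_le)
      ultimately have "bulk_energy \<eta> < \<infinity>" by (auto simp: ennreal_mult_less_top)
      then show ?thesis by (simp add: k_def)
    qed
    have "?T = (\<Sum>\<eta>\<in>{\<eta>. \<eta> \<le> \<nu>}. ennreal (k \<eta> / ?w \<eta>))"
      unfolding S using \<gamma>
      by (intro sum.cong refl) (simp add: k k_nonneg ennreal_mult''[symmetric])
    also have "\<dots> = ennreal (\<Sum>\<eta>\<in>{\<eta>. \<eta> \<le> \<nu>}. k \<eta> / ?w \<eta>)"
      by (rule sum_ennreal) (use \<gamma> in \<open>auto simp: k_nonneg less_imp_le\<close>)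
    finally have norm: "(sobolev_norm \<gamma> \<psi> \<rho> (mcons 0 \<nu>) \<theta>)\<^sup>2 = (\<Sum>\<eta>\<in>{\<eta>. \<eta> \<le> \<nu>}. k \<eta> / ?w \<eta>)"
      unfolding sobolev_norm_def using \<gamma> by (simp add: sum_nonneg k_nonneg less_imp_le)
    \<comment> \<open>At order zero \<open>k\<close> alone would bound the energy; taking
      \<open>2 * k\<close> at every order makes these parts sum to exactly twice the squared norm of
      \<theta>.\<close>
    define c where "c \<eta> = 2 * k \<eta> + (if \<eta> = (\<lambda>_. 0) then 0 else 2 * (N0 \<eta>)\<^sup>2 * B 0 \<eta>)" for \<eta>
    have c_nonneg: "0 \<le> c \<eta>" if "\<eta> \<le> \<nu>" for \<eta>
      using B_nonneg[OF that] by (simp add: c_def k_nonneg)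
    have c_bound: "energy (W is) (count_list is) \<le> ennreal (c (count_list is))"
      if le: "count_list is \<le> \<nu>" for "is"
    proof (cases "is = []")
      case True
      then have c0: "count_list is = (\<lambda>_. 0)" by (simp add: Nil_iff)
      have "energy (W is) (count_list is) \<le> bulk_energy (\<lambda>_. 0)"
        using W_Nil_bound True unfolding c0 by simp
      also have "\<dots> = ennreal (k (\<lambda>_. 0))" by (rule k) (simp add: le_fun_def)
      also have "\<dots> \<le> ennreal (c (count_list is))"
        unfolding c0 by (intro ennreal_leI) (simp add: c_def k_nonneg)
      finally show ?thesis .
    next
      case False
      have "energy (W is) (count_list is)
          \<le> 2 * energy_on_V (bulk is) (count_list is)
            + ennreal (2 * (N0 (count_list is))\<^sup>2 * B 0 (count_list is))"
        by (rule W_split_bound[OF le N0[OF False]])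
      also have "\<dots> \<le> 2 * ennreal (k (count_list is)) + ennreal (2 * (N0 (count_list is))\<^sup>2 * B 0 (count_list is))"
        unfolding k[OF le, symmetric] by (intro add_mono mult_left_mono bulk_bound le) simp_all
      also have "\<dots> = ennreal (c (count_list is))"
        using B_nonneg[OF le] False by (simp add: c_def Nil_iff ennreal_plus ennreal_mult' k_nonneg)
      finally show ?thesis .
    qed
    have "(\<Sum>\<eta>\<in>{\<eta>. \<eta> \<le> \<nu>}. c \<eta> / ?w \<eta>) = 2 * (\<Sum>\<eta>\<in>{\<eta>. \<eta> \<le> \<nu>}. k \<eta> / ?w \<eta>)
        + (\<Sum>\<eta>\<in>{\<eta>. \<eta> \<le> \<nu>}. if \<eta> = (\<lambda>_. 0) then 0 else 2 * ((N0 \<eta>)\<^sup>2 * B 0 \<eta> / ?w \<eta>))"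
      unfolding sum_distrib_left sum.distrib[symmetric]
      by (intro sum.cong refl) (simp add: c_def add_divide_distrib)
    also have "(\<Sum>\<eta>\<in>{\<eta>. \<eta> \<le> \<nu>}. if \<eta> = (\<lambda>_. 0) then 0 else 2 * ((N0 \<eta>)\<^sup>2 * B 0 \<eta> / ?w \<eta>))
        = 2 * ?S0"
      unfolding sum_multi_indices_split sum_distrib_left if_P[OF refl] add_0
      by (rule sum.cong) auto
    finally have "(\<Sum>\<eta>\<in>{\<eta>. \<eta> \<le> \<nu>}. c \<eta> / ?w \<eta>) = 2 * (sobolev_norm \<gamma> \<psi> \<rho> (mcons 0 \<nu>) \<theta>)\<^sup>2
        + 2 * ?S0"
      unfolding norm .
    with W_sobolev[of \<gamma> c, OF \<gamma> c_nonneg c_bound] sob show ?thesis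
      unfolding P0_ind_eq_W[OF refl] by simp
  qed
  have ii: "sobolev_drop0_norm \<gamma> \<psi> \<rho> \<nu> ?P
         \<le> sqrt (1 + ?S0)"
    if \<theta>: "\<theta> = (\<lambda>_. 1)" and \<gamma>1: "\<gamma> {} = 1"
  proof -
    interpret preintegration_bounds \<phi> \<rho> \<theta> \<nu> x 0 \<psi> "B 0"
      by (rule bounds) (use uniform_lower_tails_const[OF density] \<theta> in auto)
    \<comment> \<open>At order zero \<open>1\<close> is the mass of the product density. At the
      other orders the derivative of \<theta> under the integral vanishes.\<close>
    define c where "c \<eta> = (if \<eta> = (\<lambda>_. 0) then 1 else (N0 \<eta>)\<^sup>2 * B 0 \<eta>)" for \<eta>
    have c_nonneg: "0 \<le> c \<eta>" if "\<eta> \<le> \<nu>" for \<eta>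
      using B_nonneg[OF that] by (simp add: c_def)
    have c_bound: "energy (W is) (count_list is) \<le> ennreal (c (count_list is))"
      if le: "count_list is \<le> \<nu>" for "is"
    proof (cases "is = []")
      case True
      then have c0: "count_list is = (\<lambda>_. 0)" by (simp add: Nil_iff)
      have m0: "mcons 0 (\<lambda>_ :: 'd. 0) = (\<lambda>_. 0)" by (simp add: fun_eq_iff split_option_all)
      have "energy (W is) (count_list is) \<le> bulk_energy (\<lambda>_. 0)"
        using W_Nil_bound True unfolding c0 by simp
      also have "\<dots> = 1"
        unfolding bulk_energy_def m0 using nn_integral_mixed_weight_0[OF density] by (simp add: \<theta>)
      finally show ?thesis unfolding c0 by (simp add: c_def)
    next
      case False
      have "mcons 0 (count_list is) \<noteq> (\<lambda>_. 0)"
        using False Nil_iff[of "is"] by (metis ext mcons_simps(2))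
      then have "bulk is y = 0" for y
        unfolding bulk_cases(1)[OF refl] by (simp add: \<theta> D_const lowint_def)
      from W_bound_no_bulk[OF le N0[OF False] this] show ?thesis
        using False by (simp add: c_def Nil_iff)
    qed
    have "(\<Sum>\<eta>\<in>{\<eta>. \<eta> \<le> \<nu>}. c \<eta> / ?w \<eta>)
        = 1 + ?S0"
      unfolding sum_multi_indices_split by (rule arg_cong2[where f="(+)"]) (simp add: c_def \<gamma>1, rule sum.cong, auto simp: c_def)
    with W_sobolev(2)[of \<gamma> c, OF \<gamma> c_nonneg c_bound] show ?thesis
      unfolding P0_ind_eq_W[OF refl] by simp
  qed
  have iii: "P0_delta \<rho> \<phi> x \<in> sobolev_drop0 \<gamma> \<psi> \<rho> \<nu> \<inter> C_mixed \<nu> \<and>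
       sobolev_drop0_norm \<gamma> \<psi> \<rho> \<nu> (P0_delta \<rho> \<phi> x) \<le> sqrt (\<Sum>\<eta>\<in>{\<eta>. \<eta> \<le> \<nu>}. (N1 \<eta>)\<^sup>2 * B 1 \<eta> / ?w \<eta>)"
    if \<theta>: "\<theta> = (\<lambda>_. 1)"
  proof -
    interpret preintegration_bounds \<phi> \<rho> \<theta> \<nu> x 1 \<psi> "B 1" by (rule bounds) auto
    have nonneg: "0 \<le> (N1 \<eta>)\<^sup>2 * B 1 \<eta>" if "\<eta> \<le> \<nu>" for \<eta> using B_nonneg[OF that] by simp
    have "bulk is y = 0" for "is" y using bulk_cases(2)[of "is"] by simp
    from W_sobolev[of \<gamma> "\<lambda>\<eta>. (N1 \<eta>)\<^sup>2 * B 1 \<eta>", OF \<gamma> nonneg W_bound_no_bulk[OF _ N1 this]] show ?thesis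
      unfolding P0_delta_eq_W[OF refl \<theta> density] by simp
  qed
  show ?thesis
    using i ii iii uniform_lower_tails_const[OF density, of \<nu>] unfolding N0_def N1_def by blast
qed

end
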